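(* Let $\mathcal G$ be a connected noncompact metric graph with finitely many edges (its compact core may be empty or non-empty), let $p>2$, and let $A:\mathcal G\to\mathbb R$, $V:\mathcal G\to[1,+\infty)$ satisfy $A\in L^2_{\rm loc}(\mathcal G,\mathbb R)$, $V\in L^1_{\rm loc}(\mathcal G,\mathbb R)$. Assume that there exist $m\ge1$ (possibly $m=+\infty$) distinct eigenvalues of $D_A^2+V(x)$ below $\inf\sigma_{\rm ess}(D_A^2+V(x))$, i.e. $D_A^2+V(x)$ has an increasing sequence of $m$ eigenvalues $1\le\lambda_1<\lambda_2<\dots<\lambda_j<\dots$ with $\lambda_j<\inf\sigma_{\rm ess}(D_A^2+V(x))$ for every $j$. Then there exists $\mu_0^*>0$ depending on $\mathcal G,p,A,V$ such that, for any $0<\mu\le\mu_0^*$, $E(\cdot,\mathcal G)$ has a critical point $u\in H^1_A(\mathcal G,\mathbb C)$ constrained on $H_\mu(\mathcal G)$, with Lagrange multiplier $\lambda\in[0,\lambda_1)$.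
   Context: Metric graphs: each bounded edge $e$ of $\mathcal G=(\mathrm V,\mathrm E)$ is identified with $I_e=[0,\ell_e]$, $\ell_e>0$, each unbounded edge with $I_e=[0,+\infty)$; the compact core is the metric subgraph consisting of all bounded edges. A function $u:\mathcal G\to\mathbb C$ is identified with the family $(u_e)_{e\in\mathrm E}$, $u_e:I_e\to\mathbb C$; $L^p(\mathcal G,\mathbb C)=\bigoplus_e L^p(I_e,\mathbb C)$ with norm $\|\cdot\|_p$. $A\in L^2_{\rm loc}$, $V\in L^1_{\rm loc}$ mean $A\in L^2(B)$, $V\in L^1(B)$ for every bounded $B\subset\mathcal G$. Magnetic Sobolev space: $D_A=\frac1i\frac{d}{dx}-A(x)$ (edgewise, weak derivative), $H^1_A(\mathcal G,\mathbb C)=\{u\in C(\mathcal G,\mathbb C): D_Au\in L^2(\mathcal G,\mathbb C),\ \int_{\mathcal G}V|u|^2dx<+\infty\}$, with $\|u\|^2=\int_{\mathcal G}(|D_Au|^2+V|u|^2)dx$ and real inner products $(u,v)=\operatorname{Re}\int_{\mathcal G}(D_Au\overline{D_Av}+Vu\bar v)dx$, $(u,v)_2=\operatorname{Re}\int_{\mathcal G}u\bar v\,dx$. Operator: $D_A^2+V(x)$ denotes the unique self-adjoint operator $T$ in the complex Hilbert space $L^2(\mathcal G,\mathbb C)$ with $\operatorname{dom}(T)\subset H^1_A(\mathcal G,\mathbb C)$ and $\int_{\mathcal G}(D_Au\overline{D_Av}+Vu\bar v)dx=\int_{\mathcal G}(Tu)\bar v\,dx$ for all $u\in\operatorname{dom}(T)$,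 $v\in H^1_A(\mathcal G,\mathbb C)$. $\sigma_{\rm ess}$ is its essential spectrum, with $\inf\emptyset=+\infty$. The symbol $\lambda_1$ always denotes $\inf_{u\in H^1_A\setminus\{0\}}\|u\|^2/\|u\|_2^2$ (here it is the first eigenvalue). Energy (nonlinearity on the whole graph): $E(u,\mathcal G)=\frac12\|u\|^2-\frac1p\int_{\mathcal G}|u|^pdx$ on $H^1_A(\mathcal G,\mathbb C)$. For $\mu>0$, $H_\mu(\mathcal G)=\{u\in H^1_A(\mathcal G,\mathbb C):\int_{\mathcal G}|u|^2dx=\mu\}$. $u\in H_\mu(\mathcal G)$ is a critical point of $E(\cdot,\mathcal G)$ constrained on $H_\mu(\mathcal G)$ with Lagrange multiplier $\lambda\in\mathbb R$ if $(u,v)-\operatorname{Re}\int_{\mathcal G}|u|^{p-2}u\bar v\,dx=\lambda(u,v)_2$ for all $v\in H^1_A(\mathcal G,\mathbb C)$. *)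

theory Defs
  imports "HOL-Analysis.Analysis" "HOL-Library.Extended_Nat"
begin

section \<open>Metric graphs\<close>

text \<open>
  Loops and multiple edges are allowed. An edge \<open>e\<close> is identified with
  \<open>{0..len e}\<close>, where \<open>0\<close> is glued to the vertex \<open>tail e\<close> and \<open>len e\<close> to \<open>head e\<close>.
  An unbounded edge has \<open>len e = \<infinity>\<close>; its \<open>head\<close> carries no information.
\<close>

record ('v, 'e) mgraph =
  verts :: "'v set"
  edges :: "'e set"
  tail :: "'e \<Rightarrow> 'v"
  head :: "'e \<Rightarrow> 'v"
  len :: "'e \<Rightarrow> ereal"

definition bounded_edges :: "('v, 'e) mgraph \<Rightarrow> 'e set" where
  "bounded_edges G = {e \<in> edges G. len G e < \<infinity>}"

definition metric_graph :: "('v, 'e) mgraph \<Rightarrow> bool" where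
  "metric_graph G \<longleftrightarrow>
     (\<forall>e\<in>edges G. 0 < len G e \<and> tail G e \<in> verts G) \<and>
     (\<forall>e\<in>bounded_edges G. head G e \<in> verts G)"

definition edge_interval :: "('v, 'e) mgraph \<Rightarrow> 'e \<Rightarrow> real set" where
  "edge_interval G e = {x. 0 \<le> x \<and> ereal x \<le> len G e}"

definition adjacency :: "('v, 'e) mgraph \<Rightarrow> 'v rel" where
  "adjacency G = {(tail G e, head G e) | e. e \<in> bounded_edges G}"

definition connected_graph :: "('v, 'e) mgraph \<Rightarrow> bool" where
  "connected_graph G \<longleftrightarrow>
     (\<forall>v\<in>verts G. \<forall>w\<in>verts G. (v, w) \<in> (adjacency G \<union> (adjacency G)\<inverse>)\<^sup>*)"

text \<open>With finitely many edges, noncompactness means having an unbounded edge.\<close>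

definition noncompact_graph :: "('v, 'e) mgraph \<Rightarrow> bool" where
  "noncompact_graph G \<longleftrightarrow> (\<exists>e\<in>edges G. len G e = \<infinity>)"


section \<open>Functions on a metric graph\<close>

text \<open>
  A function on the graph is a family indexed by the edges; only the values on the
  intervals \<open>edge_interval G e\<close> with \<open>e \<in> edges G\<close> are meaningful. Integrals are
  only used for graphs with finitely many edges.
\<close>

type_synonym ('e, 'a) gfun = "'e \<Rightarrow> real \<Rightarrow> 'a"

definition gmeasurable ::
    "('v, 'e) mgraph \<Rightarrow> ('e, 'a::real_normed_vector) gfun \<Rightarrow> bool" where
  "gmeasurable G f \<longleftrightarrow>
     (\<forall>e\<in>edges G. set_borel_measurable lebesgue (edge_interval G e) (f e))"

definition gintegrable ::
    "('v, 'e) mgraph \<Rightarrow> ('e, 'a::{banach, second_countable_topology}) gfun \<Rightarrow> bool" where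
  "gintegrable G f \<longleftrightarrow> (\<forall>e\<in>edges G. set_integrable lebesgue (edge_interval G e) (f e))"

definition gintegral ::
    "('v, 'e) mgraph \<Rightarrow> ('e, 'a::{banach, second_countable_topology}) gfun \<Rightarrow> 'a" where
  "gintegral G f = (\<Sum>e\<in>edges G. LINT x:edge_interval G e|lebesgue. f e x)"

definition ae_eq :: "('v, 'e) mgraph \<Rightarrow> ('e, 'a) gfun \<Rightarrow> ('e, 'a) gfun \<Rightarrow> bool" where
  "ae_eq G f g \<longleftrightarrow>
     (\<forall>e\<in>edges G. AE x in lebesgue. x \<in> edge_interval G e \<longrightarrow> f e x = g e x)"

text \<open>
  Local integrability refers to bounded subsets of the graph, so it includes
  integrability up to the vertices.
\<close>

definition L1_loc :: "('v, 'e) mgraph \<Rightarrow> ('e, real) gfun set" where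
  "L1_loc G = {f. gmeasurable G f \<and>
     (\<forall>e\<in>edges G. \<forall>B\<in>sets lebesgue. bounded B \<and> B \<subseteq> edge_interval G e \<longrightarrow>
        set_integrable lebesgue B (f e))}"

definition L2_loc :: "('v, 'e) mgraph \<Rightarrow> ('e, real) gfun set" where
  "L2_loc G = {f. gmeasurable G f \<and>
     (\<forall>e\<in>edges G. \<forall>B\<in>sets lebesgue. bounded B \<and> B \<subseteq> edge_interval G e \<longrightarrow>
        set_integrable lebesgue B (\<lambda>x. (f e x)\<^sup>2))}"

text \<open>
  \<open>L2 G\<close> consists of representatives: elements are to be identified along \<open>ae_eq G\<close>.
\<close>

definition L2 :: "('v, 'e) mgraph \<Rightarrow> ('e, complex) gfun set" where
  "L2 G = {f. gmeasurable G f \<and> gintegrable G (\<lambda>e x. (cmod (f e x))\<^sup>2)}"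

definition L2_inner ::
    "('v, 'e) mgraph \<Rightarrow> ('e, complex) gfun \<Rightarrow> ('e, complex) gfun \<Rightarrow> complex" where
  "L2_inner G f g = gintegral G (\<lambda>e x. f e x * cnj (g e x))"

definition L2_norm :: "('v, 'e) mgraph \<Rightarrow> ('e, complex) gfun \<Rightarrow> real" where
  "L2_norm G f = sqrt (gintegral G (\<lambda>e x. (cmod (f e x))\<^sup>2))"

definition gcontinuous :: "('v, 'e) mgraph \<Rightarrow> ('e, complex) gfun \<Rightarrow> bool" where
  "gcontinuous G u \<longleftrightarrow>
     (\<forall>e\<in>edges G. continuous_on (edge_interval G e) (u e)) \<and>
     (\<exists>val. (\<forall>e\<in>edges G. u e 0 = val (tail G e)) \<and>
            (\<forall>e\<in>bounded_edges G. u e (real_of_ereal (len G e)) = val (head G e)))"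


section \<open>The magnetic Sobolev space\<close>

text \<open>
  Continuously differentiable test functions with compact support in the interior of
  \<open>I\<close>. In dimension one they yield the same weak derivatives as smooth test functions;
  this is the convention of Brezis' textbook.
\<close>

definition test_function :: "real set \<Rightarrow> (real \<Rightarrow> real) \<Rightarrow> (real \<Rightarrow> real) \<Rightarrow> bool" where
  "test_function I \<phi> \<phi>' \<longleftrightarrow>
     (\<forall>x. (\<phi> has_real_derivative \<phi>' x) (at x)) \<and> continuous_on UNIV \<phi>' \<and>
     (\<exists>K. compact K \<and> K \<subseteq> interior I \<and> (\<forall>x. x \<notin> K \<longrightarrow> \<phi> x = 0))"

definition locally_integrable :: "real set \<Rightarrow> (real \<Rightarrow> complex) \<Rightarrow> bool" where
  "locally_integrable I f \<longleftrightarrow>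
     (\<forall>K. compact K \<and> K \<subseteq> interior I \<longrightarrow> set_integrable lebesgue K f)"

definition has_weak_deriv :: "real set \<Rightarrow> (real \<Rightarrow> complex) \<Rightarrow> (real \<Rightarrow> complex) \<Rightarrow> bool" where
  "has_weak_deriv I f g \<longleftrightarrow> locally_integrable I f \<and> locally_integrable I g \<and>
     (\<forall>\<phi> \<phi>'. test_function I \<phi> \<phi>' \<longrightarrow>
        (LINT x:I|lebesgue. \<phi>' x *\<^sub>R f x) = - (LINT x:I|lebesgue. \<phi> x *\<^sub>R g x))"

text \<open>A representative: the weak derivative is unique only almost everywhere on \<open>I\<close>.\<close>

definition weak_deriv :: "real set \<Rightarrow> (real \<Rightarrow> complex) \<Rightarrow> real \<Rightarrow> complex" where
  "weak_deriv I f = (SOME g. has_weak_deriv I f g)"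

definition mag_deriv ::
    "('v, 'e) mgraph \<Rightarrow> ('e, real) gfun \<Rightarrow> ('e, complex) gfun \<Rightarrow> ('e, complex) gfun" where
  "mag_deriv G A u =
     (\<lambda>e x. (1 / \<i>) * weak_deriv (edge_interval G e) (u e) x - of_real (A e x) * u e x)"

definition H1 ::
    "('v, 'e) mgraph \<Rightarrow> ('e, real) gfun \<Rightarrow> ('e, real) gfun \<Rightarrow> ('e, complex) gfun set" where
  "H1 G A V = {u. gcontinuous G u \<and>
     (\<forall>e\<in>edges G. \<exists>g. has_weak_deriv (edge_interval G e) (u e) g) \<and>
     mag_deriv G A u \<in> L2 G \<and> gintegrable G (\<lambda>e x. V e x * (cmod (u e x))\<^sup>2)}"

definition mag_form ::
    "('v, 'e) mgraph \<Rightarrow> ('e, real) gfun \<Rightarrow> ('e, real) gfun \<Rightarrow>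
     ('e, complex) gfun \<Rightarrow> ('e, complex) gfun \<Rightarrow> complex" where
  "mag_form G A V u v =
     gintegral G (\<lambda>e x. mag_deriv G A u e x * cnj (mag_deriv G A v e x)
                        + of_real (V e x) * u e x * cnj (v e x))"

definition H1_inner ::
    "('v, 'e) mgraph \<Rightarrow> ('e, real) gfun \<Rightarrow> ('e, real) gfun \<Rightarrow>
     ('e, complex) gfun \<Rightarrow> ('e, complex) gfun \<Rightarrow> real" where
  "H1_inner G A V u v = Re (mag_form G A V u v)"

definition H1_norm ::
    "('v, 'e) mgraph \<Rightarrow> ('e, real) gfun \<Rightarrow> ('e, real) gfun \<Rightarrow> ('e, complex) gfun \<Rightarrow> real" where
  "H1_norm G A V u =
     sqrt (gintegral G (\<lambda>e x. (cmod (mag_deriv G A u e x))\<^sup>2 + V e x * (cmod (u e x))\<^sup>2))"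


section \<open>Self-adjoint operators and their spectra\<close>

text \<open>
  An operator in \<open>L2 G\<close> is given by its graph, a set of pairs of representatives that
  is closed under changes on null sets and single-valued up to null sets.
\<close>

type_synonym 'e operator = "(('e, complex) gfun \<times> ('e, complex) gfun) set"

definition linear_operator :: "('v, 'e) mgraph \<Rightarrow> 'e operator \<Rightarrow> bool" where
  "linear_operator G T \<longleftrightarrow>
     T \<subseteq> L2 G \<times> L2 G \<and>
     (\<forall>(u, f)\<in>T. \<forall>u'\<in>L2 G. \<forall>f'\<in>L2 G. ae_eq G u u' \<and> ae_eq G f f' \<longrightarrow> (u', f') \<in> T) \<and>
     (\<forall>(u, f)\<in>T. \<forall>(u', f')\<in>T. ae_eq G u u' \<longrightarrow> ae_eq G f f') \<and>
     (\<lambda>e x. 0, \<lambda>e x. 0) \<in> T \<and>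
     (\<forall>(u, f)\<in>T. \<forall>(v, g)\<in>T. (\<lambda>e x. u e x + v e x, \<lambda>e x. f e x + g e x) \<in> T) \<and>
     (\<forall>(u, f)\<in>T. \<forall>c. (\<lambda>e x. c * u e x, \<lambda>e x. c * f e x) \<in> T)"

definition densely_defined :: "('v, 'e) mgraph \<Rightarrow> 'e operator \<Rightarrow> bool" where
  "densely_defined G T \<longleftrightarrow>
     (\<forall>g\<in>L2 G. \<forall>\<epsilon>>0. \<exists>u\<in>Domain T. L2_norm G (\<lambda>e x. g e x - u e x) < \<epsilon>)"

definition adjoint_operator :: "('v, 'e) mgraph \<Rightarrow> 'e operator \<Rightarrow> 'e operator" where
  "adjoint_operator G T =
     {(v, g) \<in> L2 G \<times> L2 G. \<forall>(u, f)\<in>T. L2_inner G f v = L2_inner G u g}"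

definition self_adjoint :: "('v, 'e) mgraph \<Rightarrow> 'e operator \<Rightarrow> bool" where
  "self_adjoint G T \<longleftrightarrow>
     linear_operator G T \<and> densely_defined G T \<and> adjoint_operator G T = T"

definition resolvent_set :: "('v, 'e) mgraph \<Rightarrow> 'e operator \<Rightarrow> complex set" where
  "resolvent_set G T = {z.
     (\<forall>g\<in>L2 G. \<exists>(u, f)\<in>T. ae_eq G (\<lambda>e x. f e x - z * u e x) g) \<and>
     (\<exists>C. \<forall>(u, f)\<in>T. L2_norm G u \<le> C * L2_norm G (\<lambda>e x. f e x - z * u e x))}"

definition spectrum :: "('v, 'e) mgraph \<Rightarrow> 'e operator \<Rightarrow> complex set" where
  "spectrum G T = - resolvent_set G T"

definition eigenspace :: "'e operator \<Rightarrow> complex \<Rightarrow> ('e, complex) gfun set" where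
  "eigenspace T z = {u. (u, \<lambda>e x. z * u e x) \<in> T}"

definition eigenvalue :: "('v, 'e) mgraph \<Rightarrow> 'e operator \<Rightarrow> complex \<Rightarrow> bool" where
  "eigenvalue G T z \<longleftrightarrow> (\<exists>u\<in>eigenspace T z. \<not> ae_eq G u (\<lambda>e x. 0))"

definition finite_multiplicity :: "('v, 'e) mgraph \<Rightarrow> 'e operator \<Rightarrow> complex \<Rightarrow> bool" where
  "finite_multiplicity G T z \<longleftrightarrow>
     (\<exists>B. finite B \<and> B \<subseteq> eigenspace T z \<and>
        (\<forall>u\<in>eigenspace T z. \<exists>c. ae_eq G u (\<lambda>e x. \<Sum>b\<in>B. c b * b e x)))"

definition discrete_spectrum :: "('v, 'e) mgraph \<Rightarrow> 'e operator \<Rightarrow> complex set" where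
  "discrete_spectrum G T =
     {z. z isolated_in spectrum G T \<and> eigenvalue G T z \<and> finite_multiplicity G T z}"

definition essential_spectrum :: "('v, 'e) mgraph \<Rightarrow> 'e operator \<Rightarrow> complex set" where
  "essential_spectrum G T = spectrum G T - discrete_spectrum G T"

text \<open>Self-adjoint operators have real spectrum; the infimum is \<open>\<infinity>\<close> if there is none.\<close>

definition inf_essential_spectrum :: "('v, 'e) mgraph \<Rightarrow> 'e operator \<Rightarrow> ereal" where
  "inf_essential_spectrum G T =
     Inf (ereal ` {t. complex_of_real t \<in> essential_spectrum G T})"


section \<open>The magnetic Schroedinger operator\<close>

text \<open>
  \<open>T\<close> is the operator \<open>D\<^sub>A\<^sup>2 + V\<close>. An element of the domain is only determined up to
  null sets, so membership in \<open>H1 G A V\<close> is asserted of its continuous representative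
  \<open>w\<close>.
\<close>

definition magnetic_schroedinger ::
    "('v, 'e) mgraph \<Rightarrow> ('e, real) gfun \<Rightarrow> ('e, real) gfun \<Rightarrow> 'e operator \<Rightarrow> bool" where
  "magnetic_schroedinger G A V T \<longleftrightarrow> self_adjoint G T \<and>
     (\<forall>(u, f)\<in>T. \<exists>w\<in>H1 G A V. ae_eq G u w \<and>
        (\<forall>v\<in>H1 G A V. mag_form G A V w v = L2_inner G f v))"

lemma gintegral_cong_ae:
  assumes "gmeasurable G f" "gmeasurable G g" "ae_eq G f g"
  shows "gintegral G f = gintegral G g"
  unfolding gintegral_def
proof (rule sum.cong)
  fix e assume e: "e \<in> edges G"
  have "AE x in lebesgue. x \<in> edge_interval G e \<longrightarrow> f e x = g e x"
    using assms(3) e by (auto simp: ae_eq_def)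
  then have ae: "AE x in lebesgue. indicator (edge_interval G e) x *\<^sub>R f e x
                   = indicator (edge_interval G e) x *\<^sub>R g e x"
    by (rule eventually_mono) (auto simp: indicator_def)
  show "(LINT x:edge_interval G e|lebesgue. f e x) = (LINT x:edge_interval G e|lebesgue. g e x)"
    unfolding set_lebesgue_integral_def
    using assms(1,2) e
    by (intro integral_cong_AE ae) (auto simp: gmeasurable_def set_borel_measurable_def)
qed simp

lemma edge_interval_lebesgue: "edge_interval G e \<in> sets lebesgue"
proof -
  have "closed (edge_interval G e)"
    unfolding edge_interval_def Collect_conj_eq
    by (intro closed_Int closed_Collect_le continuous_intros)
  then show ?thesis by auto
qed

lemma gmeasurable_mult_cnj:
  fixes f g :: "('e, complex) gfun"
  assumes "gmeasurable G f" "gmeasurable G g"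
  shows "gmeasurable G (\<lambda>e x. f e x * cnj (g e x))"
  unfolding gmeasurable_def
proof
  fix e assume e: "e \<in> edges G"
  let ?I = "edge_interval G e"
  have f: "(\<lambda>x. indicator ?I x *\<^sub>R f e x) \<in> borel_measurable lebesgue"
   and g: "(\<lambda>x. indicator ?I x *\<^sub>R g e x) \<in> borel_measurable lebesgue"
    using assms e by (auto simp: gmeasurable_def set_borel_measurable_def)
  have "cnj \<in> borel_measurable borel"
    by (intro borel_measurable_continuous_onI continuous_intros)
  then have g': "(\<lambda>x. cnj (indicator ?I x *\<^sub>R g e x)) \<in> borel_measurable lebesgue"
    using measurable_compose[OF g] by blast
  have "(\<lambda>x. indicator ?I x *\<^sub>R (f e x * cnj (g e x)))
     = (\<lambda>x. (indicator ?I x *\<^sub>R f e x) * cnj (indicator ?I x *\<^sub>R g e x))"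
    by (auto simp: indicator_def fun_eq_iff)
  then show "set_borel_measurable lebesgue ?I (\<lambda>x. f e x * cnj (g e x))"
    unfolding set_borel_measurable_def using borel_measurable_times[OF f g'] by simp
qed

lemma gcontinuous_gmeasurable:
  assumes "gcontinuous G u"
  shows "gmeasurable G u"
  unfolding gmeasurable_def set_borel_measurable_def
proof
  fix e assume "e \<in> edges G"
  then have "continuous_on (edge_interval G e) (u e)"
    using assms by (auto simp: gcontinuous_def)
  then have "u e \<in> borel_measurable (lebesgue_on (edge_interval G e))"
    by (rule continuous_imp_measurable_on_sets_lebesgue) (rule edge_interval_lebesgue)
  then show "(\<lambda>x. indicator (edge_interval G e) x *\<^sub>R u e x) \<in> borel_measurable lebesgue"
    by (subst (asm) borel_measurable_restrict_space_iff)
       (auto simp: edge_interval_lebesgue)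
qed

lemma L2_inner_cong_ae:
  assumes "gmeasurable G f" "gmeasurable G u" "gmeasurable G w" "ae_eq G u w"
  shows "L2_inner G f u = L2_inner G f w"
  unfolding L2_inner_def
  by (intro gintegral_cong_ae gmeasurable_mult_cnj assms)
     (use assms(4) in \<open>auto simp: ae_eq_def elim!: eventually_mono\<close>)

lemma gintegral_cnj: "gintegral G (\<lambda>e x. cnj (f e x)) = cnj (gintegral G f)"
  unfolding gintegral_def cnj_sum
proof (rule sum.cong)
  fix e
  have "(\<lambda>x. indicator (edge_interval G e) x *\<^sub>R cnj (f e x))
      = (\<lambda>x. cnj (indicator (edge_interval G e) x *\<^sub>R f e x))" by auto
  then show "(LINT x:edge_interval G e|lebesgue. cnj (f e x))
           = cnj (LINT x:edge_interval G e|lebesgue. f e x)"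
    unfolding set_lebesgue_integral_def by (simp only: Bochner_Integration.integral_cnj)
qed simp

lemma L2_inner_cnj: "L2_inner G f g = cnj (L2_inner G g f)"
  unfolding L2_inner_def by (subst gintegral_cnj[symmetric]) (simp add: mult.commute)

lemma mag_form_cnj: "mag_form G A V u v = cnj (mag_form G A V v u)"
  unfolding mag_form_def by (subst gintegral_cnj[symmetric]) (simp add: mult.commute mult.left_commute)

lemma magnetic_schroedinger_unique:
  assumes "magnetic_schroedinger G A V T" "magnetic_schroedinger G A V T'"
  shows "T = T'"
proof -
  have sub: "S \<subseteq> S'" if S: "magnetic_schroedinger G A V S" and S': "magnetic_schroedinger G A V S'" for S S'
  proof clarify
    fix u f assume uf: "(u, f) \<in> S"
    have L: "S \<subseteq> L2 G \<times> L2 G" "S' \<subseteq> L2 G \<times> L2 G"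
      using S S' by (auto simp: magnetic_schroedinger_def self_adjoint_def linear_operator_def)
    obtain w where w: "w \<in> H1 G A V" "ae_eq G u w"
        "\<And>v. v \<in> H1 G A V \<Longrightarrow> mag_form G A V w v = L2_inner G f v"
      using S uf unfolding magnetic_schroedinger_def by fast
    have "(u, f) \<in> adjoint_operator G S'"
      unfolding adjoint_operator_def
    proof clarsimp
      show "u \<in> L2 G \<and> f \<in> L2 G \<and> (\<forall>(v, g)\<in>S'. L2_inner G g u = L2_inner G v f)"
      proof (intro conjI ballI, goal_cases)
        case (3 vg)
        obtain v g where vg: "vg = (v, g)" by fastforce
        with 3 have "(v, g) \<in> S'" by simp
        then obtain z where z: "z \<in> H1 G A V" "ae_eq G v z"
            "\<And>y. y \<in> H1 G A V \<Longrightarrow> mag_form G A V z y = L2_inner G g y"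
          using S' unfolding magnetic_schroedinger_def by fast
        have m: "gmeasurable G u" "gmeasurable G f" "gmeasurable G v" "gmeasurable G g"
          using L uf \<open>(v, g) \<in> S'\<close> by (auto simp: L2_def)
        have mw: "gmeasurable G w" "gmeasurable G z"
          using w(1) z(1) by (auto simp: H1_def gcontinuous_gmeasurable)
        have "L2_inner G g u = L2_inner G g w" by (intro L2_inner_cong_ae m mw w)
        also have "\<dots> = mag_form G A V z w" using z(3) w(1) by simp
        also have "\<dots> = cnj (mag_form G A V w z)" by (rule mag_form_cnj)
        also have "\<dots> = cnj (L2_inner G f z)" using w(3) z(1) by simp
        also have "L2_inner G f z = L2_inner G f v" by (intro L2_inner_cong_ae[symmetric] m mw z)
        also have "cnj (L2_inner G f v) = L2_inner G v f" by (rule L2_inner_cnj[symmetric])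
        finally show ?case by (simp add: vg)
      qed (use L uf in auto)
    qed
    then show "(u, f) \<in> S'"
      using S' by (simp add: magnetic_schroedinger_def self_adjoint_def)
  qed
  show ?thesis using sub assms by blast
qed

definition lambda1 ::
    "('v, 'e) mgraph \<Rightarrow> ('e, real) gfun \<Rightarrow> ('e, real) gfun \<Rightarrow> real" where
  "lambda1 G A V = Inf {(H1_norm G A V u)\<^sup>2 / (L2_norm G u)\<^sup>2 | u.
     u \<in> H1 G A V \<and> (\<exists>e\<in>edges G. \<exists>x\<in>edge_interval G e. u e x \<noteq> 0)}"

definition mass_sphere ::
    "('v, 'e) mgraph \<Rightarrow> ('e, real) gfun \<Rightarrow> ('e, real) gfun \<Rightarrow> real \<Rightarrow> ('e, complex) gfun set" where
  "mass_sphere G A V \<mu> =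
     {u \<in> H1 G A V. gintegral G (\<lambda>e x. (cmod (u e x))\<^sup>2) = \<mu>}"

text \<open>
  \<open>u\<close> is a critical point, constrained on \<open>mass_sphere G A V \<mu>\<close>, with Lagrange
  multiplier \<open>l\<close>, of the energy \<open>\<parallel>u\<parallel>\<^sup>2 / 2 - (1 / p) \<integral> |u| powr p\<close>.
\<close>

definition constrained_critical_point ::
    "('v, 'e) mgraph \<Rightarrow> ('e, real) gfun \<Rightarrow> ('e, real) gfun \<Rightarrow> real \<Rightarrow> real \<Rightarrow>
     ('e, complex) gfun \<Rightarrow> real \<Rightarrow> bool" where
  "constrained_critical_point G A V p \<mu> u l \<longleftrightarrow> u \<in> mass_sphere G A V \<mu> \<and>
     (\<forall>v\<in>H1 G A V.
        H1_inner G A V u v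
          - Re (gintegral G (\<lambda>e x. of_real (cmod (u e x) powr (p - 2)) * u e x * cnj (v e x)))
        = l * Re (L2_inner G u v))"

end

theory Submission
  imports Defs "HOL-Library.Function_Algebras"
begin

text \<open>
  Write \<open>p = 2 q + 2\<close>. The substitution \<open>u = sqrt \<mu> w\<close> turns the problem at mass \<open>\<mu>\<close> into one at mass \<open>1\<close> in
  which the nonlinearity carries the factor \<open>\<mu> powr q\<close>. At small mass it is therefore a small
  perturbation of the quadratic problem of minimising \<open>\<parallel>u\<parallel>\<^sup>2\<close> on the unit sphere of \<open>L\<^sup>2\<close>, whose infimum is
  \<open>\<lambda>\<^sub>1\<close>. The hypothesis on the eigenvalues puts \<open>\<lambda>\<^sub>1\<close> below the essential spectrum: it is an isolated
  eigenvalue of finite multiplicity, and orthogonally to its eigenspace the energy has a gap above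
  \<open>\<lambda>\<^sub>1\<close> (\<open>resolvent_interval_bound\<close>, \<open>kernel_decomposition\<close>, \<open>spectral_gap\<close>, \<open>kernel_finite_dimensional\<close>).

  The gap replaces concentration compactness. If the perturbation is small compared with the gap, then
  the perturbed functional is still uniformly convex on the sphere in all directions except the finitely
  many of the eigenspace. By the parallelogram identity a minimising sequence, after passing to a
  subsequence, is Cauchy in the energy norm (\<open>midpoint_defect\<close>, \<open>minimizer_exists\<close>), and its limit is a
  minimiser. No mass can escape along the unbounded edges.

  The power \<open>|u|\<^sup>p\<close> is not bounded by a multiple of \<open>|u|\<^sup>2\<close>, so it is continued quadratically
  beyond a threshold \<open>R\<close>. The energy dominates the supremum of \<open>|u|\<^sup>2\<close>, independently of the magnetic potential
  (\<open>modulus_oscillation\<close>, \<open>sup_bound\<close>), and the minimiser has energy at most \<open>\<lambda>\<^sub>1 + 1\<close>; with a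
  suitable \<open>R\<close> the truncation does not affect the equation that it satisfies. The value at the minimiser \<open>w\<close>
  is at most \<open>\<lambda>\<^sub>1\<close>, and the multiplier is smaller than this value because for \<open>p > 2\<close> the nonlinearity is
  strictly superquadratic (\<open>Gam_less\<close>). It is nonnegative because the energy of \<open>w\<close> is at least \<open>1\<close>
  and the perturbation is small.

  Two representations connect this argument with the definitions. Membership in \<open>H\<^sup>1\<^sub>A\<close> is
  expressed by an integral equation for the magnetic derivative (\<open>mag_rep\<close>), obtained from the lemma of
  du Bois-Reymond, which makes the energy space complete (\<open>a_complete\<close>). And by self-adjointness the
  operator contains every pair that satisfies the form identity (\<open>T_I\<close>), which makes it the inverse of the
  solution operator that the Riesz representation theorem provides for the energy form.
\<close>


section \<open>Bilinear forms and Hilbert spaces on subspaces\<close>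

text \<open>
  The first-order condition at a minimum: dividing by \<open>t\<close> and letting \<open>t\<close> tend to \<open>0\<close> from
  either side forces both signs on \<open>D\<close>.
\<close>

lemma linear_coefficient_zero:
  fixes D c :: real
  assumes "0 < r" "\<And>t. \<bar>t\<bar> \<le> r \<Longrightarrow> 0 \<le> t * D + t\<^sup>2 * c"
  shows "D = 0"
proof (rule ccontr)
  assume "D \<noteq> 0"
  (* A step against the sign of D, so short that the linear term beats the quadratic one. *)
  define t where "t = min r (\<bar>D\<bar> / (2 * (\<bar>c\<bar> + 1)))"
  have t: "0 < t" "t \<le> r" "t * \<bar>c\<bar> < \<bar>D\<bar>"
  proof -
    show "0 < t" "t \<le> r" using \<open>D \<noteq> 0\<close> assms(1) by (auto simp: t_def)
    have "t * (\<bar>c\<bar> + 1) \<le> \<bar>D\<bar> / (2 * (\<bar>c\<bar> + 1)) * (\<bar>c\<bar> + 1)"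
      by (intro mult_right_mono) (auto simp: t_def)
    also have "\<dots> = \<bar>D\<bar> / 2" by (simp add: field_simps)
    finally show "t * \<bar>c\<bar> < \<bar>D\<bar>" using \<open>0 < t\<close> \<open>D \<noteq> 0\<close> by (simp add: algebra_simps)
  qed
  have "0 \<le> (- sgn D * t) * D + (- sgn D * t)\<^sup>2 * c"
    using t \<open>D \<noteq> 0\<close> by (intro assms(2)) (simp add: abs_mult abs_sgn_eq)
  also have "\<dots> = t * (t * c - \<bar>D\<bar>)"
    using \<open>D \<noteq> 0\<close> by (simp add: sgn_if power2_eq_square algebra_simps)
  also have "\<dots> < 0"
  proof (rule mult_pos_neg)
    have "t * c \<le> t * \<bar>c\<bar>" using t(1) by (intro mult_left_mono) auto
    then show "t * c - \<bar>D\<bar> < 0" using t(3) by linarith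
  qed (rule t)
  finally show False by simp
qed

lemma minimizing_sequence:
  fixes Q :: "'a \<Rightarrow> real"
  assumes "A \<noteq> {}" "bdd_below (Q ` A)"
  obtains X where "\<And>n. X n \<in> A" "\<And>n. Q (X n) < Inf (Q ` A) + 1 / Suc n"
proof -
  have "\<exists>x\<in>A. Q x < Inf (Q ` A) + 1 / Suc n" for n :: nat
    using cInf_lessD[of "Q ` A" "Inf (Q ` A) + 1 / Suc n"] assms(1) by auto
  then show ?thesis using that by metis
qed

text \<open>
  The Hilbert spaces of the problem depend on the graph and its potentials, so they cannot be
  types. They are carried by a subspace \<open>S\<close> of an ambient vector space, and all forms are real:
  the critical point equation involves only real parts.
\<close>

locale symmetric_form =
  fixes S :: "'a::real_vector set" and f :: "'a \<Rightarrow> 'a \<Rightarrow> real"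
  assumes subsp: "subspace S"
    and add_left: "\<lbrakk>x \<in> S; y \<in> S; z \<in> S\<rbrakk> \<Longrightarrow> f (x + y) z = f x z + f y z"
    and scale_left: "\<lbrakk>x \<in> S; z \<in> S\<rbrakk> \<Longrightarrow> f (c *\<^sub>R x) z = c * f x z"
    and sym: "\<lbrakk>x \<in> S; y \<in> S\<rbrakk> \<Longrightarrow> f x y = f y x"
begin

lemma mem [simp, intro]:
  "0 \<in> S" "x \<in> S \<Longrightarrow> y \<in> S \<Longrightarrow> x + y \<in> S" "x \<in> S \<Longrightarrow> y \<in> S \<Longrightarrow> x - y \<in> S"
  "x \<in> S \<Longrightarrow> c *\<^sub>R x \<in> S" "x \<in> S \<Longrightarrow> - x \<in> S"
  using subsp by (auto simp: subspace_def subspace_diff subspace_neg)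

lemma minus_left: "\<lbrakk>x \<in> S; z \<in> S\<rbrakk> \<Longrightarrow> f (- x) z = - f x z"
  using scale_left[of x z "-1"] by simp

lemma diff_left: "\<lbrakk>x \<in> S; y \<in> S; z \<in> S\<rbrakk> \<Longrightarrow> f (x - y) z = f x z - f y z"
  using add_left[of x "-y" z] by (simp add: minus_left)

lemma zero_left: "z \<in> S \<Longrightarrow> f 0 z = 0"
  using scale_left[of z z 0] by simp

lemma add_right: "\<lbrakk>x \<in> S; y \<in> S; z \<in> S\<rbrakk> \<Longrightarrow> f z (x + y) = f z x + f z y"
  using add_left[of x y z] sym by simp

lemma scale_right: "\<lbrakk>x \<in> S; z \<in> S\<rbrakk> \<Longrightarrow> f z (c *\<^sub>R x) = c * f z x"
  using scale_left[of x z c] sym by simp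

lemma minus_right: "\<lbrakk>x \<in> S; z \<in> S\<rbrakk> \<Longrightarrow> f z (- x) = - f z x"
  using minus_left[of x z] sym by simp

lemma diff_right: "\<lbrakk>x \<in> S; y \<in> S; z \<in> S\<rbrakk> \<Longrightarrow> f z (x - y) = f z x - f z y"
  using diff_left[of x y z] sym by simp

lemma zero_right: "z \<in> S \<Longrightarrow> f z 0 = 0"
  using zero_left[of z] sym by simp

lemmas bilin = add_left scale_left minus_left diff_left zero_left
  add_right scale_right minus_right diff_right zero_right

lemma sum_left: "\<lbrakk>finite B; \<And>i. i \<in> B \<Longrightarrow> g i \<in> S; z \<in> S\<rbrakk> \<Longrightarrow> f (\<Sum>i\<in>B. g i) z = (\<Sum>i\<in>B. f (g i) z)"
proof (induction B rule: finite_induct)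
  case (insert x B)
  then have "(\<Sum>i\<in>B. g i) \<in> S"
    by (intro subspace_sum[OF subsp]) auto
  with insert show ?case by (simp add: add_left)
qed (simp add: zero_left)

end

locale semi_inner = symmetric_form +
  assumes nonneg: "x \<in> S \<Longrightarrow> 0 \<le> f x x"
begin

lemma Cauchy_Schwarz:
  assumes "x \<in> S" "y \<in> S"
  shows "(f x y)\<^sup>2 \<le> f x x * f y y"
proof -
  (* The quadratic polynomial in t is nonnegative, hence its discriminant is not positive. *)
  have q: "0 \<le> f x x - 2 * t * f x y + t\<^sup>2 * f y y" for t
  proof -
    have "0 \<le> f (x - t *\<^sub>R y) (x - t *\<^sub>R y)" using assms nonneg by simp
    also have "\<dots> = f x x - 2 * t * f x y + t\<^sup>2 * f y y"
      using assms by (simp add: bilin sym[of y x] power2_eq_square algebra_simps)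
    finally show ?thesis .
  qed
  show ?thesis
  proof (cases "f y y = 0")
    case True
    have "f x y = 0"
    proof (rule ccontr)
      assume "f x y \<noteq> 0"
      then show False using q[of "(f x x + 1) / (2 * f x y)"] True by (simp add: field_simps)
    qed
    then show ?thesis using True by simp
  next
    case False
    then have "f y y > 0" using nonneg[OF assms(2)] by linarith
    then show ?thesis using q[of "f x y / f y y"]
      by (simp add: power2_eq_square field_simps)
  qed
qed

definition nrm where "nrm x = sqrt (f x x)"

lemma nrm_nonneg [simp]: "x \<in> S \<Longrightarrow> 0 \<le> nrm x"
  by (simp add: nrm_def nonneg)

lemma nrm_sq: "x \<in> S \<Longrightarrow> (nrm x)\<^sup>2 = f x x"
  by (simp add: nrm_def nonneg)

lemma abs_le_nrm: "x \<in> S \<Longrightarrow> y \<in> S \<Longrightarrow> \<bar>f x y\<bar> \<le> nrm x * nrm y"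
  using Cauchy_Schwarz[of x y]
  by (simp add: nrm_def flip: real_sqrt_mult) (metis real_sqrt_abs real_sqrt_le_iff)

lemma triangle: "x \<in> S \<Longrightarrow> y \<in> S \<Longrightarrow> nrm (x + y) \<le> nrm x + nrm y"
proof (rule power2_le_imp_le)
  assume xy: "x \<in> S" "y \<in> S"
  have "(nrm (x + y))\<^sup>2 = f x x + 2 * f x y + f y y"
    using xy by (simp add: nrm_sq bilin sym[of y x])
  also have "\<dots> \<le> (nrm x + nrm y)\<^sup>2"
    using abs_le_nrm[OF xy] xy by (simp add: power2_sum nrm_sq)
  finally show "(nrm (x + y))\<^sup>2 \<le> (nrm x + nrm y)\<^sup>2" .
qed auto

lemma nrm_scale: "x \<in> S \<Longrightarrow> nrm (c *\<^sub>R x) = \<bar>c\<bar> * nrm x"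
  by (simp add: nrm_def bilin real_sqrt_mult flip: mult.assoc)

lemma nrm_diff_commute: "x \<in> S \<Longrightarrow> y \<in> S \<Longrightarrow> nrm (x - y) = nrm (y - x)"
  using nrm_scale[of "x - y" "-1"] by simp

lemma triangle_diff: "\<lbrakk>x \<in> S; y \<in> S; z \<in> S\<rbrakk> \<Longrightarrow> nrm (x - z) \<le> nrm (x - y) + nrm (y - z)"
  using triangle[of "x - y" "y - z"] by simp

lemma tendsto_form:
  assumes "\<And>n. X n \<in> S" "\<And>n. Y n \<in> S" "x \<in> S" "y \<in> S"
    and "(\<lambda>n. nrm (X n - x)) \<longlonglongrightarrow> 0" "(\<lambda>n. nrm (Y n - y)) \<longlonglongrightarrow> 0"
  shows "(\<lambda>n. f (X n) (Y n)) \<longlonglongrightarrow> f x y"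
proof -
  let ?B = "\<lambda>n. nrm (X n - x) * nrm (Y n - y) + nrm x * nrm (Y n - y) + nrm (X n - x) * nrm y"
  have "?B \<longlonglongrightarrow> 0 * 0 + nrm x * 0 + 0 * nrm y"
    by (intro tendsto_intros assms)
  then have B: "?B \<longlonglongrightarrow> 0" by simp
  have "(\<lambda>n. f (X n) (Y n) - f x y) \<longlonglongrightarrow> 0"
  proof (rule Lim_null_comparison[OF _ B], intro always_eventually allI)
    fix n
    have "f (X n) (Y n) - f x y = f (X n - x) (Y n - y) + f x (Y n - y) + f (X n - x) y"
      using assms by (simp add: bilin)
    then show "norm (f (X n) (Y n) - f x y) \<le> ?B n"
      using abs_le_nrm[of "X n - x" "Y n - y"] abs_le_nrm[of x "Y n - y"] abs_le_nrm[of "X n - x" y] assms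
      by auto
  qed
  then show ?thesis by (simp add: LIM_zero_iff)
qed

definition Cauchy_seq where
  "Cauchy_seq X \<longleftrightarrow> (\<forall>n. X n \<in> S) \<and> (\<forall>\<epsilon>>0. \<exists>N. \<forall>m\<ge>N. \<forall>n\<ge>N. nrm (X m - X n) < \<epsilon>)"

lemma Cauchy_seqI:
  assumes X: "\<And>n. X n \<in> S" and e: "e \<longlonglongrightarrow> (0::real)"
    and le: "\<And>m n. f (X m - X n) (X m - X n) \<le> e m + e n"
  shows "Cauchy_seq X"
  unfolding Cauchy_seq_def
proof (intro conjI allI impI)
  fix \<epsilon> :: real assume "\<epsilon> > 0"
  then have "\<forall>\<^sub>F n in sequentially. e n < \<epsilon>\<^sup>2 / 2"
    by (intro order_tendstoD(2)[OF e]) auto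
  then obtain N where N: "\<And>n. n \<ge> N \<Longrightarrow> e n < \<epsilon>\<^sup>2 / 2"
    by (auto simp: eventually_sequentially)
  have "nrm (X m - X n) < \<epsilon>" if "m \<ge> N" "n \<ge> N" for m n
    unfolding nrm_def using le[of m n] N[OF that(1)] N[OF that(2)] \<open>\<epsilon> > 0\<close>
    by (intro real_less_lsqrt) auto
  then show "\<exists>N. \<forall>m\<ge>N. \<forall>n\<ge>N. nrm (X m - X n) < \<epsilon>" by blast
qed (rule X)

end

locale hilbert = semi_inner +
  assumes definite: "\<lbrakk>x \<in> S; f x x = 0\<rbrakk> \<Longrightarrow> x = 0"
    and complete: "Cauchy_seq X \<Longrightarrow> \<exists>x\<in>S. (\<lambda>n. nrm (X n - x)) \<longlonglongrightarrow> 0"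
begin

lemma eq_by_form:
  assumes "x \<in> S" "y \<in> S" "\<And>z. z \<in> S \<Longrightarrow> f x z = f y z"
  shows "x = y"
proof -
  have "f (x - y) (x - y) = 0" using assms by (simp add: diff_left)
  then show ?thesis using definite[of "x - y"] assms by simp
qed

text \<open>
  The representing vector minimises \<open>f x x - 2 * l x\<close>. By the parallelogram identity every
  minimising sequence is Cauchy, and the first-order condition at its limit is the claim.
\<close>

theorem Riesz_representation:
  fixes l :: "'a \<Rightarrow> real"
  assumes add: "\<And>x y. x \<in> S \<Longrightarrow> y \<in> S \<Longrightarrow> l (x + y) = l x + l y"
    and scale: "\<And>x c. x \<in> S \<Longrightarrow> l (c *\<^sub>R x) = c * l x"
    and bound: "\<And>x. x \<in> S \<Longrightarrow> \<bar>l x\<bar> \<le> C * nrm x"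
  shows "\<exists>w\<in>S. \<forall>v\<in>S. f w v = l v"
proof -
  define Q where "Q x = f x x - 2 * l x" for x
  have diff: "l (x - y) = l x - l y" if "x \<in> S" "y \<in> S" for x y
    using add[of x "- y"] scale[of y "-1"] that by simp
  have Q_lower: "- (C\<^sup>2) \<le> Q x" if "x \<in> S" for x
  proof -
    have "2 * l x \<le> 2 * (C * nrm x)" using bound[OF that] by simp
    also have "\<dots> \<le> C\<^sup>2 + (nrm x)\<^sup>2" using sum_squares_bound[of C "nrm x"] by simp
    finally show ?thesis using that by (simp add: Q_def nrm_sq)
  qed
  have bdd: "bdd_below (Q ` S)" by (rule bdd_belowI2) (rule Q_lower)
  obtain X where X: "\<And>n. X n \<in> S" "\<And>n. Q (X n) < Inf (Q ` S) + 1 / Suc n"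
    using minimizing_sequence[OF _ bdd] mem(1) by blast
  have Q_Inf: "Inf (Q ` S) \<le> Q x" if "x \<in> S" for x
    by (rule cInf_lower[OF _ bdd]) (use that in auto)
  have "Cauchy_seq X"
  proof (rule Cauchy_seqI[where e = "\<lambda>n. 2 / Suc n"])
    fix m n
    let ?h = "(1/2) *\<^sub>R (X m + X n)"
    have "f (X m - X n) (X m - X n) = 2 * Q (X m) + 2 * Q (X n) - 4 * Q ?h"
      using X(1) by (simp add: Q_def bilin add scale sym[of "X n" "X m"] field_simps)
    then show "f (X m - X n) (X m - X n) \<le> 2 / Suc m + 2 / Suc n"
      using X(2)[of m] X(2)[of n] Q_Inf[of ?h] X(1) by fastforce
  next
    have "(\<lambda>n. 2 * inverse (real (Suc n))) \<longlonglongrightarrow> 2 * 0"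
      by (intro tendsto_intros LIMSEQ_inverse_real_of_nat)
    then show "(\<lambda>n. 2 / real (Suc n)) \<longlonglongrightarrow> 0" by (simp add: field_simps)
  qed (use X in auto)
  then obtain w where w: "w \<in> S" "(\<lambda>n. nrm (X n - w)) \<longlonglongrightarrow> 0"
    using complete by blast
  have "(\<lambda>n. l (X n) - l w) \<longlonglongrightarrow> 0"
  proof (rule Lim_null_comparison)
    show "(\<lambda>n. C * nrm (X n - w)) \<longlonglongrightarrow> 0" using tendsto_mult[OF tendsto_const w(2)] by simp
    show "\<forall>\<^sub>F n in sequentially. norm (l (X n) - l w) \<le> C * nrm (X n - w)"
      using bound X(1) w(1) by (auto simp flip: diff)
  qed
  then have "(\<lambda>n. l (X n)) \<longlonglongrightarrow> l w" by (simp add: LIM_zero_iff)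
  then have "(\<lambda>n. Q (X n)) \<longlonglongrightarrow> Q w"
    unfolding Q_def by (intro tendsto_intros tendsto_form X w)
  moreover have "(\<lambda>n. Inf (Q ` S) + inverse (real (Suc n))) \<longlonglongrightarrow> Inf (Q ` S) + 0"
    by (intro tendsto_intros LIMSEQ_inverse_real_of_nat)
  ultimately have Qw: "Q w \<le> Inf (Q ` S)"
    using X(2) by (intro LIMSEQ_le[of "\<lambda>n. Q (X n)" "Q w"]) (auto simp: field_simps less_imp_le)
  have "f w v = l v" if v: "v \<in> S" for v
  proof -
    have "0 \<le> t * (2 * (f w v - l v)) + t\<^sup>2 * f v v" for t
    proof -
      have "Q w \<le> Q (w + t *\<^sub>R v)" using Q_Inf[of "w + t *\<^sub>R v"] Qw w v by fastforce
      also have "\<dots> = Q w + (t * (2 * (f w v - l v)) + t\<^sup>2 * f v v)"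
        using w(1) v by (simp add: Q_def bilin add scale sym[of v w] power2_eq_square algebra_simps)
      finally show ?thesis by simp
    qed
    then have "2 * (f w v - l v) = 0" by (intro linear_coefficient_zero[of 1]) auto
    then show ?thesis by simp
  qed
  then show ?thesis using w(1) by blast
qed

end


section \<open>The bottom of the spectrum of a pair of forms\<close>

text \<open>
  The form \<open>a\<close> is the energy, \<open>b\<close> the inner product of the ambient \<open>L\<^sup>2\<close> space, and \<open>lam\<close> the
  bottom of the spectrum of the operator that \<open>a\<close> defines relative to \<open>b\<close>.
\<close>

locale form_pair = a: hilbert S a + b: semi_inner S b
  for S :: "'a::real_vector set" and a b :: "'a \<Rightarrow> 'a \<Rightarrow> real" +
  fixes lam :: real
  assumes lam_ge_1: "1 \<le> lam"
    and lam_le: "x \<in> S \<Longrightarrow> lam * b x x \<le> a x x"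
    and lam_approx: "0 < \<epsilon> \<Longrightarrow> \<exists>x\<in>S. 0 < b x x \<and> a x x < (lam + \<epsilon>) * b x x"
begin

lemma b_le_a: "x \<in> S \<Longrightarrow> b x x \<le> a x x"
  using lam_le[of x] mult_right_mono[OF lam_ge_1 b.nonneg[of x]] by simp

lemma b_nrm_le: "x \<in> S \<Longrightarrow> b.nrm x \<le> a.nrm x"
  by (simp add: a.nrm_def b.nrm_def b_le_a)

text \<open>
  \<open>K\<close> is the inverse of that operator, acting on the form domain. It is bounded and symmetric
  for \<open>a\<close>, so all spectral arguments take place with bounded operators on the Hilbert space \<open>(S, a)\<close>;
  spectral values are inverted.
\<close>

definition K where "K u = (SOME w. w \<in> S \<and> (\<forall>v\<in>S. a w v = b u v))"

lemma K:
  assumes "u \<in> S"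
  shows K_mem [simp, intro]: "K u \<in> S" and K_form: "v \<in> S \<Longrightarrow> a (K u) v = b u v"
proof -
  have "\<exists>w\<in>S. \<forall>v\<in>S. a w v = b u v"
  proof (rule a.Riesz_representation[where C = "b.nrm u"])
    fix x assume x: "x \<in> S"
    have "\<bar>b u x\<bar> \<le> b.nrm u * b.nrm x" using b.abs_le_nrm assms x by simp
    also have "\<dots> \<le> b.nrm u * a.nrm x" using assms x by (intro mult_left_mono b_nrm_le) auto
    finally show "\<bar>b u x\<bar> \<le> b.nrm u * a.nrm x" .
  qed (use assms in \<open>auto simp: b.bilin\<close>)
  then have "\<exists>w. w \<in> S \<and> (\<forall>v\<in>S. a w v = b u v)" by blast
  from someI_ex[OF this] have "K u \<in> S \<and> (\<forall>v\<in>S. a (K u) v = b u v)"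
    unfolding K_def .
  then show "K u \<in> S" "v \<in> S \<Longrightarrow> a (K u) v = b u v" by auto
qed

lemma K_form': "\<lbrakk>u \<in> S; v \<in> S\<rbrakk> \<Longrightarrow> a v (K u) = b v u"
  using K_form[of u v] a.sym[of v "K u"] b.sym[of u v] by simp

lemma K_add: "\<lbrakk>x \<in> S; y \<in> S\<rbrakk> \<Longrightarrow> K (x + y) = K x + K y"
  by (intro a.eq_by_form) (auto simp: K_form a.bilin b.bilin)

lemma K_scale: "x \<in> S \<Longrightarrow> K (c *\<^sub>R x) = c *\<^sub>R K x"
  by (intro a.eq_by_form) (auto simp: K_form a.bilin b.bilin)

lemma K_diff: "\<lbrakk>x \<in> S; y \<in> S\<rbrakk> \<Longrightarrow> K (x - y) = K x - K y"
  by (intro a.eq_by_form) (auto simp: K_form a.bilin b.bilin)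

lemma K_contraction:
  assumes "u \<in> S" shows "a.nrm (K u) \<le> a.nrm u"
proof -
  have "(a.nrm (K u))\<^sup>2 = b u (K u)" using assms by (simp add: a.nrm_sq K_form)
  also have "\<dots> \<le> b.nrm u * b.nrm (K u)" using b.abs_le_nrm[of u "K u"] assms by auto
  also have "\<dots> \<le> a.nrm u * a.nrm (K u)" using assms by (intro mult_mono b_nrm_le) auto
  finally have *: "a.nrm (K u) * a.nrm (K u) \<le> a.nrm u * a.nrm (K u)" by (simp add: power2_eq_square)
  show ?thesis
  proof (cases "a.nrm (K u) = 0")
    case False
    then have "0 < a.nrm (K u)" using a.nrm_nonneg[OF K_mem[OF assms]] by linarith
    with * show ?thesis by (simp only: mult_le_cancel_right_pos)
  qed (use assms in simp)
qed

text \<open>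
  An interval free of spectrum keeps \<open>K - c\<close> away from \<open>0\<close> by its radius. This is the part of
  the spectral theorem that is needed, and it has a short proof. Let \<open>B = K - c\<close> and let \<open>M\<close> be the
  infimum of \<open>|B v|\<^sup>2 / |v|\<^sup>2\<close>. If \<open>M < r\<^sup>2\<close>, then \<open>B\<^sup>2 - M\<close> is the product of \<open>K - (c + sqrt M)\<close> and
  \<open>K - (c - sqrt M)\<close>, both of which are bounded below. But \<open>q v v = |B v|\<^sup>2 - M |v|\<^sup>2\<close> is a nonnegative
  form represented by \<open>B\<^sup>2 - M\<close>, and its Cauchy-Schwarz inequality turns that lower bound into
  \<open>q v v \<ge> k |v|\<^sup>2\<close> with \<open>k > 0\<close>, which contradicts the choice of \<open>M\<close>.
\<close>

lemma resolvent_interval_bound: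
  assumes r: "0 < r" and u: "u \<in> S"
    and bb: "\<And>s. \<lbrakk>c - r < s; s < c + r\<rbrakk> \<Longrightarrow> \<exists>k>0. \<forall>u\<in>S. k * a u u \<le> a (K u - s *\<^sub>R u) (K u - s *\<^sub>R u)"
  shows "r\<^sup>2 * a u u \<le> a (K u - c *\<^sub>R u) (K u - c *\<^sub>R u)"
proof (rule ccontr)
  assume less: "\<not> ?thesis"
  define B where "B v = K v - c *\<^sub>R v" for v
  have B_mem [simp]: "B v \<in> S" if "v \<in> S" for v using that by (simp add: B_def)
  have B_sa: "a (B x) y = a x (B y)" if "x \<in> S" "y \<in> S" for x y
    using that by (simp add: B_def a.bilin K_form K_form')
  have B_add: "B (x + y) = B x + B y" if "x \<in> S" "y \<in> S" for x y
    using that by (simp add: B_def K_add algebra_simps)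
  have B_scale: "B (t *\<^sub>R x) = t *\<^sub>R B x" if "x \<in> S" for x t
    using that by (simp add: B_def K_scale algebra_simps)
  have B_bound: "a (B v) (B v) \<le> (1 + \<bar>c\<bar>)\<^sup>2 * a v v" if v: "v \<in> S" for v
  proof -
    have "a.nrm (B v) \<le> a.nrm (K v) + a.nrm ((- c) *\<^sub>R v)"
      using a.triangle[of "K v" "(- c) *\<^sub>R v"] v by (simp add: B_def)
    also have "\<dots> \<le> a.nrm v + \<bar>c\<bar> * a.nrm v"
      using K_contraction[OF v] v by (simp only: a.nrm_scale) simp
    finally have "(a.nrm (B v))\<^sup>2 \<le> ((1 + \<bar>c\<bar>) * a.nrm v)\<^sup>2"
      using v by (intro power_mono) (auto simp: algebra_simps)
    then show ?thesis using v by (simp add: a.nrm_sq power_mult_distrib)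
  qed
  define R where "R v = a (B v) (B v) / a v v" for v
  define A where "A = S - {0}"
  have pos: "a v v > 0" if "v \<in> A" for v
    using that a.nonneg[of v] a.definite[of v] by (force simp: A_def)
  have uA: "u \<in> A"
  proof -
    have "u \<noteq> 0"
    proof
      assume "u = 0"
      then have "a u u = 0" using u by (simp add: a.zero_left)
      then show False using less u a.nonneg[of "B u"] by (simp add: B_def)
    qed
    then show ?thesis using u by (simp add: A_def)
  qed
  have bdd: "bdd_below (R ` A)"
    by (rule bdd_belowI2[where m = 0]) (auto simp: R_def A_def a.nonneg)
  define M where "M = Inf (R ` A)"
  have M0: "0 \<le> M" unfolding M_def
    using uA by (intro cInf_greatest) (auto simp: R_def A_def a.nonneg)
  have "M \<le> R u" unfolding M_def using uA by (intro cInf_lower bdd) auto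
  also have "\<dots> < r\<^sup>2" using less pos[OF uA] by (simp add: R_def B_def field_simps)
  finally have Mr: "sqrt M < r" using r M0 by (intro real_less_lsqrt) auto
  have M_le: "M * a v v \<le> a (B v) (B v)" if v: "v \<in> S" for v
  proof (cases "v = 0")
    case False
    then have "M \<le> R v" unfolding M_def using v by (intro cInf_lower bdd) (auto simp: A_def)
    then show ?thesis using pos[of v] False v by (simp add: R_def A_def field_simps)
  qed (use v in \<open>simp add: a.zero_left a.nonneg\<close>)
  obtain k1 where k1: "k1 > 0" "\<And>v. v \<in> S \<Longrightarrow> k1 * a v v \<le> a (K v - (c + sqrt M) *\<^sub>R v) (K v - (c + sqrt M) *\<^sub>R v)"
  proof -
    have "c - r < c + sqrt M" "c + sqrt M < c + r" using Mr r real_sqrt_ge_zero[OF M0] by linarith+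
    then show ?thesis using bb[of "c + sqrt M"] that by blast
  qed
  obtain k2 where k2: "k2 > 0" "\<And>v. v \<in> S \<Longrightarrow> k2 * a v v \<le> a (K v - (c - sqrt M) *\<^sub>R v) (K v - (c - sqrt M) *\<^sub>R v)"
  proof -
    have "c - r < c - sqrt M" "c - sqrt M < c + r" using Mr r real_sqrt_ge_zero[OF M0] by linarith+
    then show ?thesis using bb[of "c - sqrt M"] that by blast
  qed
  define q where "q x y = a (B x) (B y) - M * a x y" for x y
  interpret q: semi_inner S q
  proof
    fix x y z :: 'a and t :: real
    assume x: "x \<in> S" and z: "z \<in> S"
    show "q (t *\<^sub>R x) z = t * q x z"
      using x z by (simp add: q_def a.bilin B_scale algebra_simps)
    show "q x z = q z x" using x z a.sym[of x z] a.sym[of "B x" "B z"] by (simp add: q_def)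
    show "0 \<le> q x x" using M_le[OF x] by (simp add: q_def)
    assume y: "y \<in> S"
    show "q (x + y) z = q x z + q y z"
      using x y z by (simp add: q_def a.bilin B_add algebra_simps)
  qed (rule a.subsp)
  have below: "M + k1 * k2 / (1 + \<bar>c\<bar>)\<^sup>2 \<le> R v" if v: "v \<in> A" for v
  proof -
    have vS: "v \<in> S" using v by (simp add: A_def)
    define w where "w = B (B v) - M *\<^sub>R v"
    define y where "y = K v - (c - sqrt M) *\<^sub>R v"
    have S: "w \<in> S" "y \<in> S" using vS by (auto simp: w_def y_def)
    have y: "y = B v + sqrt M *\<^sub>R v" by (simp add: y_def B_def algebra_simps)
    have "K y - (c + sqrt M) *\<^sub>R y = B y - sqrt M *\<^sub>R y" by (simp add: B_def algebra_simps)
    also have "\<dots> = w"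
      using vS M0 by (simp add: y w_def B_add B_scale algebra_simps)
    finally have w: "K y - (c + sqrt M) *\<^sub>R y = w" .
    have "k1 * (k2 * a v v) \<le> k1 * a y y" using k1(1) k2(2)[OF vS] by (simp add: y_def)
    also have "\<dots> \<le> a w w" using k1(2)[OF S(2)] by (simp add: w)
    finally have lower: "k1 * k2 * a v v \<le> a w w" by simp
    then have wpos: "a w w > 0"
      using k1(1) k2(1) pos[OF v] by (meson less_le_trans mult_pos_pos)
    have "q v w = a w w"
      using vS S B_sa[of "B v" w] a.diff_left[of "B (B v)" "M *\<^sub>R v" w] a.scale_left[of v w M]
      by (simp add: q_def flip: w_def)
    then have "(a w w)\<^sup>2 \<le> q v v * q w w" using q.Cauchy_Schwarz[OF vS S(1)] by simp
    also have "\<dots> \<le> q v v * ((1 + \<bar>c\<bar>)\<^sup>2 * a w w)"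
    proof (intro mult_left_mono q.nonneg vS)
      have "q w w \<le> a (B w) (B w)" using M0 a.nonneg[OF S(1)] by (simp add: q_def)
      then show "q w w \<le> (1 + \<bar>c\<bar>)\<^sup>2 * a w w" using B_bound[OF S(1)] by linarith
    qed
    finally have "a w w * a w w \<le> (q v v * (1 + \<bar>c\<bar>)\<^sup>2) * a w w" by (simp add: power2_eq_square mult_ac)
    then have "a w w \<le> q v v * (1 + \<bar>c\<bar>)\<^sup>2" using wpos by (simp only: mult_le_cancel_right_pos)
    with lower have "k1 * k2 * a v v \<le> (a (B v) (B v) - M * a v v) * (1 + \<bar>c\<bar>)\<^sup>2"
      by (simp add: q_def)
    moreover have "(1 + \<bar>c\<bar>)\<^sup>2 > 0" by (simp add: add_pos_nonneg)
    ultimately show ?thesis using pos[OF v] by (simp add: R_def field_simps)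
  qed
  have "M + k1 * k2 / (1 + \<bar>c\<bar>)\<^sup>2 \<le> M"
    by (subst (2) M_def) (use uA below in \<open>auto intro!: cInf_greatest\<close>)
  moreover have "k1 * k2 / (1 + \<bar>c\<bar>)\<^sup>2 > 0" using k1 k2 by (simp add: add_pos_nonneg)
  ultimately show False by simp
qed

text \<open>
  \<open>L\<close> corresponds to the operator minus \<open>lam\<close>: it lies between \<open>0\<close> and the identity, and its kernel
  is the eigenspace of \<open>lam\<close>.
\<close>

definition L where "L u = u - lam *\<^sub>R K u"

lemma L_mem [simp, intro]: "u \<in> S \<Longrightarrow> L u \<in> S"
  by (simp add: L_def)

lemma L_form: "\<lbrakk>u \<in> S; v \<in> S\<rbrakk> \<Longrightarrow> a (L u) v = a u v - lam * b u v"
  by (simp add: L_def a.bilin K_form)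

lemma L_sa: "\<lbrakk>u \<in> S; v \<in> S\<rbrakk> \<Longrightarrow> a (L u) v = a u (L v)"
  using L_form[of u v] L_form[of v u] a.sym[of u v] a.sym[of u "L v"] b.sym[of u v] by simp

lemma L_add: "\<lbrakk>x \<in> S; y \<in> S\<rbrakk> \<Longrightarrow> L (x + y) = L x + L y"
  by (simp add: L_def K_add algebra_simps)

lemma L_diff: "\<lbrakk>x \<in> S; y \<in> S\<rbrakk> \<Longrightarrow> L (x - y) = L x - L y"
  by (simp add: L_def K_diff algebra_simps)

lemma L_scale: "x \<in> S \<Longrightarrow> L (c *\<^sub>R x) = c *\<^sub>R L x"
  by (simp add: L_def K_scale algebra_simps)

lemma L_nonneg: "u \<in> S \<Longrightarrow> 0 \<le> a (L u) u"
  using lam_le[of u] by (simp add: L_form)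

sublocale Lf: semi_inner S "\<lambda>x y. a (L x) y"
proof
  fix x y z :: 'a and t :: real
  assume x: "x \<in> S" and z: "z \<in> S"
  show "a (L (t *\<^sub>R x)) z = t * a (L x) z" using x z by (simp add: L_scale a.bilin)
  show "a (L x) z = a (L z) x" using x z L_sa[of x z] a.sym[of x "L z"] by simp
  show "0 \<le> a (L x) x" using L_nonneg[OF x] .
  assume y: "y \<in> S"
  show "a (L (x + y)) z = a (L x) z + a (L y) z" using x y z by (simp add: L_add a.bilin)
qed (rule a.subsp)

lemma L_le: "u \<in> S \<Longrightarrow> a (L u) u \<le> a u u"
  using lam_ge_1 b.nonneg[of u] by (simp add: L_form)

text \<open>
  Cauchy-Schwarz for the nonnegative form \<open>a (L x) y\<close>, tested with \<open>L u\<close>, combined with \<open>L \<le> 1\<close>.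
\<close>

lemma L_square_le:
  assumes "u \<in> S" shows "a (L u) (L u) \<le> a (L u) u"
proof (cases "a (L u) (L u) = 0")
  case True
  then show ?thesis using L_nonneg[OF assms] by simp
next
  case False
  then have pos: "a (L u) (L u) > 0" using a.nonneg[of "L u"] assms by simp
  have "(a (L u) (L u))\<^sup>2 \<le> a (L u) u * a (L (L u)) (L u)"
    using Lf.Cauchy_Schwarz[of u "L u"] assms by simp
  also have "\<dots> \<le> a (L u) u * a (L u) (L u)"
    using assms by (intro mult_left_mono L_le L_nonneg) auto
  finally have "a (L u) (L u) * a (L u) (L u) \<le> a (L u) u * a (L u) (L u)"
    by (simp add: power2_eq_square)
  then show ?thesis using pos by (simp only: mult_le_cancel_right_pos)
qed

lemma L_nrm_le: "u \<in> S \<Longrightarrow> a.nrm (L u) \<le> a.nrm u"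
  unfolding a.nrm_def using L_square_le[of u] L_le[of u] by simp

text \<open>
  The infimum of the quotients belongs to the spectrum: if \<open>L\<close> were bounded below, then by
  \<open>L_square_le\<close> the quotient \<open>a x x / b x x\<close> would stay above a number larger than \<open>lam\<close>.
\<close>

lemma L_not_bounded_below:
  assumes "0 < k" "\<And>u. u \<in> S \<Longrightarrow> k * a u u \<le> a (L u) (L u)"
  shows False
proof -
  obtain x where x: "x \<in> S" "0 < b x x" "a x x < (lam + lam * k) * b x x"
    using lam_approx[of "lam * k"] assms(1) lam_ge_1 by auto
  have "k * a x x \<le> a (L x) x" using assms(2)[OF x(1)] L_square_le[OF x(1)] by simp
  then have *: "lam * b x x \<le> (1 - k) * a x x" using x by (simp add: L_form algebra_simps)
  have "0 < (1 - k) * a x x" using * x(2) lam_ge_1 by (smt (verit) mult_pos_pos)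
  moreover have "0 < a x x" using b_le_a[OF x(1)] x(2) by simp
  ultimately have "0 < 1 - k" by (simp add: zero_less_mult_iff)
  then have "(1 - k) * a x x < (1 - k) * ((lam + lam * k) * b x x)"
    using x(3) by simp
  with * have "lam * b x x < (1 - k) * ((lam + lam * k) * b x x)" by simp
  also have "\<dots> = lam * b x x - k\<^sup>2 * (lam * b x x)" by (simp add: power2_eq_square algebra_simps)
  also have "\<dots> \<le> lam * b x x" using x(2) lam_ge_1 by simp
  finally show False by simp
qed

text \<open>
  If no spectrum lies between \<open>lam\<close> and \<open>lam + \<eta>\<close>, then the spectrum of \<open>L\<close> avoids an interval
  next to \<open>0\<close>, that is \<open>L (L - \<gamma>) \<ge> 0\<close>.
\<close>

lemma L_square_ge:
  assumes \<eta>: "0 < \<eta>"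
    and bb: "\<And>t. \<lbrakk>lam < t; t < lam + \<eta>\<rbrakk> \<Longrightarrow> \<exists>k>0. \<forall>u\<in>S. k * a u u \<le> a (u - t *\<^sub>R K u) (u - t *\<^sub>R K u)"
  obtains \<gamma> where "0 < \<gamma>" "\<gamma> < 1" "\<And>u. u \<in> S \<Longrightarrow> \<gamma> * a (L u) u \<le> a (L u) (L u)"
proof -
  (* Half the length and the midpoint of the gap of K, which is the inverted interval. *)
  define r where "r = (1 / lam - 1 / (lam + \<eta>)) / 2"
  define c where "c = 1 / lam - r"
  have lam0: "0 < lam" using lam_ge_1 by simp
  have "1 / (lam + \<eta>) < 1 / lam" using lam0 \<eta> by (intro divide_strict_left_mono) auto
  then have r0: "0 < r" by (simp add: r_def)
  have c1: "c - r = 1 / (lam + \<eta>)" 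
  proof -
    have "r + r = 1 / lam - 1 / (lam + \<eta>)" unfolding r_def by (rule field_sum_of_halves)
    then show ?thesis by (simp add: c_def)
  qed
  have c2: "c + r = 1 / lam" by (simp add: c_def)
  have main: "2 * r * lam * a (L u) u \<le> a (L u) (L u)" if u: "u \<in> S" for u
  proof -
    have "r\<^sup>2 * a u u \<le> a (K u - c *\<^sub>R u) (K u - c *\<^sub>R u)"
    proof (rule resolvent_interval_bound[OF r0 u])
      fix s assume s: "c - r < s" "s < c + r"
      have s0: "0 < s" using s(1) \<eta> lam0 less_trans[of 0 "1 / (lam + \<eta>)" s] by (simp add: c1)
      have "lam < 1 / s" "1 / s < lam + \<eta>" using s s0 lam0 \<eta> by (simp_all add: c1 c2 field_simps)
      then obtain k where k: "k > 0" "\<And>u. u \<in> S \<Longrightarrow> k * a u u \<le> a (u - (1/s) *\<^sub>R K u) (u - (1/s) *\<^sub>R K u)"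
        using bb by blast
      have "s\<^sup>2 * k * a v v \<le> a (K v - s *\<^sub>R v) (K v - s *\<^sub>R v)" if v: "v \<in> S" for v
      proof -
        have "K v - s *\<^sub>R v = (- s) *\<^sub>R (v - (1/s) *\<^sub>R K v)" using s0 by (simp add: algebra_simps)
        then have "a (K v - s *\<^sub>R v) (K v - s *\<^sub>R v) = s\<^sup>2 * a (v - (1/s) *\<^sub>R K v) (v - (1/s) *\<^sub>R K v)"
          using v by (simp only: a.scale_left a.scale_right a.mem K_mem) (simp add: power2_eq_square)
        moreover have "s\<^sup>2 * (k * a v v) \<le> s\<^sup>2 * a (v - (1/s) *\<^sub>R K v) (v - (1/s) *\<^sub>R K v)"
          using k(2)[OF v] by (intro mult_left_mono) auto
        ultimately show ?thesis by (simp add: mult.assoc)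
      qed
      moreover have "s\<^sup>2 * k > 0" using s0 k by simp
      ultimately show "\<exists>k>0. \<forall>u\<in>S. k * a u u \<le> a (K u - s *\<^sub>R u) (K u - s *\<^sub>R u)" by blast
    qed
    also have "K u - c *\<^sub>R u = r *\<^sub>R u - (1 / lam) *\<^sub>R L u"
      using lam0 by (simp add: L_def c_def algebra_simps)
    also have "a \<dots> \<dots> = r\<^sup>2 * a u u - 2 * r / lam * a (L u) u + a (L u) (L u) / lam\<^sup>2"
      using u a.sym[of u "L u"]
      by (simp add: a.bilin power2_eq_square right_diff_distrib diff_divide_distrib)
    finally have "2 * r / lam * a (L u) u \<le> a (L u) (L u) / lam\<^sup>2" by simp
    then have "lam\<^sup>2 * (2 * r / lam * a (L u) u) \<le> lam\<^sup>2 * (a (L u) (L u) / lam\<^sup>2)"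
      by (intro mult_left_mono) auto
    then show ?thesis using lam0 by (simp add: power2_eq_square mult_ac)
  qed
  have "2 * r * lam = 1 - lam / (lam + \<eta>)" using lam0 by (simp add: r_def field_simps)
  then have "2 * r * lam < 1" using lam0 \<eta> by simp
  moreover have "0 < 2 * r * lam" using r0 lam0 by simp
  ultimately show ?thesis using main that by blast
qed

definition N where "N = {y \<in> S. L y = 0}"

lemma N_form: "y \<in> N \<Longrightarrow> v \<in> S \<Longrightarrow> a y v = lam * b y v"
  using L_form[of y v] by (simp add: N_def a.zero_left)

lemma N_subspace: "subspace N"
proof -
  have "L 0 = 0" using L_scale[of 0 0] by simp
  then show ?thesis by (auto simp: subspace_def N_def L_add L_scale)
qed

text \<open>
  Every vector splits into a part in \<open>N\<close> and a part on which the energy has a gap above \<open>lam\<close>.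
  Testing the Cauchy-Schwarz inequality of the form \<open>a (L x) y\<close> on the range of \<open>L\<close> upgrades
  \<open>L\<^sup>2 \<ge> \<gamma> L\<close> to \<open>L \<ge> \<gamma>\<close> there. Hence \<open>M = 1 - L\<close> contracts the range of \<open>L\<close>, the iterates
  \<open>M\<^sup>k u\<close> converge geometrically to a vector \<open>y\<close> of the kernel, and \<open>u - y\<close> is a limit of vectors
  \<open>u - M\<^sup>k u\<close> of the range, so it inherits \<open>L \<ge> \<gamma>\<close> and orthogonality to the kernel.
\<close>

lemma kernel_decomposition:
  assumes \<gamma>: "0 < \<gamma>" "\<gamma> < 1" "\<And>u. u \<in> S \<Longrightarrow> \<gamma> * a (L u) u \<le> a (L u) (L u)"
    and u: "u \<in> S"
  obtains y where "y \<in> N" "\<And>n. n \<in> N \<Longrightarrow> a n (u - y) = 0"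
    "lam * b (u - y) (u - y) \<le> (1 - \<gamma>) * a (u - y) (u - y)"
proof -
  have ran: "\<gamma> * a (L w) (L w) \<le> a (L (L w)) (L w)" if w: "w \<in> S" for w
  proof (cases "a (L w) (L w) = 0")
    case True
    then show ?thesis using L_nonneg[of "L w"] w by simp
  next
    case False
    then have pos: "a (L w) (L w) > 0" using a.nonneg[of "L w"] w by simp
    have "\<gamma> * (a (L w) (L w))\<^sup>2 \<le> \<gamma> * (a (L w) w * a (L (L w)) (L w))"
      using Lf.Cauchy_Schwarz[of w "L w"] w \<gamma>(1) by (intro mult_left_mono) auto
    also have "\<dots> = (\<gamma> * a (L w) w) * a (L (L w)) (L w)" by simp
    also have "\<dots> \<le> a (L w) (L w) * a (L (L w)) (L w)"
      using \<gamma>(3)[OF w] L_nonneg[of "L w"] w by (intro mult_right_mono) auto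
    finally have "a (L w) (L w) * (\<gamma> * a (L w) (L w)) \<le> a (L w) (L w) * a (L (L w)) (L w)"
      by (simp add: power2_eq_square mult_ac)
    then show ?thesis using pos by (simp only: mult_le_cancel_left_pos)
  qed
  define M where "M v = v - L v" for v
  have M_mem [simp]: "M v \<in> S" if "v \<in> S" for v using that by (simp add: M_def)
  define \<rho> where "\<rho> = sqrt (1 - \<gamma>)"
  have \<rho>: "0 \<le> \<rho>" "\<rho> < 1" using \<gamma> by (auto simp: \<rho>_def real_sqrt_lt_1_iff)
  have M_contr: "a.nrm (M (L w)) \<le> \<rho> * a.nrm (L w)" if w: "w \<in> S" for w
  proof -
    have "a (M (L w)) (M (L w)) = a (L w) (L w) - 2 * a (L (L w)) (L w) + a (L (L w)) (L (L w))"
      using w a.sym[of "L w" "L (L w)"] by (simp add: M_def a.bilin)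
    also have "\<dots> \<le> (1 - \<gamma>) * a (L w) (L w)"
      using L_square_le[of "L w"] ran[OF w] w by (simp add: algebra_simps)
    finally show ?thesis
      unfolding a.nrm_def \<rho>_def by (simp flip: real_sqrt_mult)
  qed
  define z where "z k = (M ^^ k) u" for k
  have z_Suc: "z (Suc k) = z k - L (z k)" for k by (simp add: z_def M_def)
  have z_mem [simp]: "z k \<in> S" for k
    by (induction k) (simp_all add: z_Suc, simp add: z_def u)
  (* The increments z k - z (k + 1) = L (z k) lie in the range of L, where M contracts. *)
  have d: "a.nrm (L (z k)) \<le> \<rho> ^ k * a.nrm (L u)" for k
  proof (induction k)
    case (Suc k)
    have "L (z (Suc k)) = M (L (z k))" by (simp add: z_Suc M_def L_diff)
    then have "a.nrm (L (z (Suc k))) \<le> \<rho> * a.nrm (L (z k))" using M_contr[of "z k"] by simp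
    also have "\<dots> \<le> \<rho> * (\<rho> ^ k * a.nrm (L u))" using Suc \<rho> by (intro mult_left_mono) auto
    finally show ?case by simp
  qed (simp add: z_def)
  define D where "D = a.nrm (L u) / (1 - \<rho>)"
  have D: "0 \<le> D" "a.nrm (L u) = D * (1 - \<rho>)" using \<rho> u by (auto simp: D_def)
  have dist: "a.nrm (z m - z (m + j)) \<le> D * (\<rho> ^ m - \<rho> ^ (m + j))" for m j
  proof (induction j)
    case 0
    then show ?case by (simp add: a.nrm_def a.zero_left)
  next
    case (Suc j)
    have "a.nrm (z m - z (m + Suc j)) \<le> a.nrm (z m - z (m + j)) + a.nrm (L (z (m + j)))"
      using a.triangle_diff[of "z m" "z (m + j)" "z (m + Suc j)"] by (simp add: z_Suc)
    also have "\<dots> \<le> D * (\<rho> ^ m - \<rho> ^ (m + j)) + \<rho> ^ (m + j) * (D * (1 - \<rho>))"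
      using Suc d[of "m + j"] D(2) by simp
    also have "\<dots> = D * (\<rho> ^ m - \<rho> ^ (m + Suc j))" by (simp add: algebra_simps)
    finally show ?case .
  qed
  have le: "a (z m - z n) (z m - z n) \<le> (D * \<rho> ^ m)\<^sup>2" if "m \<le> n" for m n
  proof -
    have "a.nrm (z m - z n) \<le> D * (\<rho> ^ m - \<rho> ^ n)"
      using dist[of m "n - m"] that by simp
    also have "\<dots> \<le> D * \<rho> ^ m" using D \<rho> by (intro mult_left_mono) auto
    finally have "(a.nrm (z m - z n))\<^sup>2 \<le> (D * \<rho> ^ m)\<^sup>2" by (intro power_mono) auto
    then show ?thesis by (simp add: a.nrm_sq)
  qed
  have \<rho>_lim: "(\<lambda>k. \<rho> ^ k) \<longlonglongrightarrow> 0" using \<rho> by (intro LIMSEQ_realpow_zero) auto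
  have "a.Cauchy_seq z"
  proof (rule a.Cauchy_seqI[where e = "\<lambda>k. (D * \<rho> ^ k)\<^sup>2"])
    show "(\<lambda>k. (D * \<rho> ^ k)\<^sup>2) \<longlonglongrightarrow> 0"
      using tendsto_power[OF tendsto_mult[OF tendsto_const[of D] \<rho>_lim], of 2] by simp
    fix m n
    have sym: "a (z m - z n) (z m - z n) = a (z n - z m) (z n - z m)"
      by (simp add: a.bilin)
    show "a (z m - z n) (z m - z n) \<le> (D * \<rho> ^ m)\<^sup>2 + (D * \<rho> ^ n)\<^sup>2"
    proof (cases "m \<le> n")
      case True
      then show ?thesis using le[of m n] by (simp add: add_increasing2)
    next
      case False
      then show ?thesis using le[of n m] sym by (simp add: add_increasing)
    qed
  qed auto
  then obtain y where y: "y \<in> S" "(\<lambda>k. a.nrm (z k - y)) \<longlonglongrightarrow> 0"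
    using a.complete by blast
  have "a.nrm (L y) \<le> 0"
  proof (rule LIMSEQ_le_const)
    show "(\<lambda>k. a.nrm (z k - y) + \<rho> ^ k * a.nrm (L u)) \<longlonglongrightarrow> 0"
      using tendsto_add[OF y(2) tendsto_mult[OF \<rho>_lim tendsto_const[of "a.nrm (L u)"]]] by simp
    have "a.nrm (L y) \<le> a.nrm (z k - y) + \<rho> ^ k * a.nrm (L u)" for k
    proof -
      have "a.nrm (L y) \<le> a.nrm (L (y - z k)) + a.nrm (L (z k))"
        using a.triangle[of "L (y - z k)" "L (z k)"] y by (simp add: L_diff)
      also have "a.nrm (L (y - z k)) \<le> a.nrm (z k - y)"
        using L_nrm_le[of "y - z k"] a.nrm_diff_commute[of y "z k"] y by simp
      finally show ?thesis using d[of k] by simp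
    qed
    then show "\<exists>N. \<forall>k\<ge>N. a.nrm (L y) \<le> a.nrm (z k - y) + \<rho> ^ k * a.nrm (L u)" by blast
  qed
  then have "a (L y) (L y) = 0" using y(1) a.nrm_nonneg[of "L y"] a.nonneg[of "L y"] by (simp add: a.nrm_def)
  then have Ly: "L y = 0" using y(1) by (intro a.definite) auto
  then have yN: "y \<in> N" using y(1) by (simp add: N_def)
  (* z telescopes: u - z k is a sum of increments from the range of L. *)
  have ranz: "\<exists>w\<in>S. u - z k = L w" for k
  proof (induction k)
    case 0
    have "L 0 = 0" using L_scale[of 0 0] by simp
    then show ?case by (intro bexI[of _ 0]) (auto simp: z_def)
  next
    case (Suc k)
    then obtain w where w: "w \<in> S" "u - z k = L w" by blast
    have "u - z (Suc k) = L (w + z k)" using w by (simp add: z_Suc L_add)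
    then show ?case by (rule bexI) (use w in auto)
  qed
  have vlim: "(\<lambda>k. a.nrm ((u - z k) - (u - y))) \<longlonglongrightarrow> 0"
    using y a.nrm_diff_commute[of y] by simp
  have Lvlim: "(\<lambda>k. a.nrm (L (u - z k) - L (u - y))) \<longlonglongrightarrow> 0"
  proof (rule Lim_null_comparison[OF always_eventually vlim], rule allI)
    fix k
    have "L (u - z k) - L (u - y) = L ((u - z k) - (u - y))" using u y by (simp add: L_diff)
    then show "norm (a.nrm (L (u - z k) - L (u - y))) \<le> a.nrm ((u - z k) - (u - y))"
      using L_nrm_le[of "(u - z k) - (u - y)"] u y by simp
  qed
  have "a n (u - y) = 0" if n: "n \<in> N" for n
  proof -
    have nS: "n \<in> S" "L n = 0" using n by (auto simp: N_def)
    have "a n (u - z k) = 0" for k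
    proof -
      obtain w where w: "w \<in> S" "u - z k = L w" using ranz by blast
      then show ?thesis using L_sa[of n w] nS by (simp add: a.zero_left)
    qed
    moreover have "(\<lambda>k. a n (u - z k)) \<longlonglongrightarrow> a n (u - y)"
      by (rule a.tendsto_form[OF _ _ _ _ _ vlim]) (use nS u y in \<open>auto simp: a.nrm_def a.zero_left\<close>)
    ultimately show ?thesis by (simp add: LIMSEQ_const_iff)
  qed
  moreover have "lam * b (u - y) (u - y) \<le> (1 - \<gamma>) * a (u - y) (u - y)"
  proof -
    have "\<gamma> * a (u - y) (u - y) \<le> a (L (u - y)) (u - y)"
    proof (rule LIMSEQ_le)
      show "(\<lambda>k. \<gamma> * a (u - z k) (u - z k)) \<longlonglongrightarrow> \<gamma> * a (u - y) (u - y)"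
        by (intro tendsto_intros a.tendsto_form vlim) (use u y in auto)
      show "(\<lambda>k. a (L (u - z k)) (u - z k)) \<longlonglongrightarrow> a (L (u - y)) (u - y)"
        by (intro a.tendsto_form vlim Lvlim) (use u y in auto)
      show "\<exists>N. \<forall>n\<ge>N. \<gamma> * a (u - z n) (u - z n) \<le> a (L (u - z n)) (u - z n)"
        using ran ranz by metis
    qed
    then show ?thesis using u y by (simp add: L_form algebra_simps)
  qed
  ultimately show ?thesis using that yN by blast
qed

end


section \<open>Finite-dimensional subspaces\<close>

lemma common_convergent_subsequence:
  fixes g :: "'i \<Rightarrow> nat \<Rightarrow> real"
  assumes "finite I" "\<And>i. i \<in> I \<Longrightarrow> bounded (range (g i))"
  shows "\<exists>r. strict_mono (r :: nat \<Rightarrow> nat) \<and> (\<forall>i\<in>I. convergent (g i \<circ> r))"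
  using assms
proof (induction I rule: finite_induct)
  case empty
  then show ?case by (auto intro: exI[of _ id] strict_monoI)
next
  case (insert i I)
  have "\<exists>r. strict_mono (r :: nat \<Rightarrow> nat) \<and> (\<forall>i\<in>I. convergent (g i \<circ> r))"
    by (rule insert.IH) (use insert.prems in blast)
  then obtain r where r: "strict_mono (r :: nat \<Rightarrow> nat)" "\<forall>i\<in>I. convergent (g i \<circ> r)" by blast
  have "bounded (range (g i \<circ> r))"
    by (rule bounded_subset[of "range (g i)"]) (use insert.prems in auto)
  then obtain l s where s: "strict_mono (s :: nat \<Rightarrow> nat)" "((g i \<circ> r) \<circ> s) \<longlonglongrightarrow> l"
    using bounded_imp_convergent_subsequence by blast
  have "convergent (g j \<circ> (r \<circ> s))" if j: "j \<in> insert i I" for j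
  proof (cases "j = i")
    case True
    then show ?thesis using s(2) by (auto simp: convergent_def comp_assoc)
  next
    case False
    then obtain l where "(g j \<circ> r) \<longlonglongrightarrow> l" using r j by (auto simp: convergent_def)
    then have "((g j \<circ> r) \<circ> s) \<longlonglongrightarrow> l" by (rule LIMSEQ_subseq_LIMSEQ) (rule s)
    then show ?thesis by (auto simp: convergent_def comp_assoc)
  qed
  moreover have "strict_mono (r \<circ> s)" using r s by (simp add: strict_mono_o)
  ultimately show ?case by blast
qed

context hilbert
begin

definition orthonormal where
  "orthonormal U \<longleftrightarrow> U \<subseteq> S \<and> (\<forall>x\<in>U. \<forall>y\<in>U. f x y = (if x = y then 1 else 0))"

text \<open>
  Gram-Schmidt, one vector at a time: either the residue \<open>r\<close> of the new vector vanishes, or its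
  normalisation joins the system.
\<close>

lemma orthonormal_spanning_set:
  assumes "finite B" "B \<subseteq> S"
  shows "\<exists>U. finite U \<and> orthonormal U \<and> B \<subseteq> span U"
  using assms
proof (induction B rule: finite_induct)
  case empty
  then show ?case by (auto simp: orthonormal_def)
next
  case (insert b B)
  then obtain U where U: "finite U" "orthonormal U" "B \<subseteq> span U" by auto
  have US: "u \<in> S" if "u \<in> U" for u using U(2) that by (auto simp: orthonormal_def)
  have bS: "b \<in> S" using insert.prems by simp
  define proj where "proj = (\<Sum>u\<in>U. f b u *\<^sub>R u)"
  define r where "r = b - proj"
  have projS: "proj \<in> S" unfolding proj_def by (intro subspace_sum[OF subsp]) (auto simp: US)
  have rS: "r \<in> S" using bS projS by (simp add: r_def)
  have proj_span: "proj \<in> span U" unfolding proj_def by (intro span_sum span_scale span_base)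
  have orth: "f r u = 0" if u: "u \<in> U" for u
  proof -
    have "f proj u = (\<Sum>v\<in>U. f b v * f v u)"
      unfolding proj_def using U(1) US u by (subst sum_left) (auto simp: scale_left)
    also have "\<dots> = (\<Sum>v\<in>U. if v = u then f b v else 0)"
      using U(2) u by (intro sum.cong) (auto simp: orthonormal_def)
    also have "\<dots> = f b u" using U(1) u by simp
    finally show ?thesis using bS projS US[OF u] by (simp add: r_def diff_left)
  qed
  show ?case
  proof (cases "r = 0")
    case True
    then have "b \<in> span U" using proj_span by (simp add: r_def)
    then show ?thesis using U by blast
  next
    case False
    define v where "v = (1 / nrm r) *\<^sub>R r"
    have npos: "nrm r > 0"
      using False rS nonneg[OF rS] definite[OF rS] by (force simp: nrm_def)
    have vS: "v \<in> S" using rS by (simp add: v_def)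
    have "f v v = f r r / (nrm r)\<^sup>2"
      using rS by (simp add: v_def bilin power2_eq_square)
    then have "f v v = (nrm r)\<^sup>2 / (nrm r)\<^sup>2" by (simp only: nrm_sq[OF rS])
    then have vv: "f v v = 1" using npos by simp
    have vu: "f v u = 0" "f u v = 0" if "u \<in> U" for u
      using orth[OF that] rS US[OF that] sym[of u v] vS by (auto simp: v_def scale_left)
    have "orthonormal (insert v U)"
      using U(2) vS vv vu by (auto simp: orthonormal_def)
    moreover have "b \<in> span (insert v U)"
    proof -
      have "b = nrm r *\<^sub>R v + proj" using npos by (simp add: v_def r_def)
      also have "\<dots> \<in> span (insert v U)"
      proof (rule span_add)
        show "nrm r *\<^sub>R v \<in> span (insert v U)" by (intro span_scale span_base) simp
        show "proj \<in> span (insert v U)" using proj_span span_mono[of U "insert v U"] by auto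
      qed
      finally show ?thesis .
    qed
    moreover have "B \<subseteq> span (insert v U)" using U(3) span_mono[of U "insert v U"] by auto
    ultimately show ?thesis using U(1) by (intro exI[of _ "insert v U"]) auto
  qed
qed

lemma orthonormal_expansion:
  assumes U: "finite U" "orthonormal U" and x: "x \<in> span U"
  shows "x \<in> S \<and> f x x = (\<Sum>u\<in>U. (f x u)\<^sup>2)"
proof -
  have US: "u \<in> S" if "u \<in> U" for u using U(2) that by (auto simp: orthonormal_def)
  obtain c where c: "x = (\<Sum>u\<in>U. c u *\<^sub>R u)"
    using x U(1) by (auto simp: span_finite)
  have xS: "x \<in> S" unfolding c by (intro subspace_sum[OF subsp]) (auto simp: US)
  have coeff: "f x u = c u" if u: "u \<in> U" for u
  proof -
    have "f x u = (\<Sum>v\<in>U. c v * f v u)"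
      unfolding c using U(1) US u by (subst sum_left) (auto simp: scale_left)
    also have "\<dots> = (\<Sum>v\<in>U. if v = u then c v else 0)"
      using U(2) u by (intro sum.cong) (auto simp: orthonormal_def)
    also have "\<dots> = c u" using U(1) u by simp
    finally show ?thesis .
  qed
  have "f x x = (\<Sum>u\<in>U. f (c u *\<^sub>R u) x)"
    using U(1) US xS by (subst (1) c, subst sum_left) auto
  also have "\<dots> = (\<Sum>u\<in>U. (f x u)\<^sup>2)"
    using US xS by (intro sum.cong) (auto simp: scale_left sym[of _ x] scale_right coeff power2_eq_square)
  finally show ?thesis using xS by simp
qed

text \<open>
  Bounded sequences in a finite-dimensional space have Cauchy subsequences: the coordinates with
  respect to an orthonormal spanning set are finitely many bounded real sequences.
\<close>

lemma bounded_finite_dim_subsequence: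
  assumes "finite B" "B \<subseteq> S" and Y: "\<And>n. Y n \<in> span B" "\<And>n. f (Y n) (Y n) \<le> C"
  shows "\<exists>r. strict_mono (r :: nat \<Rightarrow> nat) \<and> Cauchy_seq (Y \<circ> r)"
proof -
  obtain U where U: "finite U" "orthonormal U" "B \<subseteq> span U"
    using orthonormal_spanning_set[OF assms(1,2)] by blast
  have YU: "Y n \<in> span U" for n
    using Y(1)[of n] span_minimal[OF U(3)] subspace_span by blast
  have YS: "Y n \<in> S" for n using orthonormal_expansion[OF U(1,2) YU] by blast
  have US: "u \<in> S" if "u \<in> U" for u using U(2) that by (auto simp: orthonormal_def)
  have "bounded (range (\<lambda>n. f (Y n) u))" if u: "u \<in> U" for u
    unfolding bounded_iff
  proof (intro exI[of _ "sqrt C"] ballI)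
    fix x assume "x \<in> range (\<lambda>n. f (Y n) u)"
    then obtain n where n: "x = f (Y n) u" by blast
    have "f u u = 1" using U(2) u by (simp add: orthonormal_def)
    then have "x\<^sup>2 \<le> C" using Cauchy_Schwarz[OF YS US[OF u], of n] Y(2)[of n] by (simp add: n)
    then show "norm x \<le> sqrt C" using real_le_rsqrt[of "\<bar>x\<bar>" C] by simp
  qed
  then obtain r where r: "strict_mono (r :: nat \<Rightarrow> nat)"
      and conv: "\<forall>u\<in>U. convergent ((\<lambda>n. f (Y n) u) \<circ> r)"
    using common_convergent_subsequence[OF U(1), of "\<lambda>u n. f (Y n) u"] by blast
  from conv have "\<forall>u\<in>U. \<exists>l. (\<lambda>n. f (Y (r n)) u) \<longlonglongrightarrow> l"
    unfolding convergent_def comp_def .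
  then obtain l where l: "\<And>u. u \<in> U \<Longrightarrow> (\<lambda>n. f (Y (r n)) u) \<longlonglongrightarrow> l u"
    by metis
  have "Cauchy_seq (Y \<circ> r)"
  proof (rule Cauchy_seqI[where e = "\<lambda>n. \<Sum>u\<in>U. 2 * (f (Y (r n)) u - l u)\<^sup>2"])
    have "(\<lambda>n. \<Sum>u\<in>U. 2 * (f (Y (r n)) u - l u)\<^sup>2) \<longlonglongrightarrow> (\<Sum>u\<in>U. 2 * (l u - l u)\<^sup>2)"
      by (intro tendsto_intros l)
    then show "(\<lambda>n. \<Sum>u\<in>U. 2 * (f (Y (r n)) u - l u)\<^sup>2) \<longlonglongrightarrow> 0" by simp
    fix m n
    have "f ((Y \<circ> r) m - (Y \<circ> r) n) ((Y \<circ> r) m - (Y \<circ> r) n) = (\<Sum>u\<in>U. (f (Y (r m) - Y (r n)) u)\<^sup>2)"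
      using orthonormal_expansion[OF U(1,2) span_diff[OF YU YU]] by simp
    also have "\<dots> \<le> (\<Sum>u\<in>U. 2 * (f (Y (r m)) u - l u)\<^sup>2 + 2 * (f (Y (r n)) u - l u)\<^sup>2)"
    proof (rule sum_mono)
      fix u assume u: "u \<in> U"
      have "(s - t)\<^sup>2 \<le> 2 * s\<^sup>2 + 2 * t\<^sup>2" for s t :: real
        using sum_squares_bound[of s "- t"] by (simp add: power2_diff)
      from this[of "f (Y (r m)) u - l u" "f (Y (r n)) u - l u"]
      show "(f (Y (r m) - Y (r n)) u)\<^sup>2 \<le> 2 * (f (Y (r m)) u - l u)\<^sup>2 + 2 * (f (Y (r n)) u - l u)\<^sup>2"
        using YS US[OF u] by (simp add: diff_left)
    qed
    finally show "f ((Y \<circ> r) m - (Y \<circ> r) n) ((Y \<circ> r) m - (Y \<circ> r) n)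
        \<le> (\<Sum>u\<in>U. 2 * (f (Y (r m)) u - l u)\<^sup>2) + (\<Sum>u\<in>U. 2 * (f (Y (r n)) u - l u)\<^sup>2)"
      by (simp add: sum.distrib)
  qed (simp add: YS)
  then show ?thesis using r by blast
qed

end

section \<open>Constrained minimisers of small perturbations\<close>

text \<open>
  Minimisation of \<open>J u = a u u - 2 * \<epsilon> * Psi u\<close> on the sphere \<open>b u u = 1\<close>. The functional \<open>Psi\<close> is
  convex with derivative \<open>psi\<close>, deviates from its tangents by at most \<open>C * b x x\<close>, and grows at least
  quadratically along rays, as integrals of powers \<open>|u|\<^sup>p\<close> do for \<open>p \<ge> 2\<close>. Subtracting \<open>2 * \<epsilon> * Psi\<close> thus
  destroys at most \<open>2 * \<epsilon> * C\<close> of the convexity of \<open>a\<close> relative to \<open>b\<close>. By the assumption \<open>small\<close> this is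
  less than the spectral gap above \<open>lam\<close>, so \<open>J\<close> stays uniformly convex on the constraint, except in
  the finitely many directions of the eigenspace \<open>N\<close>, where compactness is automatic.
\<close>

locale form_pair_perturbation = form_pair +
  fixes \<gamma> :: real and B :: "'a set" and Psi :: "'a \<Rightarrow> real" and psi :: "'a \<Rightarrow> 'a \<Rightarrow> real" and C \<epsilon> :: real
  assumes \<gamma>: "0 < \<gamma>" "\<gamma> < 1" "\<And>u. u \<in> S \<Longrightarrow> \<gamma> * a (L u) u \<le> a (L u) (L u)"
    and B: "finite B" "B \<subseteq> S" "N \<subseteq> span B"
    and psi_add: "\<lbrakk>u \<in> S; x \<in> S; y \<in> S\<rbrakk> \<Longrightarrow> psi u (x + y) = psi u x + psi u y"
    and psi_scale: "\<lbrakk>u \<in> S; x \<in> S\<rbrakk> \<Longrightarrow> psi u (t *\<^sub>R x) = t * psi u x"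
    and Psi_lower: "\<lbrakk>u \<in> S; x \<in> S\<rbrakk> \<Longrightarrow> Psi u + psi u x \<le> Psi (u + x)"
    and Psi_upper: "\<lbrakk>u \<in> S; x \<in> S\<rbrakk> \<Longrightarrow> Psi (u + x) \<le> Psi u + psi u x + C * b x x"
    and Psi_nonneg: "u \<in> S \<Longrightarrow> 0 \<le> Psi u"
    and Psi_le: "u \<in> S \<Longrightarrow> Psi u \<le> C * b u u"
    and Psi_scale: "\<lbrakk>u \<in> S; 0 \<le> t; t \<le> 1\<rbrakk> \<Longrightarrow> Psi (t *\<^sub>R u) \<le> t\<^sup>2 * Psi u"
    and C: "0 \<le> C" and \<epsilon>: "0 \<le> \<epsilon>"
    and small: "(1 - \<gamma>) * (lam + 2 * \<epsilon> * C) < lam"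
begin

definition J where "J u = a u u - 2 * \<epsilon> * Psi u"

definition sphere where "sphere = {u \<in> S. b u u = 1}"

definition J0 where "J0 = Inf (J ` sphere)"

text \<open>
  On the sphere \<open>Phi\<close> is \<open>J - J0\<close>, so it vanishes there exactly at the minimisers; the homogeneous
  extension is nonnegative on the whole unit ball of \<open>b\<close>. Working with \<open>Phi\<close> avoids renormalising vectors that have moved inside the ball.
\<close>

definition Phi where "Phi u = J u - J0 * b u u"

lemma normalize:
  assumes "u \<in> S" "0 < b u u" shows "(1 / b.nrm u) *\<^sub>R u \<in> sphere"
proof -
  have "0 < b.nrm u" using assms by (simp add: b.nrm_def)
  then show ?thesis using assms b.nrm_sq[of u]
    by (simp add: sphere_def b.bilin power2_eq_square)
qed

lemma J_ge: "u \<in> sphere \<Longrightarrow> lam - 2 * \<epsilon> * C \<le> J u"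
  using lam_le[of u] Psi_le[of u] mult_left_mono[of "Psi u" C "2 * \<epsilon>"] \<epsilon>
  by (simp add: J_def sphere_def)

lemma J_bdd: "bdd_below (J ` sphere)"
  by (rule bdd_belowI2) (rule J_ge)

lemma J0_le_J: "u \<in> sphere \<Longrightarrow> J0 \<le> J u"
  unfolding J0_def by (intro cInf_lower J_bdd) auto

lemma sphere_nonempty: "sphere \<noteq> {}"
  using lam_approx[of 1] normalize by auto

lemma J0_le_lam: "J0 \<le> lam"
proof (rule field_le_epsilon)
  fix e :: real assume "0 < e"
  then obtain x where x: "x \<in> S" "0 < b x x" "a x x < (lam + e) * b x x" using lam_approx by blast
  let ?y = "(1 / b.nrm x) *\<^sub>R x"
  have y: "?y \<in> sphere" by (rule normalize) (use x in auto)
  have "0 \<le> 2 * \<epsilon> * Psi ?y" using Psi_nonneg[of ?y] \<epsilon> x by simp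
  then have "J0 \<le> a ?y ?y" using J0_le_J[OF y] unfolding J_def by linarith
  also have "\<dots> = a x x / (b.nrm x)\<^sup>2" using x by (simp add: a.bilin power2_eq_square)
  also have "\<dots> = a x x / b x x" using x by (simp add: b.nrm_sq)
  also have "\<dots> \<le> lam + e" using x by (simp add: field_simps)
  finally show "J0 \<le> lam + e" .
qed

text \<open>
  Scaling a vector of the ball up to the sphere changes \<open>a\<close> quadratically and increases \<open>Psi\<close> at least
  quadratically, which only lowers \<open>J\<close>.
\<close>

lemma Phi_nonneg:
  assumes u: "u \<in> S" "b u u \<le> 1"
  shows "0 \<le> Phi u"
proof (cases "b u u = 0")
  case True
  then have "Psi u \<le> 0" using Psi_le[OF u(1)] by simp
  then show ?thesis using True a.nonneg[OF u(1)] \<epsilon> mult_nonneg_nonpos[of \<epsilon> "Psi u"] by (simp add: Phi_def J_def)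
next
  case False
  define s where "s = b.nrm u"
  have s: "0 < s" "s \<le> 1" "s\<^sup>2 = b u u"
    using False u b.nonneg[OF u(1)] b.nrm_sq[OF u(1)] by (auto simp: s_def b.nrm_def)
  let ?v = "(1 / s) *\<^sub>R u"
  have v: "?v \<in> sphere" using normalize[OF u(1)] False b.nonneg[OF u(1)] by (simp add: s_def)
  have "Psi (s *\<^sub>R ?v) \<le> s\<^sup>2 * Psi ?v" using s u by (intro Psi_scale) auto
  then have P: "Psi u \<le> s\<^sup>2 * Psi ?v" using s by simp
  have "J0 * s\<^sup>2 \<le> J ?v * s\<^sup>2" using J0_le_J[OF v] by (intro mult_right_mono) auto
  also have "\<dots> = a u u - 2 * \<epsilon> * (s\<^sup>2 * Psi ?v)"
    using s(1) u by (simp add: J_def a.bilin power2_eq_square field_simps)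
  also have "\<dots> \<le> J u" using mult_left_mono[OF P, of "2 * \<epsilon>"] \<epsilon> by (simp add: J_def)
  finally show ?thesis by (simp add: Phi_def s)
qed

lemma decomposition:
  assumes "u \<in> S"
  obtains y where "y \<in> N" "\<And>n. n \<in> N \<Longrightarrow> a n (u - y) = 0"
proof (rule kernel_decomposition[OF \<gamma> assms])
  fix y assume "y \<in> N" "\<And>n. n \<in> N \<Longrightarrow> a n (u - y) = 0"
  then show ?thesis by (rule that)
qed

text \<open>
  A vector orthogonal to \<open>N\<close> has no component in \<open>N\<close> in \<open>kernel_decomposition\<close>.
\<close>

lemma gap:
  assumes u: "u \<in> S" and orth: "\<And>n. n \<in> N \<Longrightarrow> a n u = 0"
  shows "lam * b u u \<le> (1 - \<gamma>) * a u u"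
proof -
  obtain y where y: "y \<in> N" "\<And>n. n \<in> N \<Longrightarrow> a n (u - y) = 0"
    "lam * b (u - y) (u - y) \<le> (1 - \<gamma>) * a (u - y) (u - y)"
    using kernel_decomposition[OF \<gamma> u] by blast
  have yS: "y \<in> S" using y by (simp add: N_def)
  have "a y y = 0" using y(2)[OF y(1)] orth[OF y(1)] u yS by (simp add: a.bilin)
  then have "y = 0" using a.definite yS by simp
  then show ?thesis using y(3) by simp
qed

text \<open>
  The parallelogram identity for \<open>a\<close> and \<open>b\<close> and the second-order bound for \<open>Psi\<close> compare \<open>Phi\<close> at
  two points of the sphere with \<open>Phi\<close> at their midpoint, which is nonnegative because the midpoint
  lies in the unit ball.
\<close>

lemma midpoint_defect:
  assumes u: "u \<in> sphere" and v: "v \<in> sphere"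
  shows "a (u - v) (u - v) - (J0 + 2 * \<epsilon> * C) * b (u - v) (u - v) \<le> 2 * (Phi u + Phi v)"
proof -
  define d where "d = (1/2) *\<^sub>R (u - v)"
  define h where "h = (1/2) *\<^sub>R (u + v)"
  have S: "u \<in> S" "v \<in> S" "d \<in> S" "h \<in> S" using u v by (auto simp: sphere_def d_def h_def)
  have uv: "u = h + d" "v = h - d"
    by (simp_all add: h_def d_def scaleR_add_right scaleR_diff_right flip: scaleR_add_left)
  have d: "a (u - v) (u - v) = 4 * a d d" "b (u - v) (u - v) = 4 * b d d"
    using S(1,2) by (simp_all add: d_def a.bilin b.bilin field_simps)
  have "b h h + b d d = (b u u + b v v) / 2"
    using S by (simp add: uv b.bilin b.sym[of d h])
  then have "b h h + b d d = 1" using u v by (simp add: sphere_def)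
  then have h: "b h h \<le> 1" using b.nonneg[OF S(3)] by simp
  have psi_neg: "psi h (- d) = - psi h d" using psi_scale[of h d "-1"] S by simp
  have P: "Psi u + Psi v \<le> 2 * Psi h + 2 * C * b d d"
    using Psi_upper[of h d] Psi_upper[of h "- d"] S psi_neg by (simp add: uv b.bilin)
  have "Phi u + Phi v = 2 * Phi h + 2 * a d d - 2 * \<epsilon> * (Psi u + Psi v - 2 * Psi h) - 2 * J0 * b d d"
    using S by (simp add: Phi_def J_def uv a.bilin b.bilin a.sym[of d h] b.sym[of d h] algebra_simps)
  moreover have "2 * \<epsilon> * (Psi u + Psi v - 2 * Psi h) \<le> 2 * \<epsilon> * (2 * C * b d d)"
    using P \<epsilon> by (intro mult_left_mono) auto
  ultimately have "2 * a d d - (2 * \<epsilon> * (2 * C * b d d) + 2 * J0 * b d d) \<le> Phi u + Phi v"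
    using Phi_nonneg[OF S(4) h] by linarith
  then show ?thesis unfolding d by (simp add: algebra_simps)
qed

text \<open>
  A minimising sequence \<open>X\<close> has a Cauchy subsequence. Split \<open>X n\<close> into its component \<open>Y n\<close> in \<open>N\<close> and
  the rest. The \<open>Y n\<close> are bounded in a finite-dimensional space, so a subsequence of them converges. In
  the orthogonal directions the left side of \<open>midpoint_defect\<close> is at least a positive multiple of
  the energy of the difference, by the gap, while the right side tends to \<open>0\<close>. No weak convergence is
  involved: the escape of mass along unbounded directions is excluded by the gap alone.
\<close>

lemma minimizer_exists:
  "\<exists>w\<in>sphere. Phi w \<le> 0"
proof -
  obtain X where X: "\<And>n. X n \<in> sphere" "\<And>n. J (X n) < J0 + 1 / Suc n"
    unfolding J0_def using minimizing_sequence[OF sphere_nonempty J_bdd] by blast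
  have XS: "X n \<in> S" "b (X n) (X n) = 1" for n using X(1)[of n] by (auto simp: sphere_def)
  have PhiX: "Phi (X n) \<le> 1 / Suc n" for n using X(2)[of n] XS(2)[of n] by (simp add: Phi_def)
  have aX: "a (X n) (X n) \<le> lam + 1 + 2 * \<epsilon> * C" for n
  proof -
    have "2 * \<epsilon> * Psi (X n) \<le> 2 * \<epsilon> * C"
      using Psi_le[OF XS(1)[of n]] XS(2)[of n] \<epsilon> by (intro mult_left_mono) auto
    moreover have "1 / real (Suc n) \<le> 1" by simp
    ultimately show ?thesis using X(2)[of n] J0_le_lam unfolding J_def by linarith
  qed
  have "\<exists>y. y \<in> N \<and> (\<forall>n\<in>N. a n (X k - y) = 0)" for k
    using decomposition[OF XS(1)[of k]] by metis
  then obtain Y where Y: "\<And>k. Y k \<in> N" "\<And>k n. n \<in> N \<Longrightarrow> a n (X k - Y k) = 0" by metis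
  have YS: "Y k \<in> S" for k using Y(1)[of k] by (simp add: N_def)
  have "a (Y k) (Y k) \<le> lam + 1 + 2 * \<epsilon> * C" for k
  proof -
    have "a (X k) (X k) = a (Y k) (Y k) + a (X k - Y k) (X k - Y k)"
      using Y(2)[OF Y(1), of k k] XS(1)[of k] YS[of k] by (simp add: a.bilin a.sym[of "X k" "Y k"])
    then show ?thesis using aX[of k] a.nonneg[of "X k - Y k"] XS YS by simp
  qed
  moreover have "Y k \<in> span B" for k using Y(1) B(3) by blast
  ultimately obtain r where r: "strict_mono (r :: nat \<Rightarrow> nat)" "a.Cauchy_seq (Y \<circ> r)"
    using a.bounded_finite_dim_subsequence[OF B(1,2)] by metis
  define \<kappa> where "\<kappa> = lam + 2 * \<epsilon> * C"
  (* Orthogonally to N the gap gives \<kappa> * b z z \<le> \<theta> * a z z, so a fraction 1 - \<theta> of the energy survives in midpoint_defect. *)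
  define \<theta> where "\<theta> = \<kappa> * (1 - \<gamma>) / lam"
  have \<kappa>: "0 < \<kappa>" using lam_ge_1 \<epsilon> C by (simp add: \<kappa>_def add_pos_nonneg)
  have \<theta>: "\<theta> < 1" using small lam_ge_1 by (simp add: \<theta>_def \<kappa>_def field_simps)
  have key: "(1 - \<theta>) * a (X m - X n) (X m - X n)
      \<le> 2 * (Phi (X m) + Phi (X n)) + (1 + \<kappa> - \<theta>) * a (Y m - Y n) (Y m - Y n)" for m n
  proof -
    define d y z where "d = X m - X n" and "y = Y m - Y n" and "z = d - y"
    have yN: "y \<in> N" using Y(1) N_subspace by (simp add: y_def subspace_diff)
    have S: "d \<in> S" "y \<in> S" "z \<in> S" using XS YS by (auto simp: d_def y_def z_def)
    have orth: "a k z = 0" if k: "k \<in> N" for k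
    proof -
      have "z = (X m - Y m) - (X n - Y n)" by (simp add: z_def d_def y_def)
      moreover have "k \<in> S" using k by (simp add: N_def)
      ultimately show ?thesis using Y(2)[OF k] XS(1) YS by (simp add: a.diff_right)
    qed
    have ay: "a y z = 0" by (rule orth[OF yN])
    then have "lam * b y z = 0" using N_form[OF yN S(3)] by simp
    then have by0: "b y z = 0" using lam_ge_1 by simp
    have dd: "d = y + z" by (simp add: z_def)
    have ad: "a d d = a y y + a z z" and bd: "b d d = b y y + b z z"
      using S ay by0 by (simp_all add: dd a.bilin b.bilin a.sym[of z y] b.sym[of z y])
    have "lam * b z z \<le> (1 - \<gamma>) * a z z" using gap[OF S(3) orth] .
    then have "\<kappa> / lam * (lam * b z z) \<le> \<kappa> / lam * ((1 - \<gamma>) * a z z)"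
      using \<kappa> lam_ge_1 by (intro mult_left_mono) auto
    then have bz: "\<kappa> * b z z \<le> \<theta> * a z z" using lam_ge_1 by (simp add: \<theta>_def mult_ac)
    have "\<kappa> * b y y \<le> \<kappa> * a y y" using b_le_a[OF S(2)] \<kappa> by simp
    moreover have "(J0 + 2 * \<epsilon> * C) * b d d \<le> \<kappa> * b d d"
      using J0_le_lam b.nonneg[OF S(1)] by (intro mult_right_mono) (auto simp: \<kappa>_def)
    moreover have "a d d - (J0 + 2 * \<epsilon> * C) * b d d \<le> 2 * (Phi (X m) + Phi (X n))"
      unfolding d_def by (intro midpoint_defect X)
    ultimately have "a d d - \<kappa> * b z z - \<kappa> * a y y \<le> 2 * (Phi (X m) + Phi (X n))"
      by (simp add: bd algebra_simps)
    then have "a d d - \<theta> * a z z - \<kappa> * a y y \<le> 2 * (Phi (X m) + Phi (X n))" using bz by linarith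
    then show ?thesis unfolding d_def[symmetric] y_def[symmetric]
      using a.nonneg[OF S(2)] by (simp add: ad algebra_simps)
  qed
  have inv0: "(\<lambda>n. inverse (real (Suc (r n)))) \<longlonglongrightarrow> 0"
    using LIMSEQ_subseq_LIMSEQ[OF LIMSEQ_inverse_real_of_nat r(1)] by (simp add: comp_def)
  have "a.Cauchy_seq (X \<circ> r)"
    unfolding a.Cauchy_seq_def
  proof (intro conjI allI impI)
    fix e :: real assume e: "0 < e"
    define \<delta> where "\<delta> = (1 - \<theta>) * e\<^sup>2 / 8"
    have \<delta>: "0 < \<delta>" using \<theta> e by (simp add: \<delta>_def)
    have \<kappa>': "0 < 1 + \<kappa> - \<theta>" using \<kappa> \<theta> by simp
    have "\<forall>\<^sub>F n in sequentially. inverse (real (Suc (r n))) < \<delta>"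
      by (rule order_tendstoD(2)[OF inv0 \<delta>])
    then obtain N1 where N1: "\<And>n. n \<ge> N1 \<Longrightarrow> inverse (real (Suc (r n))) < \<delta>"
      by (auto simp: eventually_sequentially)
    obtain N2 where N2: "\<And>m n. m \<ge> N2 \<Longrightarrow> n \<ge> N2 \<Longrightarrow> a.nrm (Y (r m) - Y (r n)) < sqrt (\<delta> / (1 + \<kappa> - \<theta>))"
      using r(2) \<delta> \<kappa>' unfolding a.Cauchy_seq_def by (metis comp_apply divide_pos_pos real_sqrt_gt_0_iff)
    have "a.nrm (X (r m) - X (r n)) < e" if "m \<ge> max N1 N2" "n \<ge> max N1 N2" for m n
    proof -
      have "a.nrm (Y (r m) - Y (r n)) < sqrt (\<delta> / (1 + \<kappa> - \<theta>))" using N2 that by simp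
      then have "a (Y (r m) - Y (r n)) (Y (r m) - Y (r n)) < \<delta> / (1 + \<kappa> - \<theta>)"
        by (simp add: a.nrm_def)
      then have "(1 + \<kappa> - \<theta>) * a (Y (r m) - Y (r n)) (Y (r m) - Y (r n)) < \<delta>"
        using \<kappa>' by (simp add: field_simps)
      moreover have "Phi (X (r m)) \<le> \<delta>" "Phi (X (r n)) \<le> \<delta>"
        using PhiX[of "r m"] PhiX[of "r n"] N1[of m] N1[of n] that by (auto simp: inverse_eq_divide)
      moreover have "P < 8 * \<delta>" if "Q < \<delta>" "F \<le> \<delta>" "H \<le> \<delta>" "P \<le> 2 * (F + H) + Q" for P Q F H :: real
        using that \<delta> by simp
      ultimately have "(1 - \<theta>) * a (X (r m) - X (r n)) (X (r m) - X (r n)) < 8 * \<delta>"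
        using key[of "r m" "r n"] by blast
      then have "a (X (r m) - X (r n)) (X (r m) - X (r n)) < e\<^sup>2" using \<theta> by (simp add: \<delta>_def)
      then show ?thesis unfolding a.nrm_def using e by (intro real_less_lsqrt) auto
    qed
    then show "\<exists>N. \<forall>m\<ge>N. \<forall>n\<ge>N. a.nrm ((X \<circ> r) m - (X \<circ> r) n) < e"
      unfolding comp_apply by blast
  qed (use XS in simp)
  then obtain w where w: "w \<in> S" "(\<lambda>n. a.nrm ((X \<circ> r) n - w)) \<longlonglongrightarrow> 0"
    using a.complete by blast
  have bw: "(\<lambda>n. b.nrm (X (r n) - w)) \<longlonglongrightarrow> 0"
    by (rule Lim_null_comparison[OF always_eventually w(2)])
       (use w XS b_nrm_le in auto)
  have "(\<lambda>n. b (X (r n)) (X (r n))) \<longlonglongrightarrow> b w w"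
    by (intro b.tendsto_form bw) (use XS w in auto)
  then have bww: "b w w = 1" using XS(2) by (simp add: LIMSEQ_const_iff)
  have ws: "w \<in> sphere" using w bww by (simp add: sphere_def)
  (* Convexity and the quadratic growth bound make the derivative of Psi at w bounded: on the unit
     ball psi w x is at most Psi (w + x), hence at most 4 * C. *)
  have psi_bound: "\<bar>psi w v\<bar> \<le> 4 * C * a.nrm v" if v: "v \<in> S" for v
  proof (cases "v = 0")
    case True
    then show ?thesis using psi_scale[of w 0 0] w by (simp add: a.nrm_def a.zero_left)
  next
    case False
    then have n: "a.nrm v > 0" using a.definite[OF v] a.nonneg[OF v] by (force simp: a.nrm_def)
    have one: "psi w x \<le> 4 * C" if x: "x \<in> S" "b x x \<le> 1" for x
    proof -
      have "psi w x \<le> Psi (w + x)" using Psi_lower[OF w(1) x(1)] Psi_nonneg[OF w(1)] by simp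
      also have "\<dots> \<le> C * b (w + x) (w + x)" using w x by (intro Psi_le) auto
      also have "b (w + x) (w + x) \<le> 4"
      proof -
        have "b w x \<le> b.nrm w * b.nrm x" using b.abs_le_nrm[of w x] w x by simp
        also have "\<dots> \<le> 1 * 1" using bww x b.nonneg[of x] by (intro mult_mono) (auto simp: b.nrm_def)
        finally show ?thesis using w x bww by (simp add: b.bilin b.sym[of x w])
      qed
      finally show ?thesis using C by (simp add: mult_left_mono)
    qed
    have "b ((1 / a.nrm v) *\<^sub>R v) ((1 / a.nrm v) *\<^sub>R v) \<le> a ((1 / a.nrm v) *\<^sub>R v) ((1 / a.nrm v) *\<^sub>R v)"
      using v by (intro b_le_a) auto
    also have "\<dots> = a v v / (a.nrm v)\<^sup>2" using v by (simp add: a.bilin power2_eq_square)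
    also have "\<dots> = (a.nrm v)\<^sup>2 / (a.nrm v)\<^sup>2" by (simp only: a.nrm_sq[OF v])
    also have "\<dots> = 1" using n by simp
    finally have le1: "b ((1 / a.nrm v) *\<^sub>R v) ((1 / a.nrm v) *\<^sub>R v) \<le> 1" .
    have "psi w ((1 / a.nrm v) *\<^sub>R v) \<le> 4 * C" "psi w ((- 1) *\<^sub>R ((1 / a.nrm v) *\<^sub>R v)) \<le> 4 * C"
      by (intro one; use v le1 in \<open>simp add: b.bilin\<close>)+
    then have "psi w v / a.nrm v \<le> 4 * C" "- (psi w v / a.nrm v) \<le> 4 * C"
      using v w by (simp_all only: psi_scale a.mem) simp_all
    then show ?thesis using n by (simp add: abs_le_iff field_simps)
  qed
  have "Phi w \<le> 0"
  proof (rule LIMSEQ_le)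
    let ?R = "\<lambda>n. 4 * C * a.nrm (X (r n) - w) + C * b (X (r n) - w) (X (r n) - w)"
    have "?R \<longlonglongrightarrow> 4 * C * 0 + C * 0\<^sup>2"
    proof (intro tendsto_intros)
      show "(\<lambda>n. a.nrm (X (r n) - w)) \<longlonglongrightarrow> 0" using w by simp
      show "(\<lambda>n. b (X (r n) - w) (X (r n) - w)) \<longlonglongrightarrow> 0\<^sup>2"
        using tendsto_power[OF bw, of 2] XS w by (simp add: b.nrm_sq)
    qed
    then have R: "?R \<longlonglongrightarrow> 0" by simp
    have aw: "(\<lambda>n. a (X (r n)) (X (r n))) \<longlonglongrightarrow> a w w"
      by (intro a.tendsto_form) (use XS w in auto)
    have "(\<lambda>n. a w w - a (X (r n)) (X (r n)) + 2 * \<epsilon> * ?R n + inverse (real (Suc (r n))))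
       \<longlonglongrightarrow> a w w - a w w + 2 * \<epsilon> * 0 + 0"
      by (intro tendsto_intros aw R inv0)
    then show "(\<lambda>n. a w w - a (X (r n)) (X (r n)) + 2 * \<epsilon> * ?R n + inverse (real (Suc (r n)))) \<longlonglongrightarrow> 0" by simp
    show "(\<lambda>n. Phi w) \<longlonglongrightarrow> Phi w" by simp
    have "Phi w \<le> a w w - a (X (r n)) (X (r n)) + 2 * \<epsilon> * ?R n + inverse (real (Suc (r n)))" for n
    proof -
      have "Psi (w + (X (r n) - w)) \<le> Psi w + psi w (X (r n) - w) + C * b (X (r n) - w) (X (r n) - w)"
        using w XS by (intro Psi_upper) auto
      moreover have "psi w (X (r n) - w) \<le> 4 * C * a.nrm (X (r n) - w)"
        using psi_bound[of "X (r n) - w"] w XS by auto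
      ultimately have "Psi (X (r n)) - Psi w \<le> ?R n" by simp
      then have "2 * \<epsilon> * (Psi (X (r n)) - Psi w) \<le> 2 * \<epsilon> * ?R n" using \<epsilon> by (intro mult_left_mono) auto
      moreover have "a (X (r n)) (X (r n)) - 2 * \<epsilon> * Psi (X (r n)) - J0 \<le> inverse (real (Suc (r n)))"
        using PhiX[of "r n"] XS(2) by (simp add: Phi_def J_def inverse_eq_divide)
      ultimately show ?thesis unfolding Phi_def J_def by (simp add: bww algebra_simps)
    qed
    then show "\<exists>N. \<forall>n\<ge>N. Phi w \<le> a w w - a (X (r n)) (X (r n)) + 2 * \<epsilon> * ?R n + inverse (real (Suc (r n)))"
      by blast
  qed
  then show ?thesis using ws by blast
qed

text \<open>
  The first-order condition for \<open>Phi\<close> at its minimum \<open>w\<close>. The variation \<open>w + t v\<close> leaves the unit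
  ball at second order in \<open>t\<close>; the correction \<open>- \<kappa> t\<^sup>2 w\<close> brings it back inside and contributes only at second
  order.
\<close>

lemma Euler_Lagrange_orthogonal:
  assumes w: "w \<in> sphere" "Phi w \<le> 0" and v: "v \<in> S" "b w v = 0"
  shows "a w v = \<epsilon> * psi w v"
proof -
  have wS: "w \<in> S" "b w w = 1" using w by (auto simp: sphere_def)
  define \<kappa> where "\<kappa> = b v v + 1"
  have \<kappa>: "1 \<le> \<kappa>" using b.nonneg[OF v(1)] by (simp add: \<kappa>_def)
  define c where "c = 2 * a v v + 2 * a w w + \<bar>J0\<bar> * \<kappa> - 2 * \<kappa> * a w w + 2 * \<epsilon> * \<kappa> * psi w w + 2 * J0 * \<kappa>"
  have "0 \<le> t * (2 * (a w v - \<epsilon> * psi w v)) + t\<^sup>2 * c" if t: "\<bar>t\<bar> \<le> 1 / \<kappa>" for t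
  proof -
    have "\<bar>\<kappa> * t\<bar> \<le> 1" using t \<kappa> by (simp add: abs_mult field_simps)
    then have kt: "\<kappa>\<^sup>2 * t\<^sup>2 \<le> 1" by (metis abs_square_le_1 power_mult_distrib)
    have kt4: "\<kappa>\<^sup>2 * t\<^sup>2 * t\<^sup>2 \<le> t\<^sup>2" using mult_right_mono[OF kt, of "t\<^sup>2"] by simp
    define x where "x = t *\<^sub>R v - (\<kappa> * t\<^sup>2) *\<^sub>R w"
    have xS: "x \<in> S" using v wS by (simp add: x_def)
    have awx: "a w x = t * a w v - \<kappa> * t\<^sup>2 * a w w" using v wS by (simp add: x_def a.bilin)
    have bwx: "b w x = - (\<kappa> * t\<^sup>2)" using v wS by (simp add: x_def b.bilin)
    have bxx: "b x x = t\<^sup>2 * b v v + \<kappa>\<^sup>2 * t\<^sup>2 * t\<^sup>2"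
      using v wS by (simp add: x_def b.bilin b.sym[of v w] power2_eq_square)
    have bx_le: "b x x \<le> \<kappa> * t\<^sup>2" using kt4 by (simp add: bxx \<kappa>_def algebra_simps)
    have pwx: "psi w x = t * psi w v - \<kappa> * t\<^sup>2 * psi w w"
    proof -
      have "x = t *\<^sub>R v + (- (\<kappa> * t\<^sup>2)) *\<^sub>R w" by (simp add: x_def)
      then show ?thesis using v wS by (simp add: psi_add psi_scale del: scaleR_minus_left)
    qed
    have axx: "a x x \<le> 2 * t\<^sup>2 * a v v + 2 * t\<^sup>2 * a w w"
    proof -
      have "0 \<le> a (t *\<^sub>R v + (\<kappa> * t\<^sup>2) *\<^sub>R w) (t *\<^sub>R v + (\<kappa> * t\<^sup>2) *\<^sub>R w)"
        using v wS by (intro a.nonneg) auto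
      then have "a x x \<le> 2 * t\<^sup>2 * a v v + 2 * (\<kappa>\<^sup>2 * t\<^sup>2 * t\<^sup>2) * a w w"
        using v wS by (simp add: x_def a.bilin a.sym[of v w] power2_eq_square algebra_simps)
      also have "2 * (\<kappa>\<^sup>2 * t\<^sup>2 * t\<^sup>2) * a w w \<le> 2 * t\<^sup>2 * a w w"
        using kt4 a.nonneg[OF wS(1)] by (intro mult_right_mono) auto
      finally show ?thesis by simp
    qed
    have "b (w + x) (w + x) = 1 - 2 * (\<kappa> * t\<^sup>2) + b x x"
      using bwx wS xS by (simp add: b.bilin b.sym[of x w])
    moreover have "0 \<le> \<kappa> * t\<^sup>2" using \<kappa> by simp
    ultimately have "b (w + x) (w + x) \<le> 1" using bx_le by linarith
    then have "0 \<le> Phi (w + x)" using wS xS by (intro Phi_nonneg) auto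
    also have "\<dots> \<le> Phi w + 2 * a w x + a x x - 2 * \<epsilon> * psi w x - 2 * J0 * b w x - J0 * b x x"
    proof -
      have "2 * \<epsilon> * (Psi w + psi w x) \<le> 2 * \<epsilon> * Psi (w + x)"
        using Psi_lower[OF wS(1) xS] \<epsilon> by (intro mult_left_mono) auto
      then show ?thesis
        using wS xS by (simp add: Phi_def J_def a.bilin b.bilin a.sym[of x w] b.sym[of x w] algebra_simps)
    qed
    finally have 1: "0 \<le> Phi w + 2 * a w x + a x x - 2 * \<epsilon> * psi w x - 2 * J0 * b w x - J0 * b x x" .
    have "- J0 * b x x \<le> \<bar>J0\<bar> * (\<kappa> * t\<^sup>2)"
      using bx_le b.nonneg[OF xS] by (intro mult_mono) auto
    then have "0 \<le> 2 * a w x + a x x - 2 * \<epsilon> * psi w x - 2 * J0 * b w x + \<bar>J0\<bar> * (\<kappa> * t\<^sup>2)"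
      using 1 w(2) by simp
    also have "\<dots> \<le> 2 * a w x + (2 * t\<^sup>2 * a v v + 2 * t\<^sup>2 * a w w) - 2 * \<epsilon> * psi w x - 2 * J0 * b w x + \<bar>J0\<bar> * (\<kappa> * t\<^sup>2)"
      using axx by simp
    also have "\<dots> = t * (2 * (a w v - \<epsilon> * psi w v)) + t\<^sup>2 * c"
      by (simp add: awx bwx pwx c_def algebra_simps)
    finally show ?thesis .
  qed
  then have "2 * (a w v - \<epsilon> * psi w v) = 0"
    using \<kappa> by (intro linear_coefficient_zero[of "1 / \<kappa>"]) auto
  then show ?thesis by simp
qed

text \<open>
  For general \<open>v\<close>, \<open>Euler_Lagrange_orthogonal\<close> applies to \<open>v - b w v *\<^sub>R w\<close>; the multiplier is
  obtained by testing with \<open>w\<close>.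
\<close>

theorem constrained_minimizer:
  "\<exists>w\<in>S. b w w = 1 \<and> a w w - 2 * \<epsilon> * Psi w \<le> lam \<and>
     (\<forall>v\<in>S. a w v - \<epsilon> * psi w v = (a w w - \<epsilon> * psi w w) * b w v)"
proof -
  obtain w where w: "w \<in> sphere" "Phi w \<le> 0" using minimizer_exists by blast
  have wS: "w \<in> S" "b w w = 1" using w by (auto simp: sphere_def)
  have "a w v - \<epsilon> * psi w v = (a w w - \<epsilon> * psi w w) * b w v" if v: "v \<in> S" for v
  proof -
    define x where "x = v + (- b w v) *\<^sub>R w"
    have "b w x = 0" using v wS by (simp add: x_def b.bilin)
    then have "a w x = \<epsilon> * psi w x" using v wS by (intro Euler_Lagrange_orthogonal w) (auto simp: x_def)
    moreover have "a w x = a w v - b w v * a w w" using v wS by (simp add: x_def a.bilin)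
    moreover have "psi w x = psi w v - b w v * psi w w"
    proof -
      have "psi w x = psi w v + (- b w v) * psi w w"
        unfolding x_def using v wS by (simp only: psi_add psi_scale a.mem)
      then show ?thesis by simp
    qed
    ultimately show ?thesis by (simp add: algebra_simps)
  qed
  moreover have "a w w - 2 * \<epsilon> * Psi w \<le> lam"
    using w(2) J0_le_lam wS by (simp add: Phi_def J_def)
  ultimately show ?thesis using wS by blast
qed

end


section \<open>Weak derivatives on the line\<close>

lemma set_integrable_subset_lebesgue:
  fixes f :: "real \<Rightarrow> 'a::{banach, second_countable_topology}"
  assumes "set_integrable lebesgue {a..b} f" "a \<le> c" "d \<le> b"
  shows "set_integrable lebesgue {c..d} f"
  by (rule set_integrable_subset[OF assms(1)]) (use assms in auto)

lemma set_integral_subset_le: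
  fixes f :: "real \<Rightarrow> real"
  assumes f: "set_integrable lebesgue B f" and A: "A \<subseteq> B" "A \<in> sets lebesgue"
    and nonneg: "\<And>x. x \<in> B \<Longrightarrow> 0 \<le> f x"
  shows "(LINT x:A|lebesgue. f x) \<le> (LINT x:B|lebesgue. f x)"
  unfolding set_lebesgue_integral_def
proof (rule integral_mono)
  show "integrable lebesgue (\<lambda>x. indicat_real A x *\<^sub>R f x)"
    using set_integrable_subset[OF f A(2,1)] by (simp add: set_integrable_def)
  show "integrable lebesgue (\<lambda>x. indicat_real B x *\<^sub>R f x)" using f by (simp add: set_integrable_def)
qed (use A nonneg in \<open>auto simp: indicator_def\<close>)

lemma set_integral_point:
  fixes f :: "real \<Rightarrow> 'a::{banach, second_countable_topology}"
  shows "(LINT t:{c..c}|lebesgue. f t) = 0"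
proof -
  have "AE t in lebesgue. t \<noteq> c" by (simp add: AE_completion AE_lborel_singleton)
  then have "AE t in lebesgue. indicator {c..c} t *\<^sub>R f t = 0"
    by eventually_elim (auto simp: indicator_def)
  then show ?thesis unfolding set_lebesgue_integral_def by (rule integral_eq_zero_AE)
qed

lemma set_integral_combine:
  fixes f :: "real \<Rightarrow> 'a::{banach, second_countable_topology}"
  assumes "set_integrable lebesgue {a..c} f" "a \<le> b" "b \<le> c"
  shows "(LINT t:{a..c}|lebesgue. f t) = (LINT t:{a..b}|lebesgue. f t) + (LINT t:{b..c}|lebesgue. f t)"
proof -
  have "AE t in lebesgue. \<not> (t \<in> {a..b} \<and> t \<in> {b..c})"
  proof -
    have "AE t in lebesgue. t \<noteq> b" by (simp add: AE_completion AE_lborel_singleton)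
    then show ?thesis by eventually_elim auto
  qed
  then have "(LINT t:{a..b} \<union> {b..c}|lebesgue. f t) = (LINT t:{a..b}|lebesgue. f t) + (LINT t:{b..c}|lebesgue. f t)"
    using assms by (intro set_integral_Un_AE) (auto intro: set_integrable_subset_lebesgue)
  then show ?thesis using assms by (simp add: ivl_disj_un)
qed

text \<open>
  Integration by parts for absolutely continuous functions. The product of the two integrals is
  an integral of \<open>f s * g t\<close> over a square; the two terms on the right are its parts over the two
  triangles into which the diagonal cuts the square.
\<close>

lemma indefinite_integral_product:
  fixes f g F G :: "real \<Rightarrow> complex"
  assumes ab: "a \<le> b"
    and f: "set_integrable lebesgue {a..b} f" and g: "set_integrable lebesgue {a..b} g"
    and F: "\<And>x. x \<in> {a..b} \<Longrightarrow> F x = F a + (LINT t:{a..x}|lebesgue. f t)"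
    and G: "\<And>x. x \<in> {a..b} \<Longrightarrow> G x = G a + (LINT t:{a..x}|lebesgue. g t)"
  shows "set_integrable lebesgue {a..b} (\<lambda>x. f x * G x + F x * g x)"
    and "F b * G b - F a * G a = (LINT x:{a..b}|lebesgue. f x * G x + F x * g x)"
proof -
  let ?M = "lebesgue_on {a..b}"
  interpret M: finite_measure ?M by (rule finite_measure_lebesgue_on) auto
  interpret MM: pair_sigma_finite ?M ?M ..
  have fM: "integrable ?M f" and gM: "integrable ?M g"
    using f g by (simp_all add: set_integrable_def integrable_restrict_space)
  note [measurable] = borel_measurable_integrable[OF fM] borel_measurable_integrable[OF gM]
  have id [measurable]: "(\<lambda>x. x) \<in> borel_measurable ?M"
    by (intro measurable_restrict_space1 measurable_completion) simp
  (* The integrand over the lower triangle; its iterated integrals in the two orders are compared. *)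
  define h where "h s t = (if t \<le> s then f s * g t else 0)" for s t :: real
  have [measurable]: "case_prod h \<in> borel_measurable (?M \<Otimes>\<^sub>M ?M)"
    unfolding h_def by measurable
  have h_int: "integrable (?M \<Otimes>\<^sub>M ?M) (case_prod h)"
  proof (rule Bochner_Integration.integrable_bound)
    show "integrable (?M \<Otimes>\<^sub>M ?M) (\<lambda>(s, t). f s * g t)"
      using fM gM by (intro MM.Fubini_integrable) (auto simp: norm_mult)
  qed (auto simp: h_def)
  have ind: "integral\<^sup>L ?M (\<lambda>t. if P t then k t else 0) = (LINT t:{t \<in> {a..b}. P t}|lebesgue. k t)"
    for P and k :: "real \<Rightarrow> complex"
    unfolding set_lebesgue_integral_def
    by (subst integral_restrict_space) (auto intro!: Bochner_Integration.integral_cong simp: indicator_def)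
  have F0: "integral\<^sup>L ?M (\<lambda>t. h s t) = f s * (G s - G a)" if s: "s \<in> {a..b}" for s
  proof -
    have "(\<lambda>t. h s t) = (\<lambda>t. f s * (if t \<le> s then g t else 0))" by (auto simp: h_def)
    then have "integral\<^sup>L ?M (\<lambda>t. h s t) = f s * integral\<^sup>L ?M (\<lambda>t. if t \<le> s then g t else 0)"
      by (simp only: Bochner_Integration.integral_mult_right_zero)
    also have "integral\<^sup>L ?M (\<lambda>t. if t \<le> s then g t else 0) = (LINT t:{a..s}|lebesgue. g t)"
      unfolding ind by (rule arg_cong[where f = "\<lambda>A. LINT t:A|lebesgue. g t"]) (use s in auto)
    finally show ?thesis using G[OF s] by simp
  qed
  have G0: "integral\<^sup>L ?M (\<lambda>s. h s t) = (F b - F t) * g t" if t: "t \<in> {a..b}" for t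
  proof -
    have "(\<lambda>s. h s t) = (\<lambda>s. (if t \<le> s then f s else 0) * g t)" by (auto simp: h_def)
    then have "integral\<^sup>L ?M (\<lambda>s. h s t) = integral\<^sup>L ?M (\<lambda>s. if t \<le> s then f s else 0) * g t"
      by (simp only: Bochner_Integration.integral_mult_left_zero)
    also have "integral\<^sup>L ?M (\<lambda>s. if t \<le> s then f s else 0) = (LINT s:{t..b}|lebesgue. f s)"
      unfolding ind by (rule arg_cong[where f = "\<lambda>A. LINT t:A|lebesgue. f t"]) (use t in auto)
    also have "\<dots> = F b - F t"
      using F[OF t] F[of b] set_integral_combine[OF f, of t] ab t by simp
    finally show ?thesis .
  qed
  have I1: "integrable ?M (\<lambda>s. f s * (G s - G a))"
    using MM.integrable_fst[OF h_int] by (rule Bochner_Integration.integrable_cong[THEN iffD1, rotated -1]) (auto simp: F0)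
  have I2: "integrable ?M (\<lambda>t. (F b - F t) * g t)"
    using MM.integrable_snd[OF h_int] by (rule Bochner_Integration.integrable_cong[THEN iffD1, rotated -1]) (auto simp: G0)
  have E: "integral\<^sup>L ?M (\<lambda>s. f s * (G s - G a)) = integral\<^sup>L ?M (\<lambda>t. (F b - F t) * g t)"
  proof -
    have "integral\<^sup>L ?M (\<lambda>s. f s * (G s - G a)) = integral\<^sup>L ?M (\<lambda>s. integral\<^sup>L ?M (\<lambda>t. h s t))"
      by (intro Bochner_Integration.integral_cong) (auto simp: F0)
    also have "\<dots> = integral\<^sup>L ?M (\<lambda>t. integral\<^sup>L ?M (\<lambda>s. h s t))"
      using MM.Fubini_integral[OF h_int] by simp
    also have "\<dots> = integral\<^sup>L ?M (\<lambda>t. (F b - F t) * g t)"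
      by (intro Bochner_Integration.integral_cong) (auto simp: G0)
    finally show ?thesis .
  qed
  have eq: "f x * G x + F x * g x = f x * (G x - G a) - (F b - F x) * g x + (f x * G a + F b * g x)" for x
    by (simp add: algebra_simps)
  have int: "integrable ?M (\<lambda>x. f x * G x + F x * g x)"
    unfolding eq by (intro Bochner_Integration.integrable_add Bochner_Integration.integrable_diff I1 I2)
      (use fM gM in auto)
  then show "set_integrable lebesgue {a..b} (\<lambda>x. f x * G x + F x * g x)"
    by (simp add: set_integrable_def integrable_restrict_space)
  have "integral\<^sup>L ?M (\<lambda>x. f x * G x + F x * g x) = integral\<^sup>L ?M f * G a + F b * integral\<^sup>L ?M g"
    unfolding eq using I1 I2 fM gM E by simp
  also have "integral\<^sup>L ?M f = F b - F a"
    using F[of b] ab by (simp add: set_lebesgue_integral_def integral_restrict_space)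
  also have "integral\<^sup>L ?M g = G b - G a"
    using G[of b] ab by (simp add: set_lebesgue_integral_def integral_restrict_space)
  finally show "F b * G b - F a * G a = (LINT x:{a..b}|lebesgue. f x * G x + F x * g x)"
    by (simp add: set_lebesgue_integral_def integral_restrict_space algebra_simps)
qed

lemma indefinite_integral_continuous_on:
  fixes g :: "real \<Rightarrow> complex"
  assumes "set_integrable lebesgue {a..b} g"
  shows "continuous_on {a..b} (\<lambda>x. LINT t:{a..x}|lebesgue. g t)"
proof -
  have "g absolutely_integrable_on {a..b}" using assms by simp
  then have "g integrable_on {a..b}" using set_lebesgue_integral_eq_integral(1) by blast
  then have "continuous_on {a..b} (\<lambda>x. integral {a..x} g)"
    by (rule indefinite_integral_continuous_1)
  then show ?thesis
  proof (rule continuous_on_eq)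
    fix x assume "x \<in> {a..b}"
    then have "set_integrable lebesgue {a..x} g"
      using assms by (intro set_integrable_subset_lebesgue[OF assms]) auto
    then show "integral {a..x} g = (LINT t:{a..x}|lebesgue. g t)"
      by (simp add: set_lebesgue_integral_eq_integral(2))
  qed
qed

lemma continuous_set_integrable:
  fixes f :: "real \<Rightarrow> 'a::euclidean_space"
  assumes "continuous_on {a..b} f" shows "set_integrable lebesgue {a..b} f"
  using absolutely_integrable_continuous_real[OF assms] .

lemma FTC_lebesgue:
  fixes f f' :: "real \<Rightarrow> real"
  assumes "a \<le> b" "\<And>x. (f has_real_derivative f' x) (at x)" "continuous_on UNIV f'"
  shows "(LINT x:{a..b}|lebesgue. f' x) = f b - f a"
proof -
  have "(f' has_integral (f b - f a)) {a..b}"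
    using assms by (intro fundamental_theorem_of_calculus)
      (auto simp: has_real_derivative_iff_has_vector_derivative[symmetric] intro: has_field_derivative_at_within)
  moreover have "set_integrable lebesgue {a..b} f'"
    using assms(3) continuous_on_subset by (intro continuous_set_integrable) blast
  ultimately show ?thesis by (simp add: set_lebesgue_integral_eq_integral(2) integral_unique)
qed

lemma of_real_indefinite_integral:
  fixes f f' :: "real \<Rightarrow> real"
  assumes "a \<le> b" "\<And>x. (f has_real_derivative f' x) (at x)" "continuous_on UNIV f'"
  shows "complex_of_real (f b) = of_real (f a) + (LINT x:{a..b}|lebesgue. of_real (f' x))"
  using FTC_lebesgue[OF assms] by (simp add: set_integral_complex_of_real)

lemma sigma_finite_lebesgue: "sigma_finite_measure (lebesgue :: 'a::euclidean_space measure)"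
proof
  obtain A :: "'a set set" where "countable A" "A \<subseteq> sets lborel" "\<Union>A = space lborel"
      "\<forall>a\<in>A. emeasure lborel a \<noteq> \<infinity>"
    using lborel.sigma_finite_countable by blast
  then show "\<exists>A. countable A \<and> A \<subseteq> sets lebesgue \<and> \<Union>A = space (lebesgue :: 'a measure)
      \<and> (\<forall>a\<in>A. emeasure lebesgue a \<noteq> \<infinity>)"
    by (intro exI[of _ A]) auto
qed

text \<open>
  The sets over which the function has integral \<open>0\<close> form a Dynkin system that contains all
  half-lines, hence all Borel sets; null sets add nothing.
\<close>

lemma AE_zero_of_indefinite_integral_zero:
  fixes g :: "real \<Rightarrow> complex"
  assumes int: "set_integrable lebesgue {a..b} g"
    and zero: "\<And>x. x \<in> {a..b} \<Longrightarrow> (LINT t:{a..x}|lebesgue. g t) = 0"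
  shows "AE x in lebesgue. x \<in> {a..b} \<longrightarrow> g x = 0"
proof -
  define k where "k = (\<lambda>x. indicator {a..b} x *\<^sub>R g x)"
  have k: "integrable lebesgue k" using int by (simp add: set_integrable_def k_def)
  have set_int: "set_integrable lebesgue A k" if "A \<in> sets lebesgue" for A
    using k that integrable_mult_indicator unfolding set_integrable_def by blast
  have all: "(LINT t|lebesgue. k t) = 0"
  proof (cases "a \<le> b")
    case True
    then show ?thesis using zero[of b] by (simp add: set_lebesgue_integral_def k_def)
  qed (simp add: k_def)
  have ray: "(LINT t:{..x}|lebesgue. k t) = 0" for x
  proof -
    have *: "indicator {..x} t *\<^sub>R k t = indicator {a..min x b} t *\<^sub>R g t" for t
      by (auto simp: k_def indicator_def)
    have "(LINT t:{a..min x b}|lebesgue. g t) = 0"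
    proof (cases "a \<le> min x b")
      case True
      then show ?thesis by (intro zero) auto
    qed (simp add: set_lebesgue_integral_def)
    then show ?thesis unfolding set_lebesgue_integral_def * .
  qed
  have borel: "(LINT t:A|lebesgue. k t) = 0" if "A \<in> sets borel" for A :: "real set"
  proof -
    have st: "Int_stable (range (atMost :: real \<Rightarrow> _))" by (auto simp: Int_stable_def)
    have pow: "range atMost \<subseteq> Pow (UNIV :: real set)" by simp
    have "A \<in> sigma_sets UNIV (range atMost)" using that by (simp add: borel_eq_atMost)
    from st pow this show ?thesis
    proof (induction rule: sigma_sets_induct_disjoint)
      fix A :: "real set" assume "A \<in> range atMost"
      then show "(LINT t:A|lebesgue. k t) = 0" using ray by auto
    next
      fix A :: "real set" assume A: "A \<in> sigma_sets UNIV (range atMost)" and 0: "(LINT t:A|lebesgue. k t) = 0"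
      have Am: "A \<in> sets lebesgue" using A by (simp add: borel_eq_atMost)
      have "(LINT t:A \<union> (UNIV - A)|lebesgue. k t) = (LINT t:A|lebesgue. k t) + (LINT t:UNIV - A|lebesgue. k t)"
        using Am by (intro set_integral_Un set_int) auto
      then show "(LINT t:UNIV - A|lebesgue. k t) = 0" using 0 all by (simp add: set_lebesgue_integral_def)
    next
      fix A :: "nat \<Rightarrow> real set"
      assume A: "disjoint_family A" "range A \<subseteq> sigma_sets UNIV (range atMost)"
        and 0: "\<And>i. (LINT t:A i|lebesgue. k t) = 0"
      have Am: "A i \<in> sets lebesgue" for i
      proof -
        have "A i \<in> sigma_sets UNIV (range atMost)" using A(2) by blast
        then have "A i \<in> sets borel" by (simp add: borel_eq_atMost)
        then show ?thesis by simp
      qed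
      have "(LINT t:(\<Union>i. A i)|lebesgue. k t) = (\<Sum>i. LINT t:A i|lebesgue. k t)"
        using A Am by (intro lebesgue_integral_countable_add set_int)
          (auto simp: disjoint_family_on_def)
      then show "(LINT t:(\<Union>i. A i)|lebesgue. k t) = 0" using 0 by simp
    qed (simp add: set_lebesgue_integral_def)
  qed
  have "AE x in lebesgue. k x = 0"
  proof (rule sigma_finite_measure.density_zero[OF sigma_finite_lebesgue k])
    fix A :: "real set" assume A: "A \<in> sets lebesgue"
    have "(LINT t:A|lebesgue. k t) = (LINT t:main_part lborel A|lebesgue. k t)"
    proof (rule set_integral_cong_set)
      have "AE x in lebesgue. x \<notin> null_part lborel A"
        using A null_part_null_sets[of A lborel] by (intro AE_not_in) auto
      then show "AE x in lebesgue. (x \<in> main_part lborel A) = (x \<in> A)"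
        by eventually_elim (use main_part_null_part_Un[OF A] in auto)
      show "set_borel_measurable lebesgue A k" "set_borel_measurable lebesgue (main_part lborel A) k"
        using set_int[of A] set_int[of "main_part lborel A"] A main_part_sets[OF A]
        by (auto simp: set_integrable_def set_borel_measurable_def)
    qed
    also have "\<dots> = 0" using main_part_sets[OF A] by (intro borel) auto
    finally show "(LINT t:A|lebesgue. k t) = 0" .
  qed
  then show ?thesis by eventually_elim (auto simp: k_def)
qed

lemma test_function_derivative_support:
  assumes "\<And>x. (\<phi> has_real_derivative \<phi>' x) (at x)" "closed K" "\<And>x. x \<notin> K \<Longrightarrow> \<phi> x = 0" "x \<notin> K"
  shows "\<phi>' x = (0::real)"
proof -
  have "((\<lambda>x. 0) has_real_derivative \<phi>' x) (at x)"
    by (rule has_field_derivative_transform_within_open[OF assms(1), of "- K"]) (use assms in auto)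
  then show ?thesis by (metis DERIV_const DERIV_unique)
qed

text \<open>
  An indefinite integral is weakly differentiable: integrate by parts against the test function.
\<close>

lemma has_weak_derivI:
  fixes u g :: "real \<Rightarrow> complex"
  assumes I: "I \<subseteq> {0..}" "\<And>x y. x \<in> I \<Longrightarrow> 0 \<le> y \<Longrightarrow> y \<le> x \<Longrightarrow> y \<in> I"
    and g: "\<And>x. x \<in> I \<Longrightarrow> set_integrable lebesgue {0..x} g"
    and u: "\<And>x. x \<in> I \<Longrightarrow> u x = u 0 + (LINT t:{0..x}|lebesgue. g t)"
  shows "has_weak_deriv I u g"
proof -
  have comp: "\<exists>\<beta>\<in>I. K \<subseteq> {0..\<beta>}" if K: "compact K" "K \<subseteq> interior I" "K \<noteq> {}" for K
  proof -
    obtain \<beta> where \<beta>: "\<beta> \<in> K" "\<And>x. x \<in> K \<Longrightarrow> x \<le> \<beta>" using compact_attains_sup[OF K(1,3)] by blast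
    moreover have "K \<subseteq> I" using K(2) interior_subset by blast
    ultimately show ?thesis using I(1) by (intro bexI[of _ \<beta>]) auto
  qed
  have cont: "continuous_on {0..x} u" if "x \<in> I" for x
  proof -
    have "continuous_on {0..x} (\<lambda>y. u 0 + (LINT t:{0..y}|lebesgue. g t))"
      by (intro continuous_intros indefinite_integral_continuous_on g that)
    then show ?thesis
    proof (rule continuous_on_eq)
      fix y assume "y \<in> {0..x}"
      then have "y \<in> I" using I(2)[OF that] by auto
      then show "u 0 + (LINT t:{0..y}|lebesgue. g t) = u y" by (rule u[symmetric])
    qed
  qed
  have loc: "locally_integrable I f" if f: "\<And>x. x \<in> I \<Longrightarrow> set_integrable lebesgue {0..x} f" for f
    unfolding locally_integrable_def
  proof (intro allI impI)
    fix K assume K: "compact K \<and> K \<subseteq> interior I"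
    show "set_integrable lebesgue K f"
    proof (cases "K = {}")
      case False
      then obtain \<beta> where "\<beta> \<in> I" "K \<subseteq> {0..\<beta>}" using comp K by blast
      then show ?thesis using K compact_imp_closed[of K]
        by (intro set_integrable_subset[OF f]) auto
    qed simp
  qed
  show ?thesis
    unfolding has_weak_deriv_def
  proof (intro conjI allI impI)
    show "locally_integrable I u" by (intro loc continuous_set_integrable cont)
    show "locally_integrable I g" by (intro loc g)
    fix \<phi> \<phi>' assume "test_function I \<phi> \<phi>'"
    then obtain K where d: "\<And>x. (\<phi> has_real_derivative \<phi>' x) (at x)" and c: "continuous_on UNIV \<phi>'"
      and K: "compact K" "K \<subseteq> interior I" "\<And>x. x \<notin> K \<Longrightarrow> \<phi> x = 0"
      unfolding test_function_def by blast
    have \<phi>'0: "\<phi>' x = 0" if "x \<notin> K" for x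
      using test_function_derivative_support[OF d compact_imp_closed[OF K(1)] K(3) that] .
    show "(LINT x:I|lebesgue. \<phi>' x *\<^sub>R u x) = - (LINT x:I|lebesgue. \<phi> x *\<^sub>R g x)"
    proof (cases "K = {}")
      case True
      then show ?thesis using K(3) \<phi>'0 by (simp add: set_lebesgue_integral_def)
    next
      case False
      then obtain \<beta> where \<beta>: "\<beta> \<in> K" "\<And>x. x \<in> K \<Longrightarrow> x \<le> \<beta>" using compact_attains_sup[OF K(1)] by blast
      have "\<beta> \<in> interior I" using \<beta>(1) K(2) by blast
      then obtain e where e: "e > 0" "ball \<beta> e \<subseteq> I" unfolding mem_interior by blast
      (* An end point of the interval to the right of the support, so that the boundary terms vanish;
         on the left 0 serves, because it is not an interior point of I. *)
      define B where "B = \<beta> + e / 2"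
      have "\<bar>\<beta> - B\<bar> < e" using e(1) by (simp add: B_def)
      then have BI: "B \<in> I" using e(2) by (auto simp: dist_real_def)
      have BK: "B \<notin> K" using \<beta>(2)[of B] e(1) by (auto simp: B_def)
      have KB: "x \<in> {0..B} \<and> x \<in> I" if "x \<in> K" for x
        using \<beta>(2)[OF that] e(1) K(2) interior_subset[of I] I(1) that by (auto simp: B_def)
      have K0: "0 \<notin> K"
      proof
        assume "0 \<in> K"
        then have "0 \<in> interior I" using K(2) by blast
        then obtain d where d: "d > 0" "ball 0 d \<subseteq> I" unfolding mem_interior by blast
        then have "- (d / 2) \<in> ball 0 d" by (simp add: dist_real_def)
        then have "- (d / 2) \<in> I" using d by blast
        then show False using I(1) \<open>d > 0\<close> by force
      qed
      have red: "(LINT x:I|lebesgue. k x) = (LINT x:{0..B}|lebesgue. k x)"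
        if "\<And>x. x \<notin> K \<Longrightarrow> k x = 0" for k :: "real \<Rightarrow> complex"
        unfolding set_lebesgue_integral_def
      proof (rule Bochner_Integration.integral_cong)
        fix x show "indicat_real I x *\<^sub>R k x = indicat_real {0..B} x *\<^sub>R k x"
          using KB[of x] that[of x] by (cases "x \<in> K") auto
      qed simp
      have B0: "0 \<le> B" using BI I(1) by auto
      have int\<phi>: "set_integrable lebesgue {0..B} (\<lambda>x. complex_of_real (\<phi>' x))"
        using c by (intro continuous_set_integrable continuous_intros) (auto intro: continuous_on_subset)
      have F: "complex_of_real (\<phi> x) = of_real (\<phi> 0) + (LINT t:{0..x}|lebesgue. of_real (\<phi>' t))"
        if "x \<in> {0..B}" for x
        using that by (intro of_real_indefinite_integral d c) auto
      have G: "u x = u 0 + (LINT t:{0..x}|lebesgue. g t)" if "x \<in> {0..B}" for x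
        using that I(2)[OF BI] by (intro u) auto
      note P = indefinite_integral_product(1)[OF B0 int\<phi> g[OF BI] F G]
        and E = indefinite_integral_product(2)[OF B0 int\<phi> g[OF BI] F G]
      have P1: "set_integrable lebesgue {0..B} (\<lambda>x. complex_of_real (\<phi>' x) * u x)"
        using c by (intro continuous_set_integrable continuous_intros cont BI) (auto intro: continuous_on_subset)
      have P2: "set_integrable lebesgue {0..B} (\<lambda>x. complex_of_real (\<phi> x) * g x)"
        using set_integral_diff(1)[OF P P1] by simp
      have "(LINT x:{0..B}|lebesgue. complex_of_real (\<phi>' x) * u x) + (LINT x:{0..B}|lebesgue. complex_of_real (\<phi> x) * g x) = 0"
        using E K(3)[OF BK] K(3)[OF K0] set_integral_add(2)[OF P1 P2] by simp
      moreover have "(LINT x:I|lebesgue. \<phi>' x *\<^sub>R u x) = (LINT x:{0..B}|lebesgue. complex_of_real (\<phi>' x) * u x)"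
        by (subst red) (auto simp: \<phi>'0 scaleR_conv_of_real)
      moreover have "(LINT x:I|lebesgue. \<phi> x *\<^sub>R g x) = (LINT x:{0..B}|lebesgue. complex_of_real (\<phi> x) * g x)"
        by (subst red) (auto simp: K(3) scaleR_conv_of_real)
      ultimately show ?thesis by (simp add: add_eq_0_iff)
    qed
  qed
qed

text \<open>
  The lemma of du Bois-Reymond. For a weight \<open>\<eta>\<close> that is positive exactly inside the interval, let \<open>m\<close>
  be the weighted mean of \<open>h\<close>. Then \<open>\<psi> = \<eta> * (h - m)\<close> has integral \<open>0\<close>, so it is the derivative of an admissible
  function, and orthogonality to \<open>\<psi>\<close> says that \<open>\<eta> * (h - m)\<^sup>2\<close> has integral \<open>0\<close>.
\<close>

lemma constant_of_orthogonal_to_derivatives: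
  fixes h :: "real \<Rightarrow> real"
  assumes cd: "c < d" and h: "continuous_on {c..d} h"
    and orth: "\<And>\<phi> \<phi>'. \<lbrakk>\<And>x. (\<phi> has_real_derivative \<phi>' x) (at x); continuous_on UNIV \<phi>';
        \<And>x. x \<notin> {c<..<d} \<Longrightarrow> \<phi> x = 0\<rbrakk> \<Longrightarrow> integral {c..d} (\<lambda>x. \<phi>' x * h x) = 0"
    and x: "x \<in> {c..d}"
  shows "h x = h c"
proof -
  define \<eta> where "\<eta> x = max 0 ((x - c) * (d - x))" for x :: real
  have \<eta>c: "continuous_on UNIV \<eta>" unfolding \<eta>_def by (intro continuous_intros)
  have \<eta>0: "\<eta> x = 0" if "x \<notin> {c<..<d}" for x
    using that cd by (auto simp: \<eta>_def mult_le_0_iff)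
  have \<eta>pos: "\<eta> x > 0" if "x \<in> {c<..<d}" for x using that by (auto simp: \<eta>_def)
  have \<eta>nn: "\<eta> x \<ge> 0" for x by (simp add: \<eta>_def)
  (* A continuous extension of h to the line, so that the test function is differentiable everywhere. *)
  define H where "H x = h (max c (min d x))" for x
  have Hc: "continuous_on UNIV H" unfolding H_def
    by (rule continuous_on_compose2[OF h]) (use cd in \<open>auto intro!: continuous_intros\<close>)
  have Hh: "H x = h x" if "x \<in> {c..d}" for x using that by (simp add: H_def)
  have int: "k integrable_on {c..d}" if "continuous_on UNIV k" for k :: "real \<Rightarrow> real"
    using that by (intro integrable_continuous_interval continuous_on_subset[OF that]) auto
  have zero: "k y = 0" if k: "continuous_on UNIV k" "\<And>x. 0 \<le> k x" "integral {c..d} k = 0" and y: "y \<in> {c..d}"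
    for k :: "real \<Rightarrow> real" and y
    using integral_eq_0_iff[of c d k] k y cd continuous_on_subset[OF k(1)] by auto
  define Z where "Z = integral {c..d} \<eta>"
  have Zpos: "Z > 0"
  proof -
    have "Z \<ge> 0" unfolding Z_def by (intro integral_nonneg int \<eta>c) (auto simp: \<eta>nn)
    moreover have "Z \<noteq> 0"
      using zero[OF \<eta>c \<eta>nn, of "(c + d) / 2"] \<eta>pos[of "(c + d) / 2"] cd by (auto simp: Z_def)
    ultimately show ?thesis by simp
  qed
  define m where "m = integral {c..d} (\<lambda>x. \<eta> x * H x) / Z"
  define \<psi> where "\<psi> = (\<lambda>x. \<eta> x * (H x - m))"
  have \<psi>c: "continuous_on UNIV \<psi>" unfolding \<psi>_def by (intro continuous_intros \<eta>c Hc)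
  have \<psi>0: "\<psi> x = 0" if "x \<notin> {c<..<d}" for x using \<eta>0[OF that] by (simp add: \<psi>_def)
  have \<psi>int: "integral {c..d} \<psi> = 0"
  proof -
    have "integral {c..d} \<psi> = integral {c..d} (\<lambda>x. \<eta> x * H x - m * \<eta> x)"
      by (simp add: \<psi>_def algebra_simps)
    also have "\<dots> = integral {c..d} (\<lambda>x. \<eta> x * H x) - m * Z"
      unfolding Z_def by (subst integral_diff) (auto intro!: int continuous_intros \<eta>c Hc)
    finally show ?thesis using Zpos by (simp add: m_def)
  qed
  have "\<exists>\<Phi>. \<forall>x. (\<Phi> has_real_derivative \<psi> x) (at x)"
  proof -
    have "\<exists>F. \<forall>x::real. (-\<infinity>::ereal) < x \<longrightarrow> x < (\<infinity>::ereal) \<longrightarrow> (F has_vector_derivative \<psi> x) (at x)"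
      using \<psi>c by (intro einterval_antiderivative) (auto simp: continuous_on_eq_continuous_at)
    then show ?thesis by (auto simp: has_real_derivative_iff_has_vector_derivative)
  qed
  then obtain \<Phi> where \<Phi>: "\<And>x. (\<Phi> has_real_derivative \<psi> x) (at x)" by blast
  have const: "\<Phi> x = \<Phi> y" if "convex T" "x \<in> T" "y \<in> T" "\<And>z. z \<in> T \<Longrightarrow> z \<notin> {c<..<d}" for T x y
  proof -
    have "(\<Phi> has_real_derivative 0) (at z within T)" if "z \<in> T" for z
      using \<Phi>[of z] \<psi>0 \<open>\<And>z. z \<in> T \<Longrightarrow> z \<notin> {c<..<d}\<close>[OF that] by (metis has_field_derivative_at_within)
    then show ?thesis using has_field_derivative_zero_constant[OF that(1)] that(2,3) by metis
  qed
  have left: "\<Phi> x = \<Phi> c" if "x \<le> c" for x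
    using that by (intro const[of "{..c}"]) auto
  have "(\<psi> has_integral (\<Phi> d - \<Phi> c)) {c..d}"
    using cd \<Phi> by (intro fundamental_theorem_of_calculus)
      (auto simp: has_real_derivative_iff_has_vector_derivative[symmetric] intro: has_field_derivative_at_within)
  then have "\<Phi> d = \<Phi> c" using \<psi>int by (simp add: integral_unique)
  then have right: "\<Phi> x = \<Phi> c" if "d \<le> x" for x
    using that const[of "{d..}" x d] by auto
  have "integral {c..d} (\<lambda>x. \<psi> x * h x) = 0"
  proof (rule orth[where \<phi> = "\<lambda>x. \<Phi> x - \<Phi> c"])
    show "((\<lambda>x. \<Phi> x - \<Phi> c) has_real_derivative \<psi> x) (at x)" for x
      using DERIV_diff[OF \<Phi> DERIV_const] by simp
    show "\<Phi> x - \<Phi> c = 0" if "x \<notin> {c<..<d}" for x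
    proof (cases "x \<le> c")
      case True
      then show ?thesis using left[of x] by simp
    next
      case False
      then show ?thesis using right[of x] that by simp
    qed
  qed (rule \<psi>c)
  moreover have "integral {c..d} (\<lambda>x. \<psi> x * h x) = integral {c..d} (\<lambda>x. \<psi> x * H x)"
    by (intro integral_cong) (simp add: Hh)
  ultimately have "integral {c..d} (\<lambda>x. \<psi> x * H x - m * \<psi> x) = 0"
    using \<psi>int by (subst integral_diff) (auto intro!: int continuous_intros \<psi>c Hc)
  moreover have "(\<lambda>x. \<psi> x * H x - m * \<psi> x) = (\<lambda>x. \<eta> x * (H x - m)\<^sup>2)"
    by (simp add: \<psi>_def fun_eq_iff power2_eq_square algebra_simps)
  ultimately have "integral {c..d} (\<lambda>x. \<eta> x * (H x - m)\<^sup>2) = 0" by simp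
  then have sq: "\<eta> y * (H y - m)\<^sup>2 = 0" if "y \<in> {c..d}" for y
    using that by (intro zero[where k = "\<lambda>x. \<eta> x * (H x - m)\<^sup>2"])
      (auto intro!: continuous_intros \<eta>c Hc simp: \<eta>nn)
  have inner: "h y = m" if "y \<in> {c<..<d}" for y
    using that \<eta>pos[OF that] Hh[of y] sq[of y] by simp
  have "h y = m" if "y \<in> {c..d}" for y
    by (rule continuous_constant_on_closure[of "{c<..<d}"]) (use h cd that inner in auto)
  from this[of x] this[of c] show ?thesis using x cd by simp
qed

text \<open>
  A continuous function minus the integral of its weak derivative is orthogonal to all derivatives
  of test functions, hence constant.
\<close>

lemma has_weak_derivD:
  fixes u g :: "real \<Rightarrow> complex"
  assumes w: "has_weak_deriv I u g" and sub: "{c..d} \<subseteq> interior I" and u: "continuous_on {c..d} u"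
    and x: "x \<in> {c..d}"
  shows "u x = u c + (LINT t:{c..x}|lebesgue. g t)"
proof (cases "c < d")
  case False
  then have "x = c" using x by simp
  moreover have "(LINT t:{c..c}|lebesgue. g t) = 0" by (rule set_integral_point)
  ultimately show ?thesis by simp
next
  case cd: True
  have g: "set_integrable lebesgue {c..d} g"
  proof -
    have "locally_integrable I g" using w unfolding has_weak_deriv_def by blast
    then show ?thesis using sub unfolding locally_integrable_def by (metis compact_Icc)
  qed
  define h where "h x = u x - (LINT t:{c..x}|lebesgue. g t)" for x
  have hc: "continuous_on {c..d} h" unfolding h_def
    by (intro continuous_intros u indefinite_integral_continuous_on g)
  have orth: "(LINT x:{c..d}|lebesgue. complex_of_real (\<phi>' x) * h x) = 0"
    if d: "\<And>x. (\<phi> has_real_derivative \<phi>' x) (at x)" and c: "continuous_on UNIV \<phi>'"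
      and supp: "\<And>x. x \<notin> {c<..<d} \<Longrightarrow> \<phi> x = 0" for \<phi> \<phi>' :: "real \<Rightarrow> real"
  proof -
    have supp': "\<phi> x = 0" if "x \<notin> {c..d}" for x using that supp by auto
    have \<phi>'0: "\<phi>' x = 0" if "x \<notin> {c..d}" for x
      using test_function_derivative_support[OF d closed_atLeastAtMost supp' that] .
    have sI: "{c..d} \<subseteq> I" using sub interior_subset by blast
    have red: "(LINT x:I|lebesgue. k x) = (LINT x:{c..d}|lebesgue. k x)"
      if "\<And>x. x \<notin> {c..d} \<Longrightarrow> k x = 0" for k :: "real \<Rightarrow> complex"
      unfolding set_lebesgue_integral_def
    proof (rule Bochner_Integration.integral_cong)
      fix x show "indicat_real I x *\<^sub>R k x = indicat_real {c..d} x *\<^sub>R k x"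
        using sI that[of x] by (cases "x \<in> {c..d}") auto
    qed simp
    have "test_function I \<phi> \<phi>'"
      unfolding test_function_def using d c supp' sub by (intro conjI exI[of _ "{c..d}"]) auto
    then have "(LINT x:I|lebesgue. \<phi>' x *\<^sub>R u x) = - (LINT x:I|lebesgue. \<phi> x *\<^sub>R g x)"
      using w by (auto simp: has_weak_deriv_def)
    then have W: "(LINT x:{c..d}|lebesgue. complex_of_real (\<phi>' x) * u x) = - (LINT x:{c..d}|lebesgue. complex_of_real (\<phi> x) * g x)"
      by (subst (asm) (1 2) red) (auto simp: \<phi>'0 supp' scaleR_conv_of_real)
    have \<phi>'c: "continuous_on {c..d} (\<lambda>x. complex_of_real (\<phi>' x))"
      using c by (intro continuous_intros) (auto intro: continuous_on_subset)
    define G where "G x = (LINT t:{c..x}|lebesgue. g t)" for x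
    have Gc: "continuous_on {c..d} G" unfolding G_def by (intro indefinite_integral_continuous_on g)
    have G0: "G c = 0" unfolding G_def by (rule set_integral_point)
    have int\<phi>: "set_integrable lebesgue {c..d} (\<lambda>x. complex_of_real (\<phi>' x))"
      by (intro continuous_set_integrable \<phi>'c)
    have F: "complex_of_real (\<phi> x) = of_real (\<phi> c) + (LINT t:{c..x}|lebesgue. of_real (\<phi>' t))"
      if "x \<in> {c..d}" for x
      using that by (intro of_real_indefinite_integral d c) auto
    have GG: "G x = G c + (LINT t:{c..x}|lebesgue. g t)" for x
      unfolding G0 by (simp add: G_def)
    note P = indefinite_integral_product(1)[OF less_imp_le[OF cd] int\<phi> g F GG]
      and E = indefinite_integral_product(2)[OF less_imp_le[OF cd] int\<phi> g F GG]
    have P1: "set_integrable lebesgue {c..d} (\<lambda>x. complex_of_real (\<phi>' x) * G x)"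
      by (intro continuous_set_integrable continuous_intros \<phi>'c Gc)
    have P2: "set_integrable lebesgue {c..d} (\<lambda>x. complex_of_real (\<phi> x) * g x)"
      using set_integral_diff(1)[OF P P1] by simp
    have P3: "set_integrable lebesgue {c..d} (\<lambda>x. complex_of_real (\<phi>' x) * u x)"
      by (intro continuous_set_integrable continuous_intros \<phi>'c u)
    have "(LINT x:{c..d}|lebesgue. complex_of_real (\<phi>' x) * G x) + (LINT x:{c..d}|lebesgue. complex_of_real (\<phi> x) * g x) = 0"
      using E supp[of c] supp[of d] set_integral_add(2)[OF P1 P2] by simp
    moreover have "(LINT x:{c..d}|lebesgue. complex_of_real (\<phi>' x) * h x)
       = (LINT x:{c..d}|lebesgue. complex_of_real (\<phi>' x) * u x) - (LINT x:{c..d}|lebesgue. complex_of_real (\<phi>' x) * G x)"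
      using set_integral_diff(2)[OF P3 P1] by (simp add: h_def G_def algebra_simps)
    ultimately show ?thesis using W by (simp add: add_eq_0_iff)
  qed
  have part: "integral {c..d} (\<lambda>x. \<phi>' x * l (h x)) = 0"
    if l: "bounded_linear l" and d: "\<And>x. (\<phi> has_real_derivative \<phi>' x) (at x)" and c: "continuous_on UNIV \<phi>'"
      and supp: "\<And>x. x \<notin> {c<..<d} \<Longrightarrow> \<phi> x = 0" for \<phi> \<phi>' :: "real \<Rightarrow> real" and l :: "complex \<Rightarrow> real"
  proof -
    have cont: "continuous_on {c..d} (\<lambda>x. complex_of_real (\<phi>' x) * h x)"
      using c by (intro continuous_intros hc) (auto intro: continuous_on_subset)
    have "integral {c..d} (\<lambda>x. complex_of_real (\<phi>' x) * h x) = 0"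
      using orth[OF d c supp] set_lebesgue_integral_eq_integral(2)[OF continuous_set_integrable[OF cont]] by simp
    then have "integral {c..d} (\<lambda>x. l (complex_of_real (\<phi>' x) * h x)) = l 0"
      using integral_linear[OF integrable_continuous_interval[OF cont] l] by (simp add: comp_def)
    moreover have "l (complex_of_real (\<phi>' x) * h x) = \<phi>' x * l (h x)" for x
      using linear_simps(5)[OF l, of "\<phi>' x" "h x"] by (simp add: scaleR_conv_of_real)
    ultimately show ?thesis using linear_simps(3)[OF l] by simp
  qed
  have "Re (h x) = Re (h c)" "Im (h x) = Im (h c)"
    using part[OF bounded_linear_Re] part[OF bounded_linear_Im]
    by (intro constant_of_orthogonal_to_derivatives[OF cd _ _ x] continuous_intros hc; blast)+
  then have "h x = h c" by (simp add: complex_eq_iff)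
  moreover have "(LINT t:{c..c}|lebesgue. g t) = 0" by (rule set_integral_point)
  ultimately show ?thesis by (simp add: h_def algebra_simps)
qed


section \<open>Square-integrable functions on a graph\<close>

text \<open>
  Fatou's lemma: a Cauchy sequence in \<open>L\<^sup>2\<close> converges in norm to any almost everywhere limit of a
  subsequence.
\<close>

lemma L2_limit_of_Cauchy:
  fixes f :: "nat \<Rightarrow> 'a \<Rightarrow> complex"
  assumes f [measurable]: "\<And>n. f n \<in> borel_measurable M"
    and Cauchy: "\<And>\<epsilon>. \<epsilon> > 0 \<Longrightarrow> \<exists>N. \<forall>m\<ge>N. \<forall>n\<ge>N. integrable M (\<lambda>x. (cmod (f m x - f n x))\<^sup>2) \<and>
        (LINT x|M. (cmod (f m x - f n x))\<^sup>2) < \<epsilon>"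
    and r: "strict_mono (r :: nat \<Rightarrow> nat)"
    and lim: "AE x in M. (\<lambda>k. f (r k) x) \<longlonglongrightarrow> g x" and g [measurable]: "g \<in> borel_measurable M"
    and \<epsilon>: "\<epsilon> > 0"
  shows "\<exists>N. \<forall>n\<ge>N. integrable M (\<lambda>x. (cmod (f n x - g x))\<^sup>2) \<and> (LINT x|M. (cmod (f n x - g x))\<^sup>2) \<le> \<epsilon>"
proof -
  obtain N where N: "\<And>m n. m \<ge> N \<Longrightarrow> n \<ge> N \<Longrightarrow> integrable M (\<lambda>x. (cmod (f m x - f n x))\<^sup>2)"
     "\<And>m n. m \<ge> N \<Longrightarrow> n \<ge> N \<Longrightarrow> (LINT x|M. (cmod (f m x - f n x))\<^sup>2) < \<epsilon>"
    using Cauchy[OF \<epsilon>] by blast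
  have "integrable M (\<lambda>x. (cmod (f n x - g x))\<^sup>2) \<and> (LINT x|M. (cmod (f n x - g x))\<^sup>2) \<le> \<epsilon>" if n: "n \<ge> N" for n
  proof -
    have "(\<integral>\<^sup>+x. ennreal ((cmod (f n x - g x))\<^sup>2) \<partial>M)
       = (\<integral>\<^sup>+x. liminf (\<lambda>k. ennreal ((cmod (f n x - f (r k) x))\<^sup>2)) \<partial>M)"
    proof (rule nn_integral_cong_AE)
      show "AE x in M. ennreal ((cmod (f n x - g x))\<^sup>2) = liminf (\<lambda>k. ennreal ((cmod (f n x - f (r k) x))\<^sup>2))"
        using lim
      proof eventually_elim
        case (elim x)
        have "(\<lambda>k. ennreal ((cmod (f n x - f (r k) x))\<^sup>2)) \<longlonglongrightarrow> ennreal ((cmod (f n x - g x))\<^sup>2)"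
          by (intro tendsto_intros elim)
        then show ?case by (metis lim_imp_Liminf trivial_limit_sequentially)
      qed
    qed
    also have "\<dots> \<le> liminf (\<lambda>k. \<integral>\<^sup>+x. ennreal ((cmod (f n x - f (r k) x))\<^sup>2) \<partial>M)"
      by (rule nn_integral_liminf) measurable
    also have "\<dots> \<le> liminf (\<lambda>k. ennreal \<epsilon>)"
    proof (rule Liminf_mono)
      have "(\<integral>\<^sup>+x. ennreal ((cmod (f n x - f (r k) x))\<^sup>2) \<partial>M) \<le> ennreal \<epsilon>" if "k \<ge> N" for k
      proof -
        have "r k \<ge> N" using that seq_suble[OF r, of k] by linarith
        then have "(\<integral>\<^sup>+x. ennreal ((cmod (f n x - f (r k) x))\<^sup>2) \<partial>M) = ennreal (LINT x|M. (cmod (f n x - f (r k) x))\<^sup>2)"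
          using N(1)[OF n] by (intro nn_integral_eq_integral) auto
        also have "\<dots> \<le> ennreal \<epsilon>" using N(2)[OF n \<open>r k \<ge> N\<close>] by (intro ennreal_leI) simp
        finally show ?thesis .
      qed
      then show "\<forall>\<^sub>F k in sequentially. (\<integral>\<^sup>+x. ennreal ((cmod (f n x - f (r k) x))\<^sup>2) \<partial>M) \<le> ennreal \<epsilon>"
        by (auto simp: eventually_sequentially)
    qed
    also have "\<dots> = ennreal \<epsilon>" by (simp add: Liminf_const)
    finally have le: "(\<integral>\<^sup>+x. ennreal ((cmod (f n x - g x))\<^sup>2) \<partial>M) \<le> ennreal \<epsilon>" .
    have int: "integrable M (\<lambda>x. (cmod (f n x - g x))\<^sup>2)"
      using le by (intro integrableI_bounded) (auto simp: less_top[symmetric] top_unique elim: le_less_trans)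
    have "ennreal (LINT x|M. (cmod (f n x - g x))\<^sup>2) \<le> ennreal \<epsilon>"
      using le int by (subst nn_integral_eq_integral[symmetric]) auto
    then show ?thesis using int \<epsilon> by simp
  qed
  then show ?thesis by blast
qed

text \<open>
  Riesz-Fischer. Along a subsequence whose consecutive differences \<open>d k\<close> have integral of
  \<open>|d k|\<^sup>2\<close> at most \<open>1 / 4 ^ k\<close>, the sum of \<open>2 ^ k * |d k|\<^sup>2\<close> is integrable, hence finite almost everywhere. There
  \<open>|d k|\<close> is dominated by a geometric sequence, so the subsequence converges pointwise.
\<close>

lemma L2_Cauchy_subsequence_converges:
  fixes f :: "nat \<Rightarrow> 'a \<Rightarrow> complex"
  assumes f [measurable]: "\<And>n. f n \<in> borel_measurable M"
    and Cauchy: "\<And>\<epsilon>. \<epsilon> > 0 \<Longrightarrow> \<exists>N. \<forall>m\<ge>N. \<forall>n\<ge>N. integrable M (\<lambda>x. (cmod (f m x - f n x))\<^sup>2) \<and>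
        (LINT x|M. (cmod (f m x - f n x))\<^sup>2) < \<epsilon>"
  obtains g r where "strict_mono (r :: nat \<Rightarrow> nat)" "g \<in> borel_measurable M"
    "AE x in M. (\<lambda>k. f (r k) x) \<longlonglongrightarrow> g x"
proof -
  define P where "P k N \<longleftrightarrow> (\<forall>m\<ge>N. \<forall>n\<ge>N. integrable M (\<lambda>x. (cmod (f m x - f n x))\<^sup>2) \<and>
        (LINT x|M. (cmod (f m x - f n x))\<^sup>2) < (1/4) ^ k)" for k N :: nat
  have "\<exists>N. P k N" for k unfolding P_def by (rule Cauchy) simp
  then obtain N where "\<And>k. P k (N k)" by metis
  then have N: "\<And>k m n. m \<ge> N k \<Longrightarrow> n \<ge> N k \<Longrightarrow> integrable M (\<lambda>x. (cmod (f m x - f n x))\<^sup>2)"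
     "\<And>k m n. m \<ge> N k \<Longrightarrow> n \<ge> N k \<Longrightarrow> (LINT x|M. (cmod (f m x - f n x))\<^sup>2) < (1/4) ^ k"
    unfolding P_def by blast+
  define r where "r = rec_nat (N 0) (\<lambda>k s. max (Suc s) (N (Suc k)))"
  have rS: "r (Suc k) = max (Suc (r k)) (N (Suc k))" for k by (simp add: r_def)
  have r: "strict_mono r" by (rule strict_monoI_Suc) (simp add: rS)
  have rN: "r k \<ge> N k" for k by (cases k) (simp_all add: rS, simp add: r_def)
  have rN': "r (Suc k) \<ge> N k" for k using rN[of k] rS[of k] by simp
  define d where "d k x = f (r (Suc k)) x - f (r k) x" for k x
  have [measurable]: "d k \<in> borel_measurable M" for k unfolding d_def by measurable
  have dk: "(\<integral>\<^sup>+x. ennreal (2 ^ k * (cmod (d k x))\<^sup>2) \<partial>M) \<le> ennreal ((1/2) ^ k)" for k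
  proof -
    have int: "integrable M (\<lambda>x. (cmod (d k x))\<^sup>2)"
      unfolding d_def by (rule N(1)[OF rN' rN])
    then have "(\<integral>\<^sup>+x. ennreal (2 ^ k * (cmod (d k x))\<^sup>2) \<partial>M) = ennreal (2 ^ k * (LINT x|M. (cmod (d k x))\<^sup>2))"
      by (subst nn_integral_eq_integral) auto
    also have "\<dots> \<le> ennreal (2 ^ k * (1/4) ^ k)"
      using N(2)[OF rN' rN, of k] unfolding d_def by (intro ennreal_leI mult_left_mono) auto
    also have "2 ^ k * (1/4) ^ k = ((1/2) ^ k :: real)" by (simp flip: power_mult_distrib)
    finally show ?thesis .
  qed
  have "(\<integral>\<^sup>+x. (\<Sum>k. ennreal (2 ^ k * (cmod (d k x))\<^sup>2)) \<partial>M) = (\<Sum>k. \<integral>\<^sup>+x. ennreal (2 ^ k * (cmod (d k x))\<^sup>2) \<partial>M)"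
    by (rule nn_integral_suminf) measurable
  also have "\<dots> \<le> (\<Sum>k. ennreal ((1/2) ^ k))" by (intro suminf_le dk) auto
  also have "\<dots> = ennreal (\<Sum>k. (1/2) ^ k)" by (intro suminf_ennreal2) (auto simp: summable_geometric)
  finally have fin: "(\<integral>\<^sup>+x. (\<Sum>k. ennreal (2 ^ k * (cmod (d k x))\<^sup>2)) \<partial>M) \<noteq> \<infinity>"
    by (auto simp: top_unique)
  have "AE x in M. (\<Sum>k. ennreal (2 ^ k * (cmod (d k x))\<^sup>2)) \<noteq> \<infinity>"
    by (rule nn_integral_PInf_AE[OF _ fin]) measurable
  then have conv: "AE x in M. convergent (\<lambda>k. f (r k) x)"
  proof eventually_elim
    case (elim x)
    have sum: "summable (\<lambda>k. 2 ^ k * (cmod (d k x))\<^sup>2)"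
      using elim by (intro summable_suminf_not_top) auto
    then have "(\<lambda>k. 2 ^ k * (cmod (d k x))\<^sup>2) \<longlonglongrightarrow> 0" by (rule summable_LIMSEQ_zero)
    then have "\<forall>\<^sub>F k in sequentially. 2 ^ k * (cmod (d k x))\<^sup>2 < 1" by (rule order_tendstoD) simp
    then have "\<forall>\<^sub>F k in sequentially. norm (d k x) \<le> sqrt (1/2) ^ k"
    proof eventually_elim
      case (elim k)
      have "(cmod (d k x))\<^sup>2 \<le> (1/2) ^ k" using elim by (simp add: field_simps power_divide)
      then have "cmod (d k x) \<le> sqrt ((1/2) ^ k)" by (rule real_le_rsqrt)
      then show ?case by (simp add: real_sqrt_power)
    qed
    moreover have "summable (\<lambda>k. sqrt (1/2) ^ k)" by (intro summable_geometric) (simp add: real_sqrt_lt_1_iff)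
    ultimately have "summable (\<lambda>k. d k x)" by (rule summable_comparison_test_ev)
    then have "convergent (\<lambda>n. \<Sum>k<n. d k x)" by (simp add: summable_iff_convergent)
    then have "convergent (\<lambda>n. (\<Sum>k<n. d k x) + f (r 0) x)"
      by (intro convergent_add convergent_const)
    moreover have "(\<Sum>k<n. d k x) + f (r 0) x = f (r n) x" for n
      unfolding d_def by (subst sum_lessThan_telescope) simp
    ultimately show ?case by simp
  qed
  define g where "g x = (if convergent (\<lambda>k. f (r k) x) then lim (\<lambda>k. f (r k) x) else 0)" for x
  have "g \<in> borel_measurable M"
  proof -
    have "(\<lambda>x. if Cauchy (\<lambda>k. f (r k) x) then lim (\<lambda>k. f (r k) x) else 0) \<in> borel_measurable M"
      by (intro measurable_If borel_measurable_lim_metric) (auto intro!: sets_Collect_Cauchy)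
    then show ?thesis unfolding g_def[abs_def] by (simp add: Cauchy_convergent_iff)
  qed
  moreover have "AE x in M. (\<lambda>k. f (r k) x) \<longlonglongrightarrow> g x"
    using conv by eventually_elim (simp add: g_def convergent_LIMSEQ_iff)
  ultimately show ?thesis using that r by blast
qed

text \<open>
  Pointwise operations make the functions on a graph a real vector space, so that function
  spaces on the graph are subspaces in the sense of the previous sections.
\<close>

instantiation "fun" :: (type, real_vector) real_vector
begin

definition "c *\<^sub>R f = (\<lambda>x. c *\<^sub>R f x)" for f :: "'a \<Rightarrow> 'b"

instance
  by standard (simp_all add: scaleR_fun_def fun_eq_iff scaleR_add_left scaleR_add_right)

end

lemma scaleR_fun_apply [simp]: "(c *\<^sub>R f) x = c *\<^sub>R f x"
  by (simp add: scaleR_fun_def)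

lemma edge_interval_measurable [measurable]: "edge_interval G e \<in> sets lebesgue"
  by (rule edge_interval_lebesgue)

lemma gmeasurable_iff: "gmeasurable G f \<longleftrightarrow> (\<forall>e\<in>edges G. f e \<in> borel_measurable (lebesgue_on (edge_interval G e)))"
  unfolding gmeasurable_def set_borel_measurable_def
  by (auto simp: borel_measurable_restrict_space_iff edge_interval_lebesgue)

lemma gintegrable_iff: "gintegrable G f \<longleftrightarrow> (\<forall>e\<in>edges G. integrable (lebesgue_on (edge_interval G e)) (f e))"
  unfolding gintegrable_def set_integrable_def
  by (simp add: integrable_restrict_space edge_interval_lebesgue)

lemma gintegral_eq: "gintegral G f = (\<Sum>e\<in>edges G. integral\<^sup>L (lebesgue_on (edge_interval G e)) (f e))"
  unfolding gintegral_def set_lebesgue_integral_def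
  by (simp add: integral_restrict_space edge_interval_lebesgue)

lemma ae_eq_iff: "ae_eq G f g \<longleftrightarrow> (\<forall>e\<in>edges G. AE x in lebesgue_on (edge_interval G e). f e x = g e x)"
  unfolding ae_eq_def by (simp add: AE_restrict_space_iff edge_interval_lebesgue)

lemma gintegrable_add: "\<lbrakk>gintegrable G f; gintegrable G g\<rbrakk> \<Longrightarrow> gintegrable G (\<lambda>e x. f e x + g e x)"
  by (simp add: gintegrable_iff)

lemma gintegrable_diff: "\<lbrakk>gintegrable G f; gintegrable G g\<rbrakk> \<Longrightarrow> gintegrable G (\<lambda>e x. f e x - g e x)"
  by (simp add: gintegrable_iff)

lemma gintegrable_mult: "gintegrable G f \<Longrightarrow> gintegrable G (\<lambda>e x. c * f e x)"
  for c :: "'a::{real_normed_field, banach, second_countable_topology}"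
  by (simp add: gintegrable_iff)

lemma gintegral_add:
  "\<lbrakk>gintegrable G f; gintegrable G g\<rbrakk> \<Longrightarrow> gintegral G (\<lambda>e x. f e x + g e x) = gintegral G f + gintegral G g"
  by (simp add: gintegral_eq gintegrable_iff flip: sum.distrib)

lemma gintegral_diff:
  "\<lbrakk>gintegrable G f; gintegrable G g\<rbrakk> \<Longrightarrow> gintegral G (\<lambda>e x. f e x - g e x) = gintegral G f - gintegral G g"
  by (simp add: gintegral_eq gintegrable_iff flip: sum_subtractf)

lemma gintegral_mult: "gintegral G (\<lambda>e x. c * f e x) = c * gintegral G f"
  for c :: "'a::{real_normed_field, banach, second_countable_topology}"
  by (simp add: gintegral_eq sum_distrib_left)

lemma gintegral_Re: "gintegrable G f \<Longrightarrow> Re (gintegral G f) = gintegral G (\<lambda>e x. Re (f e x))"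
  by (simp add: gintegral_eq gintegrable_iff)

lemma gintegrable_Re: "gintegrable G f \<Longrightarrow> gintegrable G (\<lambda>e x. Re (f e x))"
  by (simp add: gintegrable_iff)

lemma gintegral_of_real: "gintegral G (\<lambda>e x. complex_of_real (f e x)) = of_real (gintegral G f)"
  by (simp add: gintegral_eq)

lemma gintegral_mono:
  fixes f g :: "'e \<Rightarrow> real \<Rightarrow> real"
  assumes "gintegrable G f" "gintegrable G g" "\<And>e x. \<lbrakk>e \<in> edges G; x \<in> edge_interval G e\<rbrakk> \<Longrightarrow> f e x \<le> g e x"
  shows "gintegral G f \<le> gintegral G g"
  unfolding gintegral_eq using assms by (intro sum_mono integral_mono) (auto simp: gintegrable_iff)

lemma gintegral_nonneg:
  fixes f :: "'e \<Rightarrow> real \<Rightarrow> real"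
  assumes "\<And>e x. \<lbrakk>e \<in> edges G; x \<in> edge_interval G e\<rbrakk> \<Longrightarrow> 0 \<le> f e x"
  shows "0 \<le> gintegral G f"
  unfolding gintegral_eq using assms by (intro sum_nonneg Bochner_Integration.integral_nonneg) auto

lemma gintegral_cong:
  "(\<And>e x. \<lbrakk>e \<in> edges G; x \<in> edge_interval G e\<rbrakk> \<Longrightarrow> f e x = g e x) \<Longrightarrow> gintegral G f = gintegral G g"
  unfolding gintegral_eq by (intro sum.cong Bochner_Integration.integral_cong) auto

lemma gintegrable_cong:
  "(\<And>e x. \<lbrakk>e \<in> edges G; x \<in> edge_interval G e\<rbrakk> \<Longrightarrow> f e x = g e x) \<Longrightarrow> gintegrable G f = gintegrable G g"
  unfolding gintegrable_iff by (intro ball_cong Bochner_Integration.integrable_cong) auto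

lemma gintegrable_bound:
  assumes "gintegrable G g" "gmeasurable G f"
    "\<And>e x. \<lbrakk>e \<in> edges G; x \<in> edge_interval G e\<rbrakk> \<Longrightarrow> norm (f e x) \<le> norm (g e x)"
  shows "gintegrable G f"
  unfolding gintegrable_iff
proof
  fix e assume e: "e \<in> edges G"
  show "integrable (lebesgue_on (edge_interval G e)) (f e)"
    by (rule Bochner_Integration.integrable_bound[of _ "g e"])
       (use assms e in \<open>auto simp: gintegrable_iff gmeasurable_iff\<close>)
qed

lemma gmeasurable_add: "\<lbrakk>gmeasurable G f; gmeasurable G g\<rbrakk> \<Longrightarrow> gmeasurable G (\<lambda>e x. f e x + g e x)"
  for f g :: "('e, 'a::{real_normed_vector, second_countable_topology}) gfun"
  by (auto simp: gmeasurable_iff intro!: borel_measurable_add)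

lemma gmeasurable_mult: "\<lbrakk>gmeasurable G f; gmeasurable G g\<rbrakk> \<Longrightarrow> gmeasurable G (\<lambda>e x. f e x * g e x)"
  for f g :: "('e, complex) gfun"
  by (auto simp: gmeasurable_iff intro!: borel_measurable_times)

lemma gmeasurable_const: "gmeasurable G (\<lambda>e x. c)"
  by (simp add: gmeasurable_iff)

lemma gmeasurable_cmod_sq: "gmeasurable G f \<Longrightarrow> gmeasurable G (\<lambda>e x. (cmod (f e x))\<^sup>2)"
  by (auto simp: gmeasurable_iff)

lemma cmod_add_sq_le: "(cmod (x + y))\<^sup>2 \<le> 2 * (cmod x)\<^sup>2 + 2 * (cmod y)\<^sup>2"
proof -
  have "(cmod (x + y))\<^sup>2 \<le> (cmod x + cmod y)\<^sup>2" by (intro power_mono norm_triangle_ineq) simp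
  also have "\<dots> \<le> 2 * (cmod x)\<^sup>2 + 2 * (cmod y)\<^sup>2"
    using sum_squares_bound[of "cmod x" "cmod y"] by (simp add: power2_sum)
  finally show ?thesis .
qed

lemma L2_add:
  assumes "f \<in> L2 G" "g \<in> L2 G" shows "(\<lambda>e x. f e x + g e x) \<in> L2 G"
proof -
  have m: "gmeasurable G (\<lambda>e x. f e x + g e x)" using assms by (intro gmeasurable_add) (auto simp: L2_def)
  have "gintegrable G (\<lambda>e x. 2 * (cmod (f e x))\<^sup>2 + 2 * (cmod (g e x))\<^sup>2)"
    using assms by (intro gintegrable_add gintegrable_mult) (auto simp: L2_def)
  then have "gintegrable G (\<lambda>e x. (cmod (f e x + g e x))\<^sup>2)"
    by (rule gintegrable_bound) (use m cmod_add_sq_le in \<open>auto intro!: gmeasurable_cmod_sq\<close>)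
  then show ?thesis using m by (simp add: L2_def)
qed

lemma L2_scale:
  assumes "f \<in> L2 G" shows "(\<lambda>e x. c * f e x) \<in> L2 G"
  using assms by (auto simp: L2_def norm_mult power_mult_distrib
      intro!: gintegrable_mult gmeasurable_mult gmeasurable_const)

lemma L2_diff:
  assumes "f \<in> L2 G" "g \<in> L2 G" shows "(\<lambda>e x. f e x - g e x) \<in> L2 G"
  using L2_add[OF assms(1) L2_scale[OF assms(2), of "-1"]] by simp

lemma L2_product_integrable:
  assumes "f \<in> L2 G" "g \<in> L2 G" shows "gintegrable G (\<lambda>e x. f e x * cnj (g e x))"
proof (rule gintegrable_bound)
  show "gintegrable G (\<lambda>e x. (cmod (f e x))\<^sup>2 + (cmod (g e x))\<^sup>2)"
    using assms by (intro gintegrable_add) (auto simp: L2_def)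
  show "gmeasurable G (\<lambda>e x. f e x * cnj (g e x))" using assms by (intro gmeasurable_mult_cnj) (auto simp: L2_def)
  fix e x
  have "2 * (cmod (f e x) * cmod (g e x)) \<le> (cmod (f e x))\<^sup>2 + (cmod (g e x))\<^sup>2"
    using sum_squares_bound[of "cmod (f e x)" "cmod (g e x)"] by simp
  moreover have "0 \<le> cmod (f e x) * cmod (g e x)" by simp
  ultimately have "cmod (f e x) * cmod (g e x) \<le> (cmod (f e x))\<^sup>2 + (cmod (g e x))\<^sup>2" by linarith
  then show "norm (f e x * cnj (g e x)) \<le> norm ((cmod (f e x))\<^sup>2 + (cmod (g e x))\<^sup>2)"
    by (simp add: norm_mult)
qed

lemma L2_inner_add_left:
  "\<lbrakk>f \<in> L2 G; g \<in> L2 G; h \<in> L2 G\<rbrakk> \<Longrightarrow> L2_inner G (\<lambda>e x. f e x + g e x) h = L2_inner G f h + L2_inner G g h"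
  unfolding L2_inner_def by (simp add: distrib_right gintegral_add L2_product_integrable)

lemma L2_inner_scale_left: "L2_inner G (\<lambda>e x. c * f e x) h = c * L2_inner G f h"
  unfolding L2_inner_def by (simp add: mult.assoc gintegral_mult)

lemma L2_inner_scale_right: "L2_inner G f (\<lambda>e x. c * h e x) = cnj c * L2_inner G f h"
  using L2_inner_scale_left[of G c h f] L2_inner_cnj[of G f] by (metis complex_cnj_mult)

lemma L2_inner_self: "L2_inner G f f = complex_of_real (gintegral G (\<lambda>e x. (cmod (f e x))\<^sup>2))"
  unfolding L2_inner_def gintegral_of_real[symmetric] by (intro gintegral_cong) (simp only: complex_norm_square)

lemma L2_norm_sq: "(L2_norm G f)\<^sup>2 = Re (L2_inner G f f)"
  unfolding L2_norm_def L2_inner_self by (simp add: gintegral_nonneg)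

lemma L2_inner_cong:
  assumes "\<And>e x. \<lbrakk>e \<in> edges G; x \<in> edge_interval G e\<rbrakk> \<Longrightarrow> f e x = f' e x"
    "\<And>e x. \<lbrakk>e \<in> edges G; x \<in> edge_interval G e\<rbrakk> \<Longrightarrow> g e x = g' e x"
  shows "L2_inner G f g = L2_inner G f' g'"
  unfolding L2_inner_def using assms by (intro gintegral_cong) auto

lemma L2_inner_cong_ae_left:
  assumes "gmeasurable G f" "gmeasurable G f'" "gmeasurable G g" "ae_eq G f f'"
  shows "L2_inner G f g = L2_inner G f' g"
  by (metis L2_inner_cnj L2_inner_cong_ae assms)

lemma L2_complete:
  assumes fin: "finite (edges G)" and f: "\<And>n. f n \<in> L2 G"
    and Cauchy: "\<And>\<epsilon>. \<epsilon> > 0 \<Longrightarrow> \<exists>N. \<forall>m\<ge>N. \<forall>n\<ge>N. gintegral G (\<lambda>e x. (cmod (f m e x - f n e x))\<^sup>2) < \<epsilon>"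
  shows "\<exists>g\<in>L2 G. (\<lambda>n. gintegral G (\<lambda>e x. (cmod (f n e x - g e x))\<^sup>2)) \<longlonglongrightarrow> 0"
    and "\<lbrakk>\<And>e x. \<lbrakk>e \<in> edges G; x \<in> edge_interval G e\<rbrakk> \<Longrightarrow> (\<lambda>n. f n e x) \<longlonglongrightarrow> h e x\<rbrakk>
      \<Longrightarrow> h \<in> L2 G \<and> (\<lambda>n. gintegral G (\<lambda>e x. (cmod (f n e x - h e x))\<^sup>2)) \<longlonglongrightarrow> 0"
proof -
  let ?M = "\<lambda>e. lebesgue_on (edge_interval G e)"
  have fm: "f n e \<in> borel_measurable (?M e)" if "e \<in> edges G" for n e
    using f[of n] that by (auto simp: L2_def gmeasurable_iff)
  have int: "integrable (?M e) (\<lambda>x. (cmod (f m e x - f n e x))\<^sup>2)" if "e \<in> edges G" for m n e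
    using L2_diff[OF f[of m] f[of n]] that by (auto simp: L2_def gintegrable_iff)
  have C: "\<exists>N. \<forall>m\<ge>N. \<forall>n\<ge>N. integrable (?M e) (\<lambda>x. (cmod (f m e x - f n e x))\<^sup>2) \<and>
        (LINT x|?M e. (cmod (f m e x - f n e x))\<^sup>2) < \<epsilon>" if e: "e \<in> edges G" and \<epsilon>: "\<epsilon> > 0" for e \<epsilon>
  proof -
    obtain N where N: "\<And>m n. m \<ge> N \<Longrightarrow> n \<ge> N \<Longrightarrow> gintegral G (\<lambda>e x. (cmod (f m e x - f n e x))\<^sup>2) < \<epsilon>"
      using Cauchy[OF \<epsilon>] by blast
    have "(LINT x|?M e. (cmod (f m e x - f n e x))\<^sup>2) \<le> gintegral G (\<lambda>e x. (cmod (f m e x - f n e x))\<^sup>2)" for m n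
      unfolding gintegral_eq
      by (rule member_le_sum[OF e _ fin, of "\<lambda>e. LINT x|?M e. (cmod (f m e x - f n e x))\<^sup>2"]) simp
    then have "(LINT x|?M e. (cmod (f m e x - f n e x))\<^sup>2) < \<epsilon>" if "m \<ge> N" "n \<ge> N" for m n
      using N[OF that] by (rule le_less_trans)
    then show ?thesis using int[OF e] by blast
  qed
  have main: "h \<in> L2 G \<and> (\<lambda>n. gintegral G (\<lambda>e x. (cmod (f n e x - h e x))\<^sup>2)) \<longlonglongrightarrow> 0"
    if h: "\<And>e. e \<in> edges G \<Longrightarrow> \<exists>r. strict_mono (r :: nat \<Rightarrow> nat) \<and> h e \<in> borel_measurable (?M e) \<and>
        (AE x in ?M e. (\<lambda>k. f (r k) e x) \<longlonglongrightarrow> h e x)" for h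
  proof -
    have ex: "\<exists>N. \<forall>n\<ge>N. integrable (?M e) (\<lambda>x. (cmod (f n e x - h e x))\<^sup>2) \<and>
       (LINT x|?M e. (cmod (f n e x - h e x))\<^sup>2) \<le> \<epsilon>" if e: "e \<in> edges G" and \<epsilon>: "\<epsilon> > 0" for e \<epsilon>
    proof -
      obtain r where r: "strict_mono (r :: nat \<Rightarrow> nat)" "h e \<in> borel_measurable (?M e)"
          "AE x in ?M e. (\<lambda>k. f (r k) e x) \<longlonglongrightarrow> h e x" using h[OF e] by blast
      show ?thesis
        by (rule L2_limit_of_Cauchy[where f = "\<lambda>n. f n e", OF fm[OF e] C[OF e] r(1,3,2) \<epsilon>])
    qed
    have lim: "(\<lambda>n. LINT x|?M e. (cmod (f n e x - h e x))\<^sup>2) \<longlonglongrightarrow> 0" if e: "e \<in> edges G" for e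
    proof (rule LIMSEQ_I)
      fix \<epsilon> :: real assume "0 < \<epsilon>"
      then obtain N where "\<And>n. n \<ge> N \<Longrightarrow> (LINT x|?M e. (cmod (f n e x - h e x))\<^sup>2) \<le> \<epsilon> / 2"
        using ex[OF e, of "\<epsilon> / 2"] by auto
      then show "\<exists>N. \<forall>n\<ge>N. norm ((LINT x|?M e. (cmod (f n e x - h e x))\<^sup>2) - 0) < \<epsilon>"
        using \<open>0 < \<epsilon>\<close> by (intro exI[of _ N]) (force simp: abs_of_nonneg)
    qed
    have hm: "gmeasurable G h" using h by (auto simp: gmeasurable_iff)
    have "integrable (?M e) (\<lambda>x. (cmod (h e x))\<^sup>2)" if e: "e \<in> edges G" for e
    proof -
      obtain n where n: "integrable (?M e) (\<lambda>x. (cmod (f n e x - h e x))\<^sup>2)" using ex[OF e, of 1] by auto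
      have fn: "integrable (?M e) (\<lambda>x. (cmod (f n e x))\<^sup>2)" using f[of n] e by (auto simp: L2_def gintegrable_iff)
      show ?thesis
      proof (rule Bochner_Integration.integrable_bound)
        show "integrable (?M e) (\<lambda>x. 2 * (cmod (f n e x))\<^sup>2 + 2 * (cmod (f n e x - h e x))\<^sup>2)"
          using n fn by simp
        show "(\<lambda>x. (cmod (h e x))\<^sup>2) \<in> borel_measurable (?M e)" using hm e by (auto simp: gmeasurable_iff)
        have "(cmod (h e x))\<^sup>2 \<le> 2 * (cmod (f n e x))\<^sup>2 + 2 * (cmod (f n e x - h e x))\<^sup>2" for x
          using cmod_add_sq_le[of "f n e x" "h e x - f n e x"] by (simp add: norm_minus_commute)
        then show "AE x in ?M e. norm ((cmod (h e x))\<^sup>2) \<le> norm (2 * (cmod (f n e x))\<^sup>2 + 2 * (cmod (f n e x - h e x))\<^sup>2)"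
          by (intro always_eventually allI) (simp add: abs_of_nonneg)
      qed
    qed
    then have "h \<in> L2 G" using hm by (simp add: L2_def gintegrable_iff)
    moreover have "(\<lambda>n. gintegral G (\<lambda>e x. (cmod (f n e x - h e x))\<^sup>2)) \<longlonglongrightarrow> (\<Sum>e\<in>edges G. 0)"
      unfolding gintegral_eq by (intro tendsto_sum lim)
    ultimately show ?thesis by simp
  qed
  define Q where "Q e g \<longleftrightarrow> (\<exists>r. strict_mono (r :: nat \<Rightarrow> nat) \<and> g \<in> borel_measurable (?M e) \<and>
        (AE x in ?M e. (\<lambda>k. f (r k) e x) \<longlonglongrightarrow> g x))" for e g
  have "\<exists>g. Q e g" if e: "e \<in> edges G" for e
  proof (rule L2_Cauchy_subsequence_converges[where f = "\<lambda>n. f n e", OF fm[OF e] C[OF e]])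
    fix g r assume "strict_mono (r :: nat \<Rightarrow> nat)" "g \<in> borel_measurable (?M e)"
        "AE x in ?M e. (\<lambda>k. f (r k) e x) \<longlonglongrightarrow> g x"
    then have "Q e g" unfolding Q_def by blast
    then show ?thesis by blast
  qed
  then obtain g where "\<And>e. e \<in> edges G \<Longrightarrow> Q e (g e)" by metis
  then have "g \<in> L2 G \<and> (\<lambda>n. gintegral G (\<lambda>e x. (cmod (f n e x - g e x))\<^sup>2)) \<longlonglongrightarrow> 0"
    unfolding Q_def by (rule main)
  then show "\<exists>g\<in>L2 G. (\<lambda>n. gintegral G (\<lambda>e x. (cmod (f n e x - g e x))\<^sup>2)) \<longlonglongrightarrow> 0"
    by blast
  assume h: "\<And>e x. \<lbrakk>e \<in> edges G; x \<in> edge_interval G e\<rbrakk> \<Longrightarrow> (\<lambda>n. f n e x) \<longlonglongrightarrow> h e x"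
  show "h \<in> L2 G \<and> (\<lambda>n. gintegral G (\<lambda>e x. (cmod (f n e x - h e x))\<^sup>2)) \<longlonglongrightarrow> 0"
  proof (rule main)
    fix e assume e: "e \<in> edges G"
    have "h e \<in> borel_measurable (?M e)"
      by (rule borel_measurable_LIMSEQ_metric[OF fm[OF e]]) (use h e in auto)
    then show "\<exists>r. strict_mono (r :: nat \<Rightarrow> nat) \<and> h e \<in> borel_measurable (?M e) \<and>
        (AE x in ?M e. (\<lambda>k. f (r k) e x) \<longlonglongrightarrow> h e x)"
      using h e by (intro exI[of _ id]) (auto simp: strict_mono_id intro!: AE_I2)
  qed
qed


section \<open>The magnetic Sobolev space\<close>

locale magnetic_graph =
  fixes G :: "('v, 'e) mgraph" and A V :: "'e \<Rightarrow> real \<Rightarrow> real"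
  assumes metric: "metric_graph G" and fin: "finite (edges G)"
    and A_loc: "A \<in> L2_loc G" and V_loc: "V \<in> L1_loc G"
    and V_ge_1: "\<forall>e\<in>edges G. \<forall>x\<in>edge_interval G e. 1 \<le> V e x"
begin

abbreviation I where "I \<equiv> edge_interval G"

lemma len_pos: "e \<in> edges G \<Longrightarrow> 0 < len G e"
  using metric by (auto simp: metric_graph_def)

lemma I_zero [simp]: "e \<in> edges G \<Longrightarrow> 0 \<in> I e"
  using len_pos[of e] by (simp add: edge_interval_def less_imp_le zero_ereal_def[symmetric])

lemma I_nonneg: "x \<in> I e \<Longrightarrow> 0 \<le> x"
  by (simp add: edge_interval_def)

lemma I_down: "x \<in> I e \<Longrightarrow> 0 \<le> y \<Longrightarrow> y \<le> x \<Longrightarrow> y \<in> I e"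
  unfolding edge_interval_def by (auto intro: order_trans[of "ereal y" "ereal x"])

lemma I_sub: "x \<in> I e \<Longrightarrow> {0..x} \<subseteq> I e"
  using I_down by auto

lemma I_interior: "x \<in> I e \<Longrightarrow> {0<..<x} \<subseteq> interior (I e)"
  using I_sub[of x e] by (intro interior_maximal) auto

lemma I_convex: "convex (I e)"
  unfolding is_interval_convex_1[symmetric] is_interval_1
proof (intro ballI allI impI)
  fix a b x assume "a \<in> I e" "b \<in> I e" "a \<le> x \<and> x \<le> b"
  then show "x \<in> I e" using I_nonneg[of a e] by (intro I_down[of b e x]) auto
qed

lemma I_pos: "e \<in> edges G \<Longrightarrow> \<exists>y>0. y \<in> I e"
proof -
  assume e: "e \<in> edges G"
  obtain y where "0 < ereal y" "ereal y < len G e"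
    using ereal_dense2[OF len_pos[OF e]] by auto
  then show ?thesis by (auto simp: edge_interval_def intro!: exI[of _ y])
qed

lemma I_subset_bounded:
  assumes "e \<in> edges G" "x \<in> I e"
  shows "{0..x} \<in> sets lebesgue" "bounded {0..x}" "{0..x} \<subseteq> I e"
  using I_sub[OF assms(2)] by auto

lemma A_sq_integrable: "\<lbrakk>e \<in> edges G; x \<in> I e\<rbrakk> \<Longrightarrow> set_integrable lebesgue {0..x} (\<lambda>t. (A e t)\<^sup>2)"
proof -
  assume e: "e \<in> edges G" and x: "x \<in> I e"
  have "\<forall>B\<in>sets lebesgue. bounded B \<and> B \<subseteq> I e \<longrightarrow> set_integrable lebesgue B (\<lambda>t. (A e t)\<^sup>2)"
    using A_loc e by (simp add: L2_loc_def)
  then show ?thesis using I_subset_bounded[OF e x] by simp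
qed

lemma measurable_on_sub:
  fixes f :: "real \<Rightarrow> 'a::{banach, second_countable_topology}"
  assumes f: "set_borel_measurable lebesgue (I e) f" and x: "x \<in> I e"
  shows "set_borel_measurable lebesgue {0..x} f"
  by (rule set_borel_measurable_subset[OF f]) (use I_sub[OF x] in auto)

lemma square_integrable_imp_integrable:
  fixes f :: "real \<Rightarrow> 'a::{banach, second_countable_topology}"
  assumes "set_integrable lebesgue {0..x} (\<lambda>t. (norm (f t))\<^sup>2)" "set_borel_measurable lebesgue {0..x} f"
  shows "set_integrable lebesgue {0..x} f"
proof (rule set_integrable_bound)
  show "set_integrable lebesgue {0..x} (\<lambda>t. 1 + (norm (f t))\<^sup>2)"
    using set_integral_add(1)[OF _ assms(1), of "\<lambda>_. 1"] continuous_set_integrable[of 0 x "\<lambda>_. 1 :: real"]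
    by simp
  show "set_borel_measurable lebesgue {0..x} f" by (rule assms(2))
  have "norm (f t) \<le> norm (1 + (norm (f t))\<^sup>2)" for t
  proof -
    have "2 * norm (f t) \<le> 1 + (norm (f t))\<^sup>2" using sum_squares_bound[of 1 "norm (f t)"] by simp
    then have "norm (f t) \<le> 1 + (norm (f t))\<^sup>2" using norm_ge_zero[of "f t"] by linarith
    then show ?thesis by simp
  qed
  then show "AE t in lebesgue. t \<in> {0..x} \<longrightarrow> norm (f t) \<le> norm (1 + (norm (f t))\<^sup>2)" by simp
qed

lemma A_integrable: "\<lbrakk>e \<in> edges G; x \<in> I e\<rbrakk> \<Longrightarrow> set_integrable lebesgue {0..x} (A e)"
proof (rule square_integrable_imp_integrable)
  assume e: "e \<in> edges G" and x: "x \<in> I e"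
  show "set_integrable lebesgue {0..x} (\<lambda>t. (norm (A e t))\<^sup>2)" using A_sq_integrable[OF e x] by simp
  show "set_borel_measurable lebesgue {0..x} (A e)"
    using A_loc e x by (intro measurable_on_sub) (auto simp: L2_loc_def gmeasurable_def)
qed

text \<open>
  The ordinary derivative of \<open>u\<close> in terms of its magnetic derivative \<open>D\<close>: solving
  \<open>D = u' / i - A u\<close> for \<open>u'\<close>.
\<close>

definition drift where "drift D u = (\<lambda>e t. \<i> * (D e t + complex_of_real (A e t) * u e t))"

text \<open>
  \<open>D\<close> is a square-integrable magnetic derivative of \<open>u\<close>, expressed through an integral equation up to
  the end points of the edges. This form is linear in \<open>(u, D)\<close> and stable under limits, unlike
  \<open>mag_deriv\<close>, which involves a choice of representative.
\<close>

definition mag_rep where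
  "mag_rep u D \<longleftrightarrow> D \<in> L2 G \<and>
     (\<forall>e\<in>edges G. \<forall>x\<in>I e. u e x = u e 0 + (LINT t:{0..x}|lebesgue. drift D u e t))"

lemma L2_integrable:
  assumes "D \<in> L2 G" "e \<in> edges G" "x \<in> I e"
  shows "set_integrable lebesgue {0..x} (D e)"
proof (rule square_integrable_imp_integrable)
  have "set_integrable lebesgue (I e) (\<lambda>t. (norm (D e t))\<^sup>2)"
    using assms by (simp add: L2_def gintegrable_def)
  then show "set_integrable lebesgue {0..x} (\<lambda>t. (norm (D e t))\<^sup>2)"
    by (rule set_integrable_subset) (use I_sub assms in auto)
  show "set_borel_measurable lebesgue {0..x} (D e)"
    using assms by (intro measurable_on_sub) (auto simp: L2_def gmeasurable_def)
qed

lemma continuous_edge: "\<lbrakk>gcontinuous G u; e \<in> edges G\<rbrakk> \<Longrightarrow> continuous_on (I e) (u e)"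
  by (simp add: gcontinuous_def)

lemma A_mult_integrable:
  assumes u: "continuous_on {0..x} (u :: real \<Rightarrow> complex)" and e: "e \<in> edges G" and x: "x \<in> I e"
  shows "set_integrable lebesgue {0..x} (\<lambda>t. complex_of_real (A e t) * u t)"
proof -
  obtain B where B: "\<And>t. t \<in> {0..x} \<Longrightarrow> norm (u t) \<le> B"
    using compact_continuous_image[OF u compact_Icc] compact_imp_bounded by (fastforce simp: bounded_iff)
  have mA: "set_borel_measurable lebesgue {0..x} (A e)"
    using A_loc e x by (intro measurable_on_sub) (auto simp: L2_loc_def gmeasurable_def)
  show ?thesis
  proof (rule set_integrable_bound)
    show "set_integrable lebesgue {0..x} (\<lambda>t. B * A e t)"
      using A_integrable[OF e x] by simp
    have "set_borel_measurable lebesgue {0..x} u"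
      using continuous_set_integrable[OF u] by (simp add: set_integrable_def set_borel_measurable_def)
    then have [measurable]: "(\<lambda>t. indicator {0..x} t *\<^sub>R u t) \<in> borel_measurable lebesgue"
      by (simp add: set_borel_measurable_def)
    have [measurable]: "(\<lambda>t. indicator {0..x} t *\<^sub>R A e t) \<in> borel_measurable lebesgue"
      using mA by (simp add: set_borel_measurable_def)
    have "(\<lambda>t. complex_of_real (indicator {0..x} t *\<^sub>R A e t) * (indicator {0..x} t *\<^sub>R u t)) \<in> borel_measurable lebesgue"
      by measurable
    moreover have "(\<lambda>t. complex_of_real (indicator {0..x} t *\<^sub>R A e t) * (indicator {0..x} t *\<^sub>R u t))
       = (\<lambda>t. indicator {0..x} t *\<^sub>R (complex_of_real (A e t) * u t))"
      by (auto simp: fun_eq_iff indicator_def)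
    ultimately show "set_borel_measurable lebesgue {0..x} (\<lambda>t. complex_of_real (A e t) * u t)"
      by (simp add: set_borel_measurable_def)
    have "norm (complex_of_real (A e t) * u t) \<le> norm (B * A e t)" if "t \<in> {0..x}" for t
    proof -
      have "0 \<le> B" using B[OF that] norm_ge_zero order_trans by blast
      have "\<bar>A e t\<bar> * norm (u t) \<le> \<bar>A e t\<bar> * B" using B[OF that] by (intro mult_left_mono) auto
      then show ?thesis using \<open>0 \<le> B\<close> by (simp add: norm_mult abs_mult mult.commute)
    qed
    then show "AE t in lebesgue. t \<in> {0..x} \<longrightarrow> norm (complex_of_real (A e t) * u t) \<le> norm (B * A e t)" by simp
  qed
qed

lemma drift_integrable:
  assumes "gcontinuous G u" "D \<in> L2 G" "e \<in> edges G" "x \<in> I e"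
  shows "set_integrable lebesgue {0..x} (drift D u e)"
  unfolding drift_def
proof (intro set_integrable_mult_right set_integral_add)
  have "continuous_on {0..x} (u e)"
    using continuous_edge[OF assms(1,3)] I_sub[OF assms(4)] continuous_on_subset by blast
  then show "set_integrable lebesgue {0..x} (\<lambda>t. complex_of_real (A e t) * u e t)"
    using assms by (intro A_mult_integrable)
qed (rule L2_integrable[OF assms(2-4)])

text \<open>
  Lebesgue measure is complete.
\<close>

lemma AE_completion_measurable:
  fixes f g :: "real \<Rightarrow> complex"
  assumes f: "f \<in> borel_measurable lebesgue" and ae: "AE x in lebesgue. f x = g x"
  shows "g \<in> borel_measurable lebesgue"
proof (rule measurableI)
  fix B :: "complex set" assume B: "B \<in> sets borel"
  have "f -` B \<inter> space lebesgue \<in> sets lebesgue" using f B by (rule measurable_sets)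
  moreover have "AE x in lebesgue. x \<in> f -` B \<inter> space lebesgue \<longleftrightarrow> x \<in> g -` B \<inter> space lebesgue"
    using ae by eventually_elim auto
  ultimately show "g -` B \<inter> space lebesgue \<in> sets lebesgue"
    by (intro completion.in_sets_AE[of "f -` B \<inter> space lebesgue" "g -` B \<inter> space lebesgue" lborel]) auto
qed auto

text \<open>
  On compact intervals inside the edge both weak derivatives have the same indefinite integrals.
  Countably many such intervals, those with rational end points, cover the interior of the edge.
\<close>

lemma weak_deriv_unique:
  assumes u: "continuous_on (I e) u"
    and g1: "has_weak_deriv (I e) u g1" and g2: "has_weak_deriv (I e) u g2"
  shows "AE x in lebesgue. x \<in> I e \<longrightarrow> g1 x = g2 x"
proof -
  have ae: "AE x in lebesgue. x \<in> {c..d} \<longrightarrow> g1 x = g2 x" if cd: "{c..d} \<subseteq> interior (I e)" for c d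
  proof -
    have loc: "set_integrable lebesgue {c..d} g1" "set_integrable lebesgue {c..d} g2"
      using g1 g2 cd compact_Icc unfolding has_weak_deriv_def locally_integrable_def by metis+
    have uc: "continuous_on {c..d} u"
      using u cd interior_subset continuous_on_subset by (metis order_trans)
    have "AE x in lebesgue. x \<in> {c..d} \<longrightarrow> g1 x - g2 x = 0"
    proof (rule AE_zero_of_indefinite_integral_zero)
      show "set_integrable lebesgue {c..d} (\<lambda>x. g1 x - g2 x)" using loc by (rule set_integral_diff)
      fix x assume x: "x \<in> {c..d}"
      have "set_integrable lebesgue {c..x} g1" "set_integrable lebesgue {c..x} g2"
        using loc x by (auto intro: set_integrable_subset_lebesgue)
      then have "(LINT t:{c..x}|lebesgue. g1 t - g2 t) = (LINT t:{c..x}|lebesgue. g1 t) - (LINT t:{c..x}|lebesgue. g2 t)"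
        by (rule set_integral_diff)
      also have "\<dots> = 0"
        using has_weak_derivD[OF g1 cd uc x] has_weak_derivD[OF g2 cd uc x] by simp
      finally show "(LINT t:{c..x}|lebesgue. g1 t - g2 t) = 0" .
    qed
    then show ?thesis by simp
  qed
  have "AE x in lebesgue. \<forall>q\<in>{(c, d). c \<in> \<rat> \<and> d \<in> \<rat> \<and> {c..d} \<subseteq> interior (I e)}. x \<in> {fst q..snd q} \<longrightarrow> g1 x = g2 x"
  proof (rule AE_ball_countable')
    have "countable (\<rat> \<times> \<rat> :: (real \<times> real) set)" using countable_rat by blast
    then show "countable {(c :: real, d). c \<in> \<rat> \<and> d \<in> \<rat> \<and> {c..d} \<subseteq> interior (I e)}"
      by (rule countable_subset[rotated]) auto
  qed (use ae in auto)
  moreover have "AE x in lebesgue. x \<notin> frontier (I e)"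
  proof -
    have "frontier (I e) \<in> null_sets lebesgue"
      using negligible_convex_frontier[OF I_convex] by (simp add: negligible_iff_null_sets)
    then show ?thesis by (rule AE_not_in)
  qed
  ultimately show ?thesis
  proof eventually_elim
    case (elim x)
    show ?case
    proof
      assume "x \<in> I e"
      then have "x \<in> interior (I e)"
        using elim(2) closure_subset by (auto simp: frontier_def)
      then obtain r where r: "r > 0" "ball x r \<subseteq> interior (I e)"
        using open_interior open_contains_ball by blast
      obtain c where c: "c \<in> \<rat>" "x - r < c" "c < x" using Rats_dense_in_real[of "x - r" x] r by auto
      obtain d where d: "d \<in> \<rat>" "x < d" "d < x + r" using Rats_dense_in_real[of x "x + r"] r by auto
      have "{c..d} \<subseteq> ball x r" using c d by (auto simp: dist_real_def)
      then show "g1 x = g2 x" using elim(1) c d r by force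
    qed
  qed
qed

lemma mag_rep_weak_deriv:
  assumes u: "gcontinuous G u" and D: "mag_rep u D" and e: "e \<in> edges G"
  shows "has_weak_deriv (I e) (u e) (drift D u e)"
proof (rule has_weak_derivI)
  show "I e \<subseteq> {0..}" using I_nonneg by auto
  show "set_integrable lebesgue {0..x} (drift D u e)" if "x \<in> I e" for x
    using that e u D by (intro drift_integrable) (auto simp: mag_rep_def)
  show "u e x = u e 0 + (LINT t:{0..x}|lebesgue. drift D u e t)" if "x \<in> I e" for x
    using that e D unfolding mag_rep_def by blast
qed (rule I_down)

lemma mag_deriv_eq_ae:
  assumes u: "gcontinuous G u" and D: "mag_rep u D"
  shows "ae_eq G (mag_deriv G A u) D"
  unfolding ae_eq_def
proof
  fix e assume e: "e \<in> edges G"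
  have w: "has_weak_deriv (I e) (u e) (drift D u e)" by (rule mag_rep_weak_deriv[OF u D e])
  then have "has_weak_deriv (I e) (u e) (weak_deriv (I e) (u e))"
    unfolding weak_deriv_def by (rule someI[of "has_weak_deriv (I e) (u e)"])
  then have "AE x in lebesgue. x \<in> I e \<longrightarrow> weak_deriv (I e) (u e) x = drift D u e x"
    using w continuous_edge[OF u e] by (intro weak_deriv_unique)
  then show "AE x in lebesgue. x \<in> I e \<longrightarrow> mag_deriv G A u e x = D e x"
    by eventually_elim (simp add: mag_deriv_def drift_def field_simps)
qed

lemma L2_cong_ae:
  assumes "D \<in> L2 G" "ae_eq G D D'" shows "D' \<in> L2 G"
proof -
  have m: "gmeasurable G D'" unfolding gmeasurable_def set_borel_measurable_def
  proof
    fix e assume e: "e \<in> edges G"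
    show "(\<lambda>x. indicat_real (I e) x *\<^sub>R D' e x) \<in> borel_measurable lebesgue"
    proof (rule AE_completion_measurable)
      show "(\<lambda>x. indicat_real (I e) x *\<^sub>R D e x) \<in> borel_measurable lebesgue"
        using assms e by (auto simp: L2_def gmeasurable_def set_borel_measurable_def)
      have "AE x in lebesgue. x \<in> I e \<longrightarrow> D e x = D' e x" using assms e by (auto simp: ae_eq_def)
      then show "AE x in lebesgue. indicat_real (I e) x *\<^sub>R D e x = indicat_real (I e) x *\<^sub>R D' e x"
        by eventually_elim (auto simp: indicator_def)
    qed
  qed
  have "gintegrable G (\<lambda>e x. (cmod (D' e x))\<^sup>2)"
    unfolding gintegrable_iff
  proof
    fix e assume e: "e \<in> edges G"
    have "AE x in lebesgue_on (I e). (cmod (D e x))\<^sup>2 = (cmod (D' e x))\<^sup>2"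
      using assms(2) e unfolding ae_eq_iff by (auto elim: eventually_mono)
    moreover have "integrable (lebesgue_on (I e)) (\<lambda>x. (cmod (D e x))\<^sup>2)"
      using assms(1) e by (auto simp: L2_def gintegrable_iff)
    moreover have "(\<lambda>x. (cmod (D' e x))\<^sup>2) \<in> borel_measurable (lebesgue_on (I e))"
      using gmeasurable_cmod_sq[OF m] e by (auto simp: gmeasurable_iff)
    ultimately show "integrable (lebesgue_on (I e)) (\<lambda>x. (cmod (D' e x))\<^sup>2)"
      using integrable_cong_AE[of "\<lambda>x. (cmod (D e x))\<^sup>2" "lebesgue_on (I e)" "\<lambda>x. (cmod (D' e x))\<^sup>2"]
      by auto
  qed
  then show ?thesis using m by (simp add: L2_def)
qed

text \<open>
  In the interior of an edge this is the lemma of du Bois-Reymond. The derivative is integrable up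
  to the end points, since \<open>D\<^sub>A u\<close> and \<open>A\<close> are locally square-integrable there, so both sides extend
  continuously to the closed edge.
\<close>

lemma H1_mag_rep:
  assumes u: "u \<in> H1 G A V" shows "mag_rep u (mag_deriv G A u)"
  unfolding mag_rep_def
proof (intro conjI ballI)
  have uc: "gcontinuous G u" using u by (simp add: H1_def)
  show D: "mag_deriv G A u \<in> L2 G" using u by (simp add: H1_def)
  fix e x assume e: "e \<in> edges G" and x: "x \<in> I e"
  let ?g = "drift (mag_deriv G A u) u e"
  have g: "?g = weak_deriv (I e) (u e)" by (simp add: drift_def mag_deriv_def fun_eq_iff field_simps)
  have w: "has_weak_deriv (I e) (u e) ?g"
  proof -
    have "\<exists>g. has_weak_deriv (I e) (u e) g" using u e by (auto simp: H1_def)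
    from someI_ex[OF this] show ?thesis unfolding g weak_deriv_def .
  qed
  have int: "set_integrable lebesgue {0..x} ?g" by (rule drift_integrable[OF uc D e x])
  have cx: "continuous_on {0..x} (u e)"
    using continuous_edge[OF uc e] I_sub[OF x] continuous_on_subset by blast
  define k where "k y = (LINT t:{0..y}|lebesgue. ?g t)" for y
  have kc: "continuous_on {0..x} k" unfolding k_def by (rule indefinite_integral_continuous_on[OF int])
  have k0: "k 0 = 0" unfolding k_def by (rule set_integral_point)
  show "u e x = u e 0 + (LINT t:{0..x}|lebesgue. ?g t)"
  proof (cases "x = 0")
    case True
    then show ?thesis using k0 by (simp add: k_def)
  next
    case False
    then have x0: "0 < x" using I_nonneg[OF x] by simp
    define h where "h y = u e y - k y" for y
    have hc: "continuous_on {0..x} h" unfolding h_def by (intro continuous_intros cx kc)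
    have step: "h d = h c" if "0 < c" "c \<le> d" "d < x" for c d
    proof -
      have "{c..d} \<subseteq> interior (I e)" using that I_interior[OF x] by auto
      then have "u e d = u e c + (LINT t:{c..d}|lebesgue. ?g t)"
        using that by (intro has_weak_derivD[OF w] continuous_on_subset[OF cx]) auto
      moreover have "k d = k c + (LINT t:{c..d}|lebesgue. ?g t)"
        unfolding k_def using that
        by (intro set_integral_combine set_integrable_subset_lebesgue[OF int]) auto
      ultimately show ?thesis by (simp add: h_def)
    qed
    define m where "m = h (x / 2)"
    have inner: "h y = m" if "y \<in> {0<..<x}" for y
      unfolding m_def using step[of y "x / 2"] step[of "x / 2" y] that x0 by (cases "y \<le> x / 2") auto
    have "h y = m" if "y \<in> {0..x}" for y
      by (rule continuous_constant_on_closure[of "{0<..<x}" h]) (use that hc x0 inner in auto)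
    from this[of x] this[of 0] have "h x = h 0" using x0 by simp
    then show ?thesis using k0 by (simp add: h_def k_def algebra_simps)
  qed
qed

lemma H1_I:
  assumes "gcontinuous G u" "mag_rep u D" "gintegrable G (\<lambda>e x. V e x * (cmod (u e x))\<^sup>2)"
  shows "u \<in> H1 G A V"
proof -
  have "mag_deriv G A u \<in> L2 G"
  proof (rule L2_cong_ae)
    show "D \<in> L2 G" using assms(2) by (simp add: mag_rep_def)
    show "ae_eq G D (mag_deriv G A u)"
      using mag_deriv_eq_ae[OF assms(1,2)] unfolding ae_eq_def by (simp only: eq_commute)
  qed
  then show ?thesis
    using assms mag_rep_weak_deriv[OF assms(1,2)] by (auto simp: H1_def)
qed

end


section \<open>The energy form and bounded functions\<close>

context magnetic_graph
begin

lemma drift_lincomb: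
  "drift (\<lambda>e x. D e x + c * E e x) (\<lambda>e x. u e x + c * v e x) e t = drift D u e t + c * drift E v e t"
  by (simp add: drift_def algebra_simps)

lemma gcontinuous_lincomb:
  assumes u: "gcontinuous G u" and v: "gcontinuous G v"
  shows "gcontinuous G (\<lambda>e x. u e x + c * v e x)"
proof -
  obtain f where f: "\<forall>e\<in>edges G. u e 0 = f (tail G e)"
      "\<forall>e\<in>bounded_edges G. u e (real_of_ereal (len G e)) = f (head G e)"
    using u unfolding gcontinuous_def by blast
  obtain g where g: "\<forall>e\<in>edges G. v e 0 = g (tail G e)"
      "\<forall>e\<in>bounded_edges G. v e (real_of_ereal (len G e)) = g (head G e)"
    using v unfolding gcontinuous_def by blast
  show ?thesis unfolding gcontinuous_def
  proof (intro conjI ballI exI[of _ "\<lambda>x. f x + c * g x"])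
    show "continuous_on (I e) (\<lambda>x. u e x + c * v e x)" if "e \<in> edges G" for e
      using that u v by (intro continuous_intros continuous_edge)
  qed (use f g in auto)
qed

lemma mag_rep_lincomb:
  assumes "gcontinuous G u" "gcontinuous G v" "mag_rep u D" "mag_rep v E"
  shows "mag_rep (\<lambda>e x. u e x + c * v e x) (\<lambda>e x. D e x + c * E e x)"
proof -
  have L: "D \<in> L2 G" "E \<in> L2 G" using assms by (auto simp: mag_rep_def)
  have "u e x + c * v e x = u e 0 + c * v e 0 +
      (LINT t:{0..x}|lebesgue. drift (\<lambda>e x. D e x + c * E e x) (\<lambda>e x. u e x + c * v e x) e t)"
    if e: "e \<in> edges G" and x: "x \<in> I e" for e x
  proof -
    have i: "set_integrable lebesgue {0..x} (drift D u e)" "set_integrable lebesgue {0..x} (\<lambda>t. c * drift E v e t)"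
      using drift_integrable assms L e x by (auto intro!: set_integrable_mult_right)
    have ux: "u e x = u e 0 + (LINT t:{0..x}|lebesgue. drift D u e t)"
      and vx: "v e x = v e 0 + (LINT t:{0..x}|lebesgue. drift E v e t)"
      using assms(3,4) e x unfolding mag_rep_def by blast+
    show ?thesis
      unfolding drift_lincomb set_integral_add(2)[OF i] by (subst ux, subst vx) (simp add: algebra_simps)
  qed
  then show ?thesis unfolding mag_rep_def using L2_add[OF L(1) L2_scale[OF L(2)]] by blast
qed

text \<open>
  With the potential written as a product of square roots, the energy form becomes a sum of two
  inner products of \<open>L\<^sup>2\<close>.
\<close>

definition sqV where "sqV u = (\<lambda>e x. complex_of_real (sqrt (V e x)) * u e x)" for u :: "('e, complex) gfun"

lemma V_measurable: "gmeasurable G V"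
  using V_loc by (simp add: L1_loc_def)

lemma V_pos: "e \<in> edges G \<Longrightarrow> x \<in> I e \<Longrightarrow> 0 \<le> V e x"
  using V_ge_1 by (meson order_trans zero_le_one)

lemma cmod_sqV: "e \<in> edges G \<Longrightarrow> x \<in> I e \<Longrightarrow> (cmod (sqV u e x))\<^sup>2 = V e x * (cmod (u e x))\<^sup>2"
  using V_pos by (simp add: sqV_def norm_mult power_mult_distrib)

lemma sqV_L2_iff:
  assumes "gcontinuous G u"
  shows "sqV u \<in> L2 G \<longleftrightarrow> gintegrable G (\<lambda>e x. V e x * (cmod (u e x))\<^sup>2)"
proof -
  have "gmeasurable G (sqV u)"
    unfolding sqV_def
  proof (rule gmeasurable_mult)
    show "gmeasurable G (\<lambda>e x. complex_of_real (sqrt (V e x)))"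
      using V_measurable by (auto simp: gmeasurable_iff)
  qed (rule gcontinuous_gmeasurable[OF assms])
  moreover have "gintegrable G (\<lambda>e x. (cmod (sqV u e x))\<^sup>2) = gintegrable G (\<lambda>e x. V e x * (cmod (u e x))\<^sup>2)"
    by (rule gintegrable_cong) (rule cmod_sqV)
  ultimately show ?thesis by (simp add: L2_def)
qed

lemma H1_D:
  assumes "u \<in> H1 G A V"
  shows H1_cont: "gcontinuous G u" and H1_deriv: "mag_deriv G A u \<in> L2 G" and H1_sqV: "sqV u \<in> L2 G"
  using assms by (auto simp: H1_def sqV_L2_iff)

lemma H1_L2: assumes "u \<in> H1 G A V" shows "u \<in> L2 G"
proof -
  have m: "gmeasurable G u" by (rule gcontinuous_gmeasurable[OF H1_cont[OF assms]])
  have "gintegrable G (\<lambda>e x. (cmod (u e x))\<^sup>2)"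
  proof (rule gintegrable_bound)
    show "gintegrable G (\<lambda>e x. V e x * (cmod (u e x))\<^sup>2)" using assms by (simp add: H1_def)
    fix e x assume "e \<in> edges G" "x \<in> I e"
    then have "1 \<le> V e x" using V_ge_1 by blast
    then have "1 * (cmod (u e x))\<^sup>2 \<le> V e x * (cmod (u e x))\<^sup>2" by (intro mult_right_mono) auto
    then show "norm ((cmod (u e x))\<^sup>2) \<le> norm (V e x * (cmod (u e x))\<^sup>2)" by simp
  qed (rule gmeasurable_cmod_sq[OF m])
  then show ?thesis using m by (simp add: L2_def)
qed

lemma H1_lincomb:
  assumes u: "u \<in> H1 G A V" and v: "v \<in> H1 G A V"
  shows "(\<lambda>e x. u e x + c * v e x) \<in> H1 G A V"
    and "ae_eq G (mag_deriv G A (\<lambda>e x. u e x + c * v e x)) (\<lambda>e x. mag_deriv G A u e x + c * mag_deriv G A v e x)"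
proof -
  have c: "gcontinuous G (\<lambda>e x. u e x + c * v e x)"
    by (intro gcontinuous_lincomb H1_cont u v)
  have r: "mag_rep (\<lambda>e x. u e x + c * v e x) (\<lambda>e x. mag_deriv G A u e x + c * mag_deriv G A v e x)"
    by (intro mag_rep_lincomb H1_cont H1_mag_rep u v)
  have "sqV (\<lambda>e x. u e x + c * v e x) = (\<lambda>e x. sqV u e x + c * sqV v e x)"
    by (simp add: sqV_def fun_eq_iff algebra_simps)
  then have "sqV (\<lambda>e x. u e x + c * v e x) \<in> L2 G"
    using L2_add[OF H1_sqV[OF u] L2_scale[OF H1_sqV[OF v], of c]] by simp
  then show "(\<lambda>e x. u e x + c * v e x) \<in> H1 G A V"
    using c r by (intro H1_I) (auto simp: sqV_L2_iff)
  show "ae_eq G (mag_deriv G A (\<lambda>e x. u e x + c * v e x)) (\<lambda>e x. mag_deriv G A u e x + c * mag_deriv G A v e x)"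
    by (rule mag_deriv_eq_ae[OF c r])
qed

lemma mag_form_eq:
  assumes u: "u \<in> H1 G A V" and v: "v \<in> H1 G A V"
  shows "mag_form G A V u v = L2_inner G (mag_deriv G A u) (mag_deriv G A v) + L2_inner G (sqV u) (sqV v)"
proof -
  have "mag_form G A V u v = gintegral G (\<lambda>e x. mag_deriv G A u e x * cnj (mag_deriv G A v e x) + sqV u e x * cnj (sqV v e x))"
    unfolding mag_form_def
  proof (rule gintegral_cong)
    fix e x assume "e \<in> edges G" "x \<in> I e"
    then have "complex_of_real (sqrt (V e x)) * complex_of_real (sqrt (V e x)) = complex_of_real (V e x)"
      using V_pos by (simp flip: of_real_mult)
    then have "sqV u e x * cnj (sqV v e x) = complex_of_real (V e x) * u e x * cnj (v e x)"
      by (simp add: sqV_def mult.assoc mult.left_commute[of "u e x"])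
    then show "mag_deriv G A u e x * cnj (mag_deriv G A v e x) + complex_of_real (V e x) * u e x * cnj (v e x)
      = mag_deriv G A u e x * cnj (mag_deriv G A v e x) + sqV u e x * cnj (sqV v e x)" by simp
  qed
  then show ?thesis unfolding L2_inner_def
    using L2_product_integrable[OF H1_deriv[OF u] H1_deriv[OF v]] L2_product_integrable[OF H1_sqV[OF u] H1_sqV[OF v]]
    by (simp add: gintegral_add)
qed

lemma mag_form_cong_ae:
  assumes u: "u \<in> H1 G A V" and v: "v \<in> H1 G A V" and D: "ae_eq G (mag_deriv G A u) D" "gmeasurable G D"
  shows "mag_form G A V u v = L2_inner G D (mag_deriv G A v) + L2_inner G (sqV u) (sqV v)"
  unfolding mag_form_eq[OF u v]
  using H1_deriv[OF u] H1_deriv[OF v] D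
  by (subst L2_inner_cong_ae_left[of G _ D]) (auto simp: L2_def)

lemma mag_form_lincomb_left:
  assumes u: "u \<in> H1 G A V" and v: "v \<in> H1 G A V" and w: "w \<in> H1 G A V"
  shows "mag_form G A V (\<lambda>e x. u e x + c * v e x) w = mag_form G A V u w + c * mag_form G A V v w"
proof -
  have sq: "sqV (\<lambda>e x. u e x + c * v e x) = (\<lambda>e x. sqV u e x + c * sqV v e x)"
    by (simp add: sqV_def fun_eq_iff algebra_simps)
  have L: "(\<lambda>e x. mag_deriv G A u e x + c * mag_deriv G A v e x) \<in> L2 G"
    by (intro L2_add L2_scale H1_deriv u v)
  have "mag_form G A V (\<lambda>e x. u e x + c * v e x) w
    = L2_inner G (\<lambda>e x. mag_deriv G A u e x + c * mag_deriv G A v e x) (mag_deriv G A w)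
      + L2_inner G (\<lambda>e x. sqV u e x + c * sqV v e x) (sqV w)"
    using mag_form_cong_ae[OF H1_lincomb(1)[OF u v] w H1_lincomb(2)[OF u v], of c] L by (simp add: L2_def sq)
  also have "\<dots> = mag_form G A V u w + c * mag_form G A V v w"
    using H1_deriv u v w H1_sqV
    by (simp add: L2_inner_add_left L2_scale L2_inner_scale_left mag_form_eq algebra_simps)
  finally show ?thesis .
qed

lemma L2_inner_lincomb_left:
  assumes "f \<in> L2 G" "g \<in> L2 G" "h \<in> L2 G"
  shows "L2_inner G (\<lambda>e x. f e x + c * g e x) h = L2_inner G f h + c * L2_inner G g h"
  using assms by (simp add: L2_inner_add_left L2_scale L2_inner_scale_left)

lemma H1_zero: "(\<lambda>e x. 0) \<in> H1 G A V"
proof (rule H1_I)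
  show "gcontinuous G (\<lambda>e x. 0)" by (auto simp: gcontinuous_def)
  show "mag_rep (\<lambda>e x. 0) (\<lambda>e x. 0)"
    by (auto simp: mag_rep_def drift_def L2_def gmeasurable_const gintegrable_iff set_lebesgue_integral_def)
qed (simp add: gintegrable_iff)

text \<open>
  Values off the edges carry no information. Setting them to \<open>0\<close> makes the forms definite, and
  every element of \<open>H1 G A V\<close> has such a representative, with the same forms.
\<close>

definition trunc where "trunc u = (\<lambda>e x. if e \<in> edges G \<and> x \<in> I e then u e x else 0)" for u :: "('e, complex) gfun"

lemma trunc_eq [simp]: "e \<in> edges G \<Longrightarrow> x \<in> I e \<Longrightarrow> trunc u e x = u e x"
  by (simp add: trunc_def)

definition S where "S = {u \<in> H1 G A V. \<forall>e x. e \<notin> edges G \<or> x \<notin> I e \<longrightarrow> u e x = 0}"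

lemma S_H1: "u \<in> S \<Longrightarrow> u \<in> H1 G A V" by (simp add: S_def)

lemma S_eqI:
  assumes "u \<in> S" "v \<in> S" "\<And>e x. \<lbrakk>e \<in> edges G; x \<in> I e\<rbrakk> \<Longrightarrow> u e x = v e x"
  shows "u = v"
proof (intro ext)
  fix e x show "u e x = v e x"
  proof (cases "e \<in> edges G \<and> x \<in> I e")
    case False
    then show ?thesis using assms(1,2) by (simp add: S_def)
  qed (simp add: assms(3))
qed

lemma trunc_mag_rep:
  assumes "mag_rep u D" shows "mag_rep (trunc u) D"
proof -
  have "trunc u e x = trunc u e 0 + (LINT t:{0..x}|lebesgue. drift D (trunc u) e t)"
    if e: "e \<in> edges G" and x: "x \<in> I e" for e x
  proof -
    have "(LINT t:{0..x}|lebesgue. drift D (trunc u) e t) = (LINT t:{0..x}|lebesgue. drift D u e t)"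
      using e I_sub[OF x] by (intro set_lebesgue_integral_cong) (auto simp: drift_def)
    moreover have "u e x = u e 0 + (LINT t:{0..x}|lebesgue. drift D u e t)"
      using assms e x unfolding mag_rep_def by blast
    ultimately show ?thesis using e x by simp
  qed
  then show ?thesis using assms unfolding mag_rep_def by blast
qed

lemma bounded_edge_end:
  assumes "e \<in> bounded_edges G"
  shows "e \<in> edges G" "real_of_ereal (len G e) \<in> I e"
proof -
  show e: "e \<in> edges G" using assms by (simp add: bounded_edges_def)
  have "len G e < \<infinity>" using assms by (auto simp: bounded_edges_def)
  then show "real_of_ereal (len G e) \<in> I e" using len_pos[OF e] by (cases "len G e") (auto simp: edge_interval_def)
qed

lemma trunc_gcontinuous:
  assumes u: "gcontinuous G u" shows "gcontinuous G (trunc u)"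
proof -
  obtain f where f: "\<forall>e\<in>edges G. u e 0 = f (tail G e)"
      "\<forall>e\<in>bounded_edges G. u e (real_of_ereal (len G e)) = f (head G e)"
    using u unfolding gcontinuous_def by blast
  show ?thesis unfolding gcontinuous_def
  proof (intro conjI ballI exI[of _ f])
    fix e assume e: "e \<in> edges G"
    show "continuous_on (I e) (trunc u e)"
      by (rule continuous_on_eq[OF continuous_edge[OF u e]]) (simp add: e)
    show "trunc u e 0 = f (tail G e)" using e f by simp
  next
    fix e assume e: "e \<in> bounded_edges G"
    then show "trunc u e (real_of_ereal (len G e)) = f (head G e)" using bounded_edge_end[OF e] f by simp
  qed
qed

lemma trunc_S: assumes "u \<in> H1 G A V" shows "trunc u \<in> S"
proof -
  have "trunc u \<in> H1 G A V"
  proof (rule H1_I)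
    have "gintegrable G (\<lambda>e x. V e x * (cmod (trunc u e x))\<^sup>2) = gintegrable G (\<lambda>e x. V e x * (cmod (u e x))\<^sup>2)"
      by (rule gintegrable_cong) simp
    then show "gintegrable G (\<lambda>e x. V e x * (cmod (trunc u e x))\<^sup>2)" using assms by (simp add: H1_def)
  qed (use assms trunc_gcontinuous trunc_mag_rep H1_mag_rep H1_cont in auto)
  then show ?thesis by (auto simp: S_def trunc_def)
qed

lemma mag_form_trunc_left:
  assumes u: "u \<in> H1 G A V" and v: "v \<in> H1 G A V"
  shows "mag_form G A V (trunc u) v = mag_form G A V u v"
proof -
  have t: "trunc u \<in> H1 G A V" using trunc_S[OF u] S_H1 by blast
  have ae: "ae_eq G (mag_deriv G A (trunc u)) (mag_deriv G A u)"
    by (intro mag_deriv_eq_ae trunc_gcontinuous trunc_mag_rep H1_mag_rep H1_cont u)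
  have "mag_form G A V (trunc u) v = L2_inner G (mag_deriv G A u) (mag_deriv G A v) + L2_inner G (sqV (trunc u)) (sqV v)"
    using mag_form_cong_ae[OF t v ae] H1_deriv[OF u] by (simp add: L2_def)
  also have "L2_inner G (sqV (trunc u)) (sqV v) = L2_inner G (sqV u) (sqV v)"
    by (rule L2_inner_cong) (auto simp: sqV_def)
  finally show ?thesis by (simp add: mag_form_eq u v)
qed

lemma mag_form_trunc_right:
  assumes u: "u \<in> H1 G A V" and v: "v \<in> H1 G A V"
  shows "mag_form G A V u (trunc v) = mag_form G A V u v"
  using mag_form_trunc_left[OF v u] mag_form_cnj[of G A V u] by simp

definition a where "a u v = H1_inner G A V u v"
definition b where "b u v = Re (L2_inner G u v)"

lemma a_self:
  assumes u: "u \<in> H1 G A V"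
  shows "a u u = gintegral G (\<lambda>e x. (cmod (mag_deriv G A u e x))\<^sup>2) + gintegral G (\<lambda>e x. (cmod (sqV u e x))\<^sup>2)"
  by (simp add: a_def H1_inner_def mag_form_eq u L2_inner_self)

lemma H1_norm_sq:
  assumes u: "u \<in> H1 G A V" shows "(H1_norm G A V u)\<^sup>2 = a u u"
proof -
  have "gintegral G (\<lambda>e x. (cmod (mag_deriv G A u e x))\<^sup>2 + V e x * (cmod (u e x))\<^sup>2)
      = gintegral G (\<lambda>e x. (cmod (mag_deriv G A u e x))\<^sup>2) + gintegral G (\<lambda>e x. V e x * (cmod (u e x))\<^sup>2)"
    using u H1_deriv[OF u] by (intro gintegral_add) (auto simp: L2_def H1_def)
  also have "gintegral G (\<lambda>e x. V e x * (cmod (u e x))\<^sup>2) = gintegral G (\<lambda>e x. (cmod (sqV u e x))\<^sup>2)"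
    by (rule gintegral_cong) (simp add: cmod_sqV)
  finally have eq: "gintegral G (\<lambda>e x. (cmod (mag_deriv G A u e x))\<^sup>2 + V e x * (cmod (u e x))\<^sup>2) = a u u"
    by (simp add: a_self u)
  have "0 \<le> a u u" unfolding a_self[OF u] by (intro add_nonneg_nonneg gintegral_nonneg) auto
  then show ?thesis by (simp add: H1_norm_def eq)
qed

lemma b_self: "b u u = gintegral G (\<lambda>e x. (cmod (u e x))\<^sup>2)"
  by (simp add: b_def L2_inner_self)

lemma b_le_sqV: assumes u: "u \<in> H1 G A V" shows "b u u \<le> gintegral G (\<lambda>e x. (cmod (sqV u e x))\<^sup>2)"
  unfolding b_self
proof (rule gintegral_mono)
  show "gintegrable G (\<lambda>e x. (cmod (u e x))\<^sup>2)" using H1_L2[OF u] by (simp add: L2_def)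
  show "gintegrable G (\<lambda>e x. (cmod (sqV u e x))\<^sup>2)" using H1_sqV[OF u] by (simp add: L2_def)
  fix e x assume ex: "e \<in> edges G" "x \<in> I e"
  then have "1 \<le> V e x" using V_ge_1 by blast
  then have "1 * (cmod (u e x))\<^sup>2 \<le> V e x * (cmod (u e x))\<^sup>2" by (intro mult_right_mono) auto
  then show "(cmod (u e x))\<^sup>2 \<le> (cmod (sqV u e x))\<^sup>2" using ex by (simp add: cmod_sqV)
qed

lemma b_le_a: assumes u: "u \<in> H1 G A V" shows "b u u \<le> a u u"
proof -
  have "gintegral G (\<lambda>e x. (cmod (sqV u e x))\<^sup>2) \<le> a u u"
    unfolding a_self[OF u] by (simp add: gintegral_nonneg)
  then show ?thesis using b_le_sqV[OF u] by linarith
qed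

lemma plus_lincomb: "u + v = (\<lambda>e x. u e x + 1 * v e x)" for u v :: "('e, complex) gfun"
  by (simp add: fun_eq_iff)

lemma scaleR_lincomb: "c *\<^sub>R u = (\<lambda>e x. u e x + of_real (c - 1) * u e x)" for u :: "('e, complex) gfun"
  by (simp add: fun_eq_iff scaleR_conv_of_real algebra_simps)

lemma S_subspace: "subspace S"
  unfolding subspace_def
proof (intro conjI ballI allI)
  show "0 \<in> S" using H1_zero by (simp add: S_def zero_fun_def)
  fix x y and c :: real assume x: "x \<in> S"
  have "c *\<^sub>R x \<in> H1 G A V" unfolding scaleR_lincomb by (intro H1_lincomb S_H1 x)
  then show "c *\<^sub>R x \<in> S" using x by (auto simp: S_def)
  assume y: "y \<in> S"
  have "x + y \<in> H1 G A V" unfolding plus_lincomb by (intro H1_lincomb S_H1 x y)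
  then show "x + y \<in> S" using x y by (auto simp: S_def)
qed

sublocale af: semi_inner S a
proof
  fix x y z and c :: real
  assume x: "x \<in> S" and z: "z \<in> S"
  show "a (c *\<^sub>R x) z = c * a x z"
    unfolding scaleR_lincomb a_def H1_inner_def
    by (simp only: mag_form_lincomb_left S_H1 x z) (simp add: algebra_simps)
  show "a x z = a z x"
    unfolding a_def H1_inner_def by (subst mag_form_cnj) simp
  show "0 \<le> a x x"
    unfolding a_self[OF S_H1[OF x]] by (intro add_nonneg_nonneg gintegral_nonneg) auto
  assume y: "y \<in> S"
  show "a (x + y) z = a x z + a y z"
    unfolding plus_lincomb a_def H1_inner_def
    by (simp add: mag_form_lincomb_left[where c = 1, simplified] S_H1 x y z)
qed (rule S_subspace)

sublocale bf: semi_inner S b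
proof
  fix x y z and c :: real
  assume x: "x \<in> S" and z: "z \<in> S"
  show "b (c *\<^sub>R x) z = c * b x z"
    unfolding scaleR_lincomb b_def
    by (simp only: L2_inner_lincomb_left H1_L2 S_H1 x z) (simp add: algebra_simps)
  show "b x z = b z x" unfolding b_def by (subst L2_inner_cnj) simp
  show "0 \<le> b x x" unfolding b_self by (intro gintegral_nonneg) auto
  assume y: "y \<in> S"
  show "b (x + y) z = b x z + b y z"
    unfolding plus_lincomb b_def
    by (simp add: L2_inner_lincomb_left[where c = 1, simplified] H1_L2 S_H1 x y z)
qed (rule S_subspace)

lemma mag_rep_segment:
  assumes u: "gcontinuous G u" and D: "mag_rep u D" and e: "e \<in> edges G" and x: "x \<in> I e" and y: "0 \<le> y" "y \<le> x"
  shows "u e x = u e y + (LINT t:{y..x}|lebesgue. drift D u e t)"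
proof -
  have yI: "y \<in> I e" using I_down[OF x y] .
  have "u e x = u e 0 + (LINT t:{0..x}|lebesgue. drift D u e t)"
    and "u e y = u e 0 + (LINT t:{0..y}|lebesgue. drift D u e t)"
    using D e x yI unfolding mag_rep_def by blast+
  moreover have "set_integrable lebesgue {0..x} (drift D u e)"
    using D by (intro drift_integrable u e x) (simp add: mag_rep_def)
  ultimately show ?thesis using set_integral_combine[of 0 x "drift D u e" y] y by simp
qed

lemma edge_energy_le:
  assumes u: "u \<in> H1 G A V" and e: "e \<in> edges G"
  shows "set_integrable lebesgue (I e) (\<lambda>t. (cmod (mag_deriv G A u e t))\<^sup>2 + (cmod (u e t))\<^sup>2)"
    and "(LINT t:I e|lebesgue. (cmod (mag_deriv G A u e t))\<^sup>2 + (cmod (u e t))\<^sup>2) \<le> a u u"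
proof -
  let ?f = "\<lambda>e t. (cmod (mag_deriv G A u e t))\<^sup>2 + (cmod (u e t))\<^sup>2"
  have int: "gintegrable G ?f"
    using H1_deriv[OF u] H1_L2[OF u] by (intro gintegrable_add) (auto simp: L2_def)
  then show "set_integrable lebesgue (I e) (?f e)" using e by (simp add: gintegrable_def)
  have "(LINT t:I e|lebesgue. ?f e t) \<le> gintegral G ?f"
    unfolding gintegral_def
    by (rule member_le_sum[OF e _ fin, of "\<lambda>e. LINT t:I e|lebesgue. ?f e t"])
       (auto simp: set_lebesgue_integral_def)
  also have "\<dots> = gintegral G (\<lambda>e x. (cmod (mag_deriv G A u e x))\<^sup>2) + b u u"
    unfolding b_self using H1_deriv[OF u] H1_L2[OF u] by (intro gintegral_add) (auto simp: L2_def)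
  also have "b u u \<le> gintegral G (\<lambda>e x. (cmod (sqV u e x))\<^sup>2)" by (rule b_le_sqV[OF u])
  finally show "(LINT t:I e|lebesgue. ?f e t) \<le> a u u" by (simp add: a_self[OF u])
qed

text \<open>
  The derivative of \<open>|u|\<^sup>2\<close> is \<open>2 Re (i D\<^sub>A u cnj u)\<close>: the real potential \<open>A\<close> contributes an imaginary term
  to \<open>u' cnj u\<close> and drops out. Hence the oscillation of \<open>|u|\<^sup>2\<close> along an edge is at most the energy, independently of \<open>A\<close>.
\<close>

lemma modulus_oscillation:
  assumes u: "u \<in> H1 G A V" and e: "e \<in> edges G" and x: "x \<in> I e" and y: "0 \<le> y" "y \<le> x"
  shows "\<bar>(cmod (u e x))\<^sup>2 - (cmod (u e y))\<^sup>2\<bar> \<le> a u u"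
proof -
  let ?D = "mag_deriv G A u" and ?M = "\<lambda>t. (cmod (mag_deriv G A u e t))\<^sup>2 + (cmod (u e t))\<^sup>2"
  let ?f = "drift ?D u e"
  have uc: "gcontinuous G u" and rep: "mag_rep u ?D" using u H1_cont H1_mag_rep by auto
  have sub: "{y..x} \<subseteq> I e" using I_sub[OF x] y by auto
  have f: "set_integrable lebesgue {y..x} ?f"
    by (rule set_integrable_subset_lebesgue[OF drift_integrable[OF uc H1_deriv[OF u] e x]]) (use y in auto)
  have f': "set_integrable lebesgue {y..x} (\<lambda>t. cnj (?f t))"
  proof -
    have "(\<lambda>t. indicator {y..x} t *\<^sub>R cnj (?f t)) = (\<lambda>t. cnj (indicator {y..x} t *\<^sub>R ?f t))" by auto
    then show ?thesis using f unfolding set_integrable_def by (simp only: complex_integrable_cnj)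
  qed
  have F: "u e z = u e y + (LINT t:{y..z}|lebesgue. ?f t)" if "z \<in> {y..x}" for z
    using that sub by (intro mag_rep_segment[OF uc rep e] y) auto
  have F': "cnj (u e z) = cnj (u e y) + (LINT t:{y..z}|lebesgue. cnj (?f t))" if "z \<in> {y..x}" for z
  proof -
    have "(LINT t:{y..z}|lebesgue. cnj (?f t)) = cnj (LINT t:{y..z}|lebesgue. ?f t)"
      unfolding set_lebesgue_integral_def by (subst Bochner_Integration.integral_cnj[symmetric]) simp
    then show ?thesis using arg_cong[OF F[OF that], of cnj] by simp
  qed
  let ?P = "\<lambda>t. ?f t * cnj (u e t) + u e t * cnj (?f t)"
  note P = indefinite_integral_product(1)[OF y(2) f f' F F']
    and E = indefinite_integral_product(2)[OF y(2) f f' F F']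
  have bound: "norm (?P t) \<le> ?M t" for t
  proof -
    have "?P t = complex_of_real (2 * Re (\<i> * (?D e t * cnj (u e t))))"
      by (simp add: drift_def complex_eq_iff algebra_simps)
    then have "norm (?P t) = 2 * \<bar>Re (\<i> * (?D e t * cnj (u e t)))\<bar>" by (simp only: norm_of_real)
    also have "\<dots> \<le> 2 * (cmod (?D e t) * cmod (u e t))"
      using abs_Re_le_cmod[of "\<i> * (?D e t * cnj (u e t))"] by (simp add: norm_mult)
    also have "\<dots> \<le> ?M t" using sum_squares_bound[of "cmod (?D e t)" "cmod (u e t)"] by simp
    finally show ?thesis .
  qed
  have Mint: "set_integrable lebesgue {y..x} ?M"
    by (rule set_integrable_subset[OF edge_energy_le(1)[OF u e]]) (use sub in auto)
  have "complex_of_real ((cmod (u e x))\<^sup>2 - (cmod (u e y))\<^sup>2) = (LINT t:{y..x}|lebesgue. ?P t)"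
    using E by (simp only: complex_norm_square of_real_diff)
  then have "\<bar>(cmod (u e x))\<^sup>2 - (cmod (u e y))\<^sup>2\<bar> = norm (LINT t:{y..x}|lebesgue. ?P t)"
    by (metis norm_of_real)
  also have "\<dots> \<le> (LINT t:{y..x}|lebesgue. ?M t)"
    unfolding set_lebesgue_integral_def
  proof (rule Bochner_Integration.integral_norm_bound_integral)
    show "integrable lebesgue (\<lambda>t. indicat_real {y..x} t *\<^sub>R ?P t)" using P by (simp add: set_integrable_def)
    show "integrable lebesgue (\<lambda>t. indicat_real {y..x} t *\<^sub>R ?M t)" using Mint by (simp add: set_integrable_def)
  qed (use bound in \<open>auto simp: indicator_def\<close>)
  also have "\<dots> \<le> (LINT t:I e|lebesgue. ?M t)"
    using sub by (intro set_integral_subset_le edge_energy_le(1)[OF u e]) auto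
  also have "\<dots> \<le> a u u" by (rule edge_energy_le(2)[OF u e])
  finally show ?thesis .
qed

text \<open>
  Average the bound of the oscillation over a segment of the edge, where the mean of \<open>|u|\<^sup>2\<close> is
  controlled by the energy because \<open>V \<ge> 1\<close>.
\<close>

lemma sup_bound_edge:
  assumes e: "e \<in> edges G"
  shows "\<exists>C\<ge>0. \<forall>u\<in>H1 G A V. \<forall>x\<in>I e. (cmod (u e x))\<^sup>2 \<le> C * a u u"
proof -
  obtain l where l: "0 < l" "l \<in> I e" using I_pos[OF e] by blast
  have "(cmod (u e x))\<^sup>2 \<le> (1 + 1 / l) * a u u" if u: "u \<in> H1 G A V" and x: "x \<in> I e" for u x
  proof -
    let ?M = "\<lambda>t. (cmod (mag_deriv G A u e t))\<^sup>2 + (cmod (u e t))\<^sup>2"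
    have le: "(cmod (u e x))\<^sup>2 \<le> ?M y + a u u" if y: "y \<in> {0..l}" for y
    proof -
      have yI: "y \<in> I e" using I_sub[OF l(2)] y by auto
      have "\<bar>(cmod (u e x))\<^sup>2 - (cmod (u e y))\<^sup>2\<bar> \<le> a u u"
        using modulus_oscillation[OF u e x, of y] modulus_oscillation[OF u e yI, of x] y I_nonneg[OF x]
        by (cases "y \<le> x") (auto simp: abs_minus_commute)
      moreover have "0 \<le> (cmod (mag_deriv G A u e y))\<^sup>2" by simp
      ultimately show ?thesis by linarith
    qed
    have Mint: "set_integrable lebesgue {0..l} ?M"
      by (rule set_integrable_subset[OF edge_energy_le(1)[OF u e]]) (use I_sub[OF l(2)] in auto)
    have const: "set_integrable lebesgue {0..l} (\<lambda>t. c)" "(LINT t:{0..l}|lebesgue. c) = l * c" for c :: real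
      using l by (auto intro!: continuous_set_integrable simp: set_lebesgue_integral_def)
    have "l * (cmod (u e x))\<^sup>2 = (LINT t:{0..l}|lebesgue. (cmod (u e x))\<^sup>2)" by (simp only: const)
    also have "\<dots> \<le> (LINT t:{0..l}|lebesgue. ?M t + a u u)"
      using le by (intro set_integral_mono const(1) set_integral_add(1)[OF Mint const(1)])
    also have "\<dots> = (LINT t:{0..l}|lebesgue. ?M t) + l * a u u"
      using set_integral_add(2)[OF Mint const(1)] by (simp only: const)
    also have "(LINT t:{0..l}|lebesgue. ?M t) \<le> (LINT t:I e|lebesgue. ?M t)"
      using I_sub[OF l(2)] by (intro set_integral_subset_le edge_energy_le(1)[OF u e]) auto
    also have "\<dots> \<le> a u u" by (rule edge_energy_le(2)[OF u e])
    finally have "l * (cmod (u e x))\<^sup>2 \<le> a u u + l * a u u" by simp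
    then show ?thesis using l(1) by (simp add: field_simps)
  qed
  then show ?thesis using l(1) by (intro exI[of _ "1 + 1 / l"]) auto
qed

lemma sup_bound:
  "\<exists>C\<ge>0. \<forall>u\<in>H1 G A V. \<forall>e\<in>edges G. \<forall>x\<in>I e. (cmod (u e x))\<^sup>2 \<le> C * a u u"
proof -
  obtain c where c: "\<And>e. e \<in> edges G \<Longrightarrow> c e \<ge> 0 \<and> (\<forall>u\<in>H1 G A V. \<forall>x\<in>I e. (cmod (u e x))\<^sup>2 \<le> c e * a u u)"
    using sup_bound_edge by metis
  show ?thesis
  proof (intro exI[of _ "sum c (edges G)"] conjI ballI)
    show "0 \<le> sum c (edges G)" using c by (intro sum_nonneg) auto
    fix u e x assume u: "u \<in> H1 G A V" and e: "e \<in> edges G" and x: "x \<in> I e"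
    have "(cmod (u e x))\<^sup>2 \<le> c e * a u u" using c u e x by blast
    also have "\<dots> \<le> sum c (edges G) * a u u"
    proof (rule mult_right_mono)
      show "c e \<le> sum c (edges G)" by (rule member_le_sum[OF e _ fin]) (use c in auto)
      show "0 \<le> a u u" unfolding a_self[OF u] by (intro add_nonneg_nonneg gintegral_nonneg) auto
    qed
    finally show "(cmod (u e x))\<^sup>2 \<le> sum c (edges G) * a u u" .
  qed
qed

end


section \<open>Completeness of the energy space\<close>

text \<open>
  On a bounded interval mean-square convergence implies convergence of integrals, because
  \<open>|d| \<le> \<delta> + |d|\<^sup>2 / \<delta>\<close> for every \<open>\<delta> > 0\<close>.
\<close>

lemma set_integral_tendsto_of_L2:
  fixes f :: "nat \<Rightarrow> real \<Rightarrow> complex"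
  assumes x: "0 \<le> x" and f: "\<And>n. set_integrable lebesgue {0..x} (f n)" and g: "set_integrable lebesgue {0..x} g"
    and sq: "\<And>n. set_integrable lebesgue {0..x} (\<lambda>t. (cmod (f n t - g t))\<^sup>2)"
    and lim: "(\<lambda>n. LINT t:{0..x}|lebesgue. (cmod (f n t - g t))\<^sup>2) \<longlonglongrightarrow> 0"
  shows "(\<lambda>n. LINT t:{0..x}|lebesgue. f n t) \<longlonglongrightarrow> (LINT t:{0..x}|lebesgue. g t)"
proof (rule LIMSEQ_I)
  fix \<epsilon> :: real assume \<epsilon>: "0 < \<epsilon>"
  define \<delta> where "\<delta> = \<epsilon> / (2 * (x + 1))"
  have \<delta>: "0 < \<delta>" "\<delta> * x < \<epsilon> / 2" using \<epsilon> x by (auto simp: \<delta>_def field_simps)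
  have "\<forall>\<^sub>F n in sequentially. (LINT t:{0..x}|lebesgue. (cmod (f n t - g t))\<^sup>2) < \<delta> * (\<epsilon> / 2)"
    by (rule order_tendstoD(2)[OF lim]) (use \<delta> \<epsilon> in simp)
  then obtain N where N: "\<And>n. n \<ge> N \<Longrightarrow> (LINT t:{0..x}|lebesgue. (cmod (f n t - g t))\<^sup>2) < \<delta> * (\<epsilon> / 2)"
    by (auto simp: eventually_sequentially)
  have "norm ((LINT t:{0..x}|lebesgue. f n t) - (LINT t:{0..x}|lebesgue. g t)) < \<epsilon>" if n: "n \<ge> N" for n
  proof -
    let ?q = "\<lambda>t. (cmod (f n t - g t))\<^sup>2"
    have d: "set_integrable lebesgue {0..x} (\<lambda>t. f n t - g t)" by (rule set_integral_diff(1)[OF f g])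
    have c: "set_integrable lebesgue {0..x} (\<lambda>t. \<delta>)" by (intro continuous_set_integrable continuous_intros)
    have s: "set_integrable lebesgue {0..x} (\<lambda>t. ?q t / \<delta>)" using sq[of n] by simp
    have "(LINT t:{0..x}|lebesgue. f n t) - (LINT t:{0..x}|lebesgue. g t) = (LINT t:{0..x}|lebesgue. f n t - g t)"
      by (rule set_integral_diff(2)[OF f g, symmetric])
    then have "norm ((LINT t:{0..x}|lebesgue. f n t) - (LINT t:{0..x}|lebesgue. g t)) = norm (LINT t:{0..x}|lebesgue. f n t - g t)"
      by simp
    also have "\<dots> \<le> (LINT t:{0..x}|lebesgue. \<delta> + ?q t / \<delta>)"
      unfolding set_lebesgue_integral_def
    proof (rule Bochner_Integration.integral_norm_bound_integral)
      show "integrable lebesgue (\<lambda>t. indicat_real {0..x} t *\<^sub>R (f n t - g t))" using d by (simp add: set_integrable_def)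
      show "integrable lebesgue (\<lambda>t. indicat_real {0..x} t *\<^sub>R (\<delta> + ?q t / \<delta>))"
        using set_integral_add(1)[OF c s] by (simp add: set_integrable_def)
      fix t
      have "cmod (f n t - g t) \<le> \<delta> + ?q t / \<delta>"
      proof -
        have "2 * \<delta> * cmod (f n t - g t) \<le> \<delta>\<^sup>2 + ?q t" using sum_squares_bound[of \<delta> "cmod (f n t - g t)"] by simp
        moreover have "0 \<le> \<delta> * cmod (f n t - g t)" using \<delta> by simp
        ultimately have "\<delta> * cmod (f n t - g t) \<le> \<delta>\<^sup>2 + ?q t" by linarith
        then show ?thesis using \<delta>(1) by (simp add: field_simps power2_eq_square)
      qed
      then show "norm (indicat_real {0..x} t *\<^sub>R (f n t - g t)) \<le> indicat_real {0..x} t *\<^sub>R (\<delta> + ?q t / \<delta>)"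
        by (simp add: indicator_def)
    qed
    also have "\<dots> = \<delta> * x + (LINT t:{0..x}|lebesgue. ?q t) / \<delta>"
      using x by (simp only: set_integral_add(2)[OF c s] set_integral_divide_zero) (simp add: set_lebesgue_integral_def)
    also have "\<dots> < \<epsilon> / 2 + \<epsilon> / 2"
      using N[OF n] \<delta> by (intro add_strict_mono) (auto simp: field_simps)
    finally show ?thesis by simp
  qed
  then show "\<exists>N. \<forall>n\<ge>N. norm ((LINT t:{0..x}|lebesgue. f n t) - (LINT t:{0..x}|lebesgue. g t)) < \<epsilon>" by blast
qed

context magnetic_graph
begin

lemma a_diff:
  assumes u: "u \<in> S" and v: "v \<in> S" and D: "mag_rep u D" and E: "mag_rep v E"
  shows "a (u - v) (u - v) = gintegral G (\<lambda>e x. (cmod (D e x - E e x))\<^sup>2)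
     + gintegral G (\<lambda>e x. (cmod (sqV u e x - sqV v e x))\<^sup>2)"
proof -
  have d: "u - v \<in> H1 G A V" by (rule S_H1[OF af.mem(3)[OF u v]])
  have uv: "u - v = (\<lambda>e x. u e x + (- 1) * v e x)" by (simp add: fun_eq_iff)
  have uc: "gcontinuous G u" and vc: "gcontinuous G v" using u v S_H1 H1_cont by auto
  have rep: "mag_rep (u - v) (\<lambda>e x. D e x + (- 1) * E e x)"
    unfolding uv by (rule mag_rep_lincomb[OF uc vc D E])
  have L: "(\<lambda>e x. D e x + (- 1) * E e x) \<in> L2 G" using rep by (simp add: mag_rep_def)
  have ae: "ae_eq G (mag_deriv G A (u - v)) (\<lambda>e x. D e x + (- 1) * E e x)"
    by (rule mag_deriv_eq_ae[OF H1_cont[OF d] rep])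
  have "gintegral G (\<lambda>e x. (cmod (mag_deriv G A (u - v) e x))\<^sup>2) = gintegral G (\<lambda>e x. (cmod (D e x - E e x))\<^sup>2)"
  proof (rule gintegral_cong_ae)
    show "gmeasurable G (\<lambda>e x. (cmod (mag_deriv G A (u - v) e x))\<^sup>2)"
      using H1_deriv[OF d] by (intro gmeasurable_cmod_sq) (simp add: L2_def)
    show "gmeasurable G (\<lambda>e x. (cmod (D e x - E e x))\<^sup>2)"
      using L by (intro gmeasurable_cmod_sq) (simp add: L2_def)
    show "ae_eq G (\<lambda>e x. (cmod (mag_deriv G A (u - v) e x))\<^sup>2) (\<lambda>e x. (cmod (D e x - E e x))\<^sup>2)"
      unfolding ae_eq_def
    proof
      fix e assume "e \<in> edges G"
      then have "AE x in lebesgue. x \<in> I e \<longrightarrow> mag_deriv G A (u - v) e x = D e x + (- 1) * E e x"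
        using ae by (simp add: ae_eq_def)
      then show "AE x in lebesgue. x \<in> I e \<longrightarrow> (cmod (mag_deriv G A (u - v) e x))\<^sup>2 = (cmod (D e x - E e x))\<^sup>2"
        by eventually_elim simp
    qed
  qed
  moreover have "sqV (u - v) = (\<lambda>e x. sqV u e x - sqV v e x)"
    by (simp add: sqV_def fun_eq_iff algebra_simps)
  ultimately show ?thesis by (simp add: a_self[OF d])
qed

lemma a_definite: assumes u: "u \<in> S" "a u u = 0" shows "u = 0"
proof (rule S_eqI)
  show "u \<in> S" "0 \<in> S" using u by auto
  fix e x assume ex: "e \<in> edges G" "x \<in> I e"
  obtain C where C: "0 \<le> C" "\<forall>u\<in>H1 G A V. \<forall>e\<in>edges G. \<forall>x\<in>I e. (cmod (u e x))\<^sup>2 \<le> C * a u u"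
    using sup_bound by blast
  have "(cmod (u e x))\<^sup>2 \<le> C * a u u" using C(2) S_H1[OF u(1)] ex by blast
  then show "u e x = 0 e x" using u(2) by simp
qed

lemma pointwise_of_uniform:
  fixes X :: "nat \<Rightarrow> ('e, complex) gfun"
  assumes unif: "\<And>\<epsilon>. \<epsilon> > 0 \<Longrightarrow> \<exists>N. \<forall>n\<ge>N. \<forall>e\<in>edges G. \<forall>x\<in>I e. cmod (X n e x - u e x) \<le> \<epsilon>"
    and e: "e \<in> edges G" and x: "x \<in> I e"
  shows "(\<lambda>n. X n e x) \<longlonglongrightarrow> u e x"
proof (rule LIMSEQ_I)
  fix \<epsilon> :: real assume "0 < \<epsilon>"
  then obtain N where "\<forall>n\<ge>N. \<forall>e\<in>edges G. \<forall>x\<in>I e. cmod (X n e x - u e x) \<le> \<epsilon> / 2"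
    using unif[of "\<epsilon> / 2"] by auto
  then show "\<exists>N. \<forall>n\<ge>N. norm (X n e x - u e x) < \<epsilon>"
    using e x \<open>0 < \<epsilon>\<close> by (intro exI[of _ N]) (force intro: le_less_trans[of _ "\<epsilon> / 2"])
qed

lemma gcontinuous_uniform_limit:
  fixes X :: "nat \<Rightarrow> ('e, complex) gfun"
  assumes X: "\<And>n. gcontinuous G (X n)"
    and unif: "\<And>\<epsilon>. \<epsilon> > 0 \<Longrightarrow> \<exists>N. \<forall>n\<ge>N. \<forall>e\<in>edges G. \<forall>x\<in>I e. cmod (X n e x - u e x) \<le> \<epsilon>"
  shows "gcontinuous G u"
proof -
  have lim: "(\<lambda>n. X n e x) \<longlonglongrightarrow> u e x" if "e \<in> edges G" "x \<in> I e" for e x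
    using unif that by (rule pointwise_of_uniform)
  have "\<exists>f. (\<forall>e\<in>edges G. X n e 0 = f (tail G e)) \<and>
       (\<forall>e\<in>bounded_edges G. X n e (real_of_ereal (len G e)) = f (head G e))" for n
    using X[of n] by (simp add: gcontinuous_def)
  then obtain f where f: "\<And>n e. e \<in> edges G \<Longrightarrow> X n e 0 = f n (tail G e)"
      "\<And>n e. e \<in> bounded_edges G \<Longrightarrow> X n e (real_of_ereal (len G e)) = f n (head G e)"
    by metis
  show ?thesis unfolding gcontinuous_def
  proof (intro conjI ballI exI[of _ "\<lambda>v. lim (\<lambda>n. f n v)"])
    fix e assume e: "e \<in> edges G"
    show "u e 0 = lim (\<lambda>n. f n (tail G e))"
      using limI[OF lim[OF e I_zero[OF e]]] f(1)[OF e] by simp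
    show "continuous_on (I e) (u e)"
    proof (rule uniform_limit_theorem)
      show "\<forall>\<^sub>F n in sequentially. continuous_on (I e) (X n e)"
        using X continuous_edge e by auto
      show "uniform_limit (I e) (\<lambda>n. X n e) (u e) sequentially"
      proof (rule uniform_limitI)
        fix \<epsilon> :: real assume "0 < \<epsilon>"
        then obtain N where "\<forall>n\<ge>N. \<forall>e\<in>edges G. \<forall>x\<in>I e. cmod (X n e x - u e x) \<le> \<epsilon> / 2"
          using unif[of "\<epsilon> / 2"] by auto
        then have "\<forall>n\<ge>N. \<forall>x\<in>I e. dist (X n e x) (u e x) < \<epsilon>"
          using e \<open>0 < \<epsilon>\<close> by (force simp: dist_norm intro: le_less_trans[of _ "\<epsilon> / 2"])
        then show "\<forall>\<^sub>F n in sequentially. \<forall>x\<in>I e. dist (X n e x) (u e x) < \<epsilon>"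
          by (auto simp: eventually_sequentially)
      qed
    qed simp
  next
    fix e assume e: "e \<in> bounded_edges G"
    show "u e (real_of_ereal (len G e)) = lim (\<lambda>n. f n (head G e))"
      using limI[OF lim[OF bounded_edge_end[OF e]]] f(2)[OF e] by simp
  qed
qed

text \<open>
  In the integral equation the terms \<open>D\<close> converge in mean square, and the terms \<open>A u\<close> because \<open>A\<close> is
  integrable on bounded intervals and \<open>u\<close> converges uniformly.
\<close>

lemma mag_rep_limit:
  fixes X :: "nat \<Rightarrow> ('e, complex) gfun"
  assumes rep: "\<And>n. mag_rep (X n) (E n)" and Xc: "\<And>n. gcontinuous G (X n)" and uc: "gcontinuous G u"
    and D: "D \<in> L2 G" and DL: "(\<lambda>n. gintegral G (\<lambda>e x. (cmod (E n e x - D e x))\<^sup>2)) \<longlonglongrightarrow> 0"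
    and unif: "\<And>\<epsilon>. \<epsilon> > 0 \<Longrightarrow> \<exists>N. \<forall>n\<ge>N. \<forall>e\<in>edges G. \<forall>x\<in>I e. cmod (X n e x - u e x) \<le> \<epsilon>"
  shows "mag_rep u D"
  unfolding mag_rep_def
proof (intro conjI ballI D)
  fix e x assume e: "e \<in> edges G" and x: "x \<in> I e"
  have E: "E n \<in> L2 G" for n using rep[of n] by (simp add: mag_rep_def)
  have x0: "0 \<le> x" by (rule I_nonneg[OF x])
  have lim: "(\<lambda>n. X n e y) \<longlonglongrightarrow> u e y" if "y \<in> I e" for y
    using unif e that by (rule pointwise_of_uniform)
  have diffL2: "(\<lambda>e x. E n e x - D e x) \<in> L2 G" for n by (rule L2_diff[OF E D])
  have sq: "set_integrable lebesgue (I e) (\<lambda>t. (cmod (E n e t - D e t))\<^sup>2)" for n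
    using diffL2[of n] e by (simp add: L2_def gintegrable_def)
  have sq': "set_integrable lebesgue {0..x} (\<lambda>t. (cmod (E n e t - D e t))\<^sup>2)" for n
    by (rule set_integrable_subset[OF sq]) (use I_sub[OF x] in auto)
  have L1: "(\<lambda>n. LINT t:{0..x}|lebesgue. E n e t) \<longlonglongrightarrow> (LINT t:{0..x}|lebesgue. D e t)"
  proof (rule set_integral_tendsto_of_L2[OF x0])
    show "set_integrable lebesgue {0..x} (E n e)" for n by (rule L2_integrable[OF E e x])
    show "set_integrable lebesgue {0..x} (D e)" by (rule L2_integrable[OF D e x])
    show "set_integrable lebesgue {0..x} (\<lambda>t. (cmod (E n e t - D e t))\<^sup>2)" for n by (rule sq')
    show "(\<lambda>n. LINT t:{0..x}|lebesgue. (cmod (E n e t - D e t))\<^sup>2) \<longlonglongrightarrow> 0"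
    proof (rule Lim_null_comparison[OF always_eventually DL], rule allI)
      fix n
      have "(LINT t:{0..x}|lebesgue. (cmod (E n e t - D e t))\<^sup>2) \<le> (LINT t:I e|lebesgue. (cmod (E n e t - D e t))\<^sup>2)"
        using I_sub[OF x] by (intro set_integral_subset_le sq) auto
      also have "\<dots> \<le> gintegral G (\<lambda>e x. (cmod (E n e x - D e x))\<^sup>2)"
        unfolding gintegral_def
        by (rule member_le_sum[OF e _ fin, of "\<lambda>e. LINT t:I e|lebesgue. (cmod (E n e t - D e t))\<^sup>2"])
           (auto simp: set_lebesgue_integral_def)
      finally have le: "(LINT t:{0..x}|lebesgue. (cmod (E n e t - D e t))\<^sup>2) \<le> gintegral G (\<lambda>e x. (cmod (E n e x - D e x))\<^sup>2)" .
      have "0 \<le> (LINT t:{0..x}|lebesgue. (cmod (E n e t - D e t))\<^sup>2)"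
        by (auto simp: set_lebesgue_integral_def)
      with le show "norm (LINT t:{0..x}|lebesgue. (cmod (E n e t - D e t))\<^sup>2) \<le> gintegral G (\<lambda>e x. (cmod (E n e x - D e x))\<^sup>2)"
        by simp
    qed
  qed
  have cX: "continuous_on {0..x} (X n e)" for n
    using continuous_edge[OF Xc e] I_sub[OF x] continuous_on_subset by blast
  have cu: "continuous_on {0..x} (u e)"
    using continuous_edge[OF uc e] I_sub[OF x] continuous_on_subset by blast
  have AX: "set_integrable lebesgue {0..x} (\<lambda>t. complex_of_real (A e t) * X n e t)" for n
    by (rule A_mult_integrable[OF cX e x])
  have Au: "set_integrable lebesgue {0..x} (\<lambda>t. complex_of_real (A e t) * u e t)"
    by (rule A_mult_integrable[OF cu e x])
  have absA: "set_integrable lebesgue {0..x} (\<lambda>t. \<bar>A e t\<bar>)"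
    using A_integrable[OF e x] by (rule set_integrable_abs)
  define c where "c = (LINT t:{0..x}|lebesgue. \<bar>A e t\<bar>)"
  have c0: "0 \<le> c" by (auto simp: c_def set_lebesgue_integral_def)
  have L2: "(\<lambda>n. LINT t:{0..x}|lebesgue. complex_of_real (A e t) * X n e t) \<longlonglongrightarrow> (LINT t:{0..x}|lebesgue. complex_of_real (A e t) * u e t)"
  proof (rule LIMSEQ_I)
    fix \<epsilon> :: real assume \<epsilon>: "0 < \<epsilon>"
    have "0 < \<epsilon> / (c + 1)" using \<epsilon> c0 by simp
    then obtain N where N: "\<forall>n\<ge>N. \<forall>e\<in>edges G. \<forall>x\<in>I e. cmod (X n e x - u e x) \<le> \<epsilon> / (c + 1)"
      using unif by blast
    have "norm ((LINT t:{0..x}|lebesgue. complex_of_real (A e t) * X n e t) - (LINT t:{0..x}|lebesgue. complex_of_real (A e t) * u e t)) < \<epsilon>"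
      if n: "n \<ge> N" for n
    proof -
      have "(LINT t:{0..x}|lebesgue. complex_of_real (A e t) * X n e t) - (LINT t:{0..x}|lebesgue. complex_of_real (A e t) * u e t)
        = (LINT t:{0..x}|lebesgue. complex_of_real (A e t) * X n e t - complex_of_real (A e t) * u e t)"
        by (rule set_integral_diff(2)[OF AX Au, symmetric])
      then have "norm ((LINT t:{0..x}|lebesgue. complex_of_real (A e t) * X n e t) - (LINT t:{0..x}|lebesgue. complex_of_real (A e t) * u e t))
        = norm (LINT t:{0..x}|lebesgue. complex_of_real (A e t) * X n e t - complex_of_real (A e t) * u e t)" by simp
      also have "\<dots> \<le> (LINT t:{0..x}|lebesgue. \<epsilon> / (c + 1) * \<bar>A e t\<bar>)"
        unfolding set_lebesgue_integral_def
      proof (rule Bochner_Integration.integral_norm_bound_integral)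
        show "integrable lebesgue (\<lambda>t. indicat_real {0..x} t *\<^sub>R (complex_of_real (A e t) * X n e t - complex_of_real (A e t) * u e t))"
          using set_integral_diff(1)[OF AX Au] by (simp add: set_integrable_def)
        show "integrable lebesgue (\<lambda>t. indicat_real {0..x} t *\<^sub>R (\<epsilon> / (c + 1) * \<bar>A e t\<bar>))"
          using set_integrable_mult_right[OF absA] by (simp add: set_integrable_def)
        fix t
        show "norm (indicat_real {0..x} t *\<^sub>R (complex_of_real (A e t) * X n e t - complex_of_real (A e t) * u e t))
           \<le> indicat_real {0..x} t *\<^sub>R (\<epsilon> / (c + 1) * \<bar>A e t\<bar>)"
        proof (cases "t \<in> {0..x}")
          case True
          then have "cmod (X n e t - u e t) \<le> \<epsilon> / (c + 1)" using N n e I_sub[OF x] by blast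
          then have "\<bar>A e t\<bar> * cmod (X n e t - u e t) \<le> \<bar>A e t\<bar> * (\<epsilon> / (c + 1))" by (intro mult_left_mono) auto
          moreover have "norm (complex_of_real (A e t) * X n e t - complex_of_real (A e t) * u e t) = \<bar>A e t\<bar> * cmod (X n e t - u e t)"
            by (simp add: norm_mult flip: right_diff_distrib)
          ultimately show ?thesis using True by (simp add: mult.commute)
        qed simp
      qed
      also have "\<dots> = \<epsilon> / (c + 1) * c" by (simp only: c_def set_integral_mult_right)
      also have "\<dots> < \<epsilon>" using \<epsilon> c0 by (simp add: field_simps)
      finally show ?thesis .
    qed
    then show "\<exists>N. \<forall>n\<ge>N. norm ((LINT t:{0..x}|lebesgue. complex_of_real (A e t) * X n e t) - (LINT t:{0..x}|lebesgue. complex_of_real (A e t) * u e t)) < \<epsilon>"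
      by blast
  qed
  have split: "(LINT t:{0..x}|lebesgue. drift F v e t) = \<i> * ((LINT t:{0..x}|lebesgue. F e t) + (LINT t:{0..x}|lebesgue. complex_of_real (A e t) * v e t))"
    if "set_integrable lebesgue {0..x} (F e)" "set_integrable lebesgue {0..x} (\<lambda>t. complex_of_real (A e t) * v e t)" for F v
    unfolding drift_def by (simp only: set_integral_mult_right set_integral_add(2)[OF that])
  have "(\<lambda>n. X n e 0 + \<i> * ((LINT t:{0..x}|lebesgue. E n e t) + (LINT t:{0..x}|lebesgue. complex_of_real (A e t) * X n e t)))
    \<longlonglongrightarrow> u e 0 + \<i> * ((LINT t:{0..x}|lebesgue. D e t) + (LINT t:{0..x}|lebesgue. complex_of_real (A e t) * u e t))"
    by (intro tendsto_intros L1 L2 lim I_zero e)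
  moreover have "X n e 0 + \<i> * ((LINT t:{0..x}|lebesgue. E n e t) + (LINT t:{0..x}|lebesgue. complex_of_real (A e t) * X n e t)) = X n e x" for n
  proof -
    have "X n e x = X n e 0 + (LINT t:{0..x}|lebesgue. drift (E n) (X n) e t)"
      using rep[of n] e x unfolding mag_rep_def by blast
    then show ?thesis using split[of "E n" "X n", OF L2_integrable[OF E e x] AX] by simp
  qed
  ultimately have "(\<lambda>n. X n e x) \<longlonglongrightarrow> u e 0 + (LINT t:{0..x}|lebesgue. drift D u e t)"
    using split[of D u, OF L2_integrable[OF D e x] Au] by simp
  then show "u e x = u e 0 + (LINT t:{0..x}|lebesgue. drift D u e t)"
    using lim[OF x] LIMSEQ_unique by blast
qed

text \<open>
  An energy-Cauchy sequence converges uniformly on the edges, its magnetic derivatives converge in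
  mean square, and the integral equation identifies the limit. The potential term converges by Fatou's
  lemma, since its pointwise limit is already known.
\<close>

lemma a_complete:
  assumes X: "af.Cauchy_seq X"
  shows "\<exists>u\<in>S. (\<lambda>n. af.nrm (X n - u)) \<longlonglongrightarrow> 0"
proof -
  have XS: "X n \<in> S" for n using X by (simp add: af.Cauchy_seq_def)
  have XH: "X n \<in> H1 G A V" for n using XS S_H1 by blast
  have Cq: "\<exists>N. \<forall>m\<ge>N. \<forall>n\<ge>N. a (X m - X n) (X m - X n) < \<epsilon>" if \<epsilon>: "0 < \<epsilon>" for \<epsilon>
  proof -
    obtain N where N: "\<forall>m\<ge>N. \<forall>n\<ge>N. af.nrm (X m - X n) < sqrt \<epsilon>"
      using X \<epsilon> unfolding af.Cauchy_seq_def by (meson real_sqrt_gt_zero)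
    then have "a (X m - X n) (X m - X n) < \<epsilon>" if "m \<ge> N" "n \<ge> N" for m n
      using that by (simp add: af.nrm_def)
    then show ?thesis by blast
  qed
  define E where "E n = mag_deriv G A (X n)" for n
  have rep: "mag_rep (X n) (E n)" for n unfolding E_def by (rule H1_mag_rep[OF XH])
  have EL: "E n \<in> L2 G" for n unfolding E_def by (rule H1_deriv[OF XH])
  have dec: "a (X m - X n) (X m - X n) = gintegral G (\<lambda>e x. (cmod (E m e x - E n e x))\<^sup>2)
     + gintegral G (\<lambda>e x. (cmod (sqV (X m) e x - sqV (X n) e x))\<^sup>2)" for m n
    by (rule a_diff[OF XS XS rep rep])
  have p1: "gintegral G (\<lambda>e x. (cmod (E m e x - E n e x))\<^sup>2) \<le> a (X m - X n) (X m - X n)" for m n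
    unfolding dec by (simp add: gintegral_nonneg)
  have p2: "gintegral G (\<lambda>e x. (cmod (sqV (X m) e x - sqV (X n) e x))\<^sup>2) \<le> a (X m - X n) (X m - X n)" for m n
    unfolding dec by (simp add: gintegral_nonneg)
  have C1: "\<exists>N. \<forall>m\<ge>N. \<forall>n\<ge>N. gintegral G (\<lambda>e x. (cmod (E m e x - E n e x))\<^sup>2) < \<epsilon>" if "0 < \<epsilon>" for \<epsilon>
    using Cq[OF that] p1 le_less_trans by blast
  have C2: "\<exists>N. \<forall>m\<ge>N. \<forall>n\<ge>N. gintegral G (\<lambda>e x. (cmod (sqV (X m) e x - sqV (X n) e x))\<^sup>2) < \<epsilon>" if "0 < \<epsilon>" for \<epsilon>
    using Cq[OF that] p2 le_less_trans by blast
  obtain D where D: "D \<in> L2 G" "(\<lambda>n. gintegral G (\<lambda>e x. (cmod (E n e x - D e x))\<^sup>2)) \<longlonglongrightarrow> 0"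
    using L2_complete(1)[OF fin EL C1] by blast
  obtain C where C: "0 \<le> C" "\<forall>u\<in>H1 G A V. \<forall>e\<in>edges G. \<forall>x\<in>I e. (cmod (u e x))\<^sup>2 \<le> C * a u u"
    using sup_bound by blast
  have sup: "\<exists>N. \<forall>m\<ge>N. \<forall>n\<ge>N. \<forall>e\<in>edges G. \<forall>x\<in>I e. cmod (X m e x - X n e x) \<le> \<epsilon>" if \<epsilon>: "0 < \<epsilon>" for \<epsilon>
  proof -
    have "0 < \<epsilon>\<^sup>2 / (C + 1)" using \<epsilon> C(1) by simp
    then obtain N where N: "\<And>m n. m \<ge> N \<Longrightarrow> n \<ge> N \<Longrightarrow> a (X m - X n) (X m - X n) < \<epsilon>\<^sup>2 / (C + 1)" using Cq by blast
    have "cmod (X m e x - X n e x) \<le> \<epsilon>" if mn: "m \<ge> N" "n \<ge> N" and e: "e \<in> edges G" and x: "x \<in> I e" for m n e x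
    proof (rule power2_le_imp_le)
      have "X m - X n \<in> H1 G A V" by (rule S_H1[OF af.mem(3)[OF XS XS]])
      then have "(cmod (X m e x - X n e x))\<^sup>2 \<le> C * a (X m - X n) (X m - X n)" using C(2)[rule_format, of "X m - X n" e x] e x by simp
      also have "\<dots> \<le> C * (\<epsilon>\<^sup>2 / (C + 1))" using N[OF mn] C(1) by (intro mult_left_mono) auto
      also have "\<dots> \<le> \<epsilon>\<^sup>2" using C(1) by (simp add: field_simps)
      finally show "(cmod (X m e x - X n e x))\<^sup>2 \<le> \<epsilon>\<^sup>2" .
    qed (use \<epsilon> in simp)
    then show ?thesis by blast
  qed
  define u where "u e x = (if e \<in> edges G \<and> x \<in> I e then lim (\<lambda>n. X n e x) else 0)" for e x
  have lim: "(\<lambda>n. X n e x) \<longlonglongrightarrow> u e x" if e: "e \<in> edges G" and x: "x \<in> I e" for e x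
  proof -
    have "Cauchy (\<lambda>n. X n e x)"
    proof (rule metric_CauchyI)
      fix \<epsilon> :: real assume "0 < \<epsilon>"
      then obtain N where "\<forall>m\<ge>N. \<forall>n\<ge>N. \<forall>e\<in>edges G. \<forall>x\<in>I e. cmod (X m e x - X n e x) \<le> \<epsilon> / 2"
        using sup[of "\<epsilon> / 2"] by auto
      then have "\<forall>m\<ge>N. \<forall>n\<ge>N. cmod (X m e x - X n e x) \<le> \<epsilon> / 2" using e x by blast
      moreover have "\<epsilon> / 2 < \<epsilon>" using \<open>0 < \<epsilon>\<close> by simp
      ultimately show "\<exists>N. \<forall>m\<ge>N. \<forall>n\<ge>N. dist (X m e x) (X n e x) < \<epsilon>"
        unfolding dist_norm using le_less_trans by blast
    qed
    then show ?thesis using e x by (simp add: u_def Cauchy_convergent_iff convergent_LIMSEQ_iff)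
  qed
  have unif: "\<exists>N. \<forall>n\<ge>N. \<forall>e\<in>edges G. \<forall>x\<in>I e. cmod (X n e x - u e x) \<le> \<epsilon>" if \<epsilon>: "0 < \<epsilon>" for \<epsilon>
  proof -
    obtain N where N: "\<And>m n e x. \<lbrakk>m \<ge> N; n \<ge> N; e \<in> edges G; x \<in> I e\<rbrakk> \<Longrightarrow> cmod (X m e x - X n e x) \<le> \<epsilon>"
      using sup[OF \<epsilon>] by blast
    have "cmod (X n e x - u e x) \<le> \<epsilon>" if n: "n \<ge> N" and e: "e \<in> edges G" and x: "x \<in> I e" for n e x
    proof (rule LIMSEQ_le_const2)
      show "(\<lambda>m. cmod (X n e x - X m e x)) \<longlonglongrightarrow> cmod (X n e x - u e x)"
        by (intro tendsto_intros lim e x)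
      show "\<exists>M. \<forall>m\<ge>M. cmod (X n e x - X m e x) \<le> \<epsilon>" using N[OF n _ e x] by blast
    qed
    then show ?thesis by blast
  qed
  have Xc: "gcontinuous G (X n)" for n by (rule H1_cont[OF XH])
  have uc: "gcontinuous G u" by (rule gcontinuous_uniform_limit[OF Xc unif])
  have urep: "mag_rep u D" by (rule mag_rep_limit[OF rep Xc uc D unif])
  have sqlim: "(\<lambda>n. sqV (X n) e x) \<longlonglongrightarrow> sqV u e x" if "e \<in> edges G" "x \<in> I e" for e x
    unfolding sqV_def by (intro tendsto_intros lim that)
  have V: "sqV u \<in> L2 G \<and> (\<lambda>n. gintegral G (\<lambda>e x. (cmod (sqV (X n) e x - sqV u e x))\<^sup>2)) \<longlonglongrightarrow> 0"
    by (rule L2_complete(2)[OF fin H1_sqV[OF XH] C2 sqlim])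
  have "u \<in> H1 G A V"
    using V by (intro H1_I[OF uc urep]) (simp add: sqV_L2_iff[OF uc])
  then have uS: "u \<in> S" by (simp add: S_def u_def)
  have "(\<lambda>n. a (X n - u) (X n - u)) \<longlonglongrightarrow> 0 + 0"
    unfolding a_diff[OF XS uS rep urep] using V by (intro tendsto_add D(2)) auto
  then have "(\<lambda>n. af.nrm (X n - u)) \<longlonglongrightarrow> sqrt 0"
    unfolding af.nrm_def by (intro tendsto_real_sqrt) simp
  then show ?thesis using uS by auto
qed

sublocale af: hilbert S a
  by standard (use a_definite a_complete in auto)

end


section \<open>A truncated power nonlinearity\<close>

text \<open>
  The density \<open>Gam (|u|\<^sup>2)\<close> agrees, up to a constant factor, with \<open>|u|\<^sup>p\<close> for \<open>p = 2 q + 2\<close> as long as \<open>|u| \<le> R\<close>, and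
  continues as a quadratic function of \<open>|u|\<close> beyond. Truncation makes the functional quadratically bounded for every
  \<open>p > 2\<close>, so that there is no critical exponent; \<open>R\<close> will be an a priori bound for the minimiser,
  on which the truncation has then no effect. As a function of \<open>|u|\<^sup>2\<close> the density has the
  nondecreasing bounded derivative \<open>gam\<close>.
\<close>

locale truncated_power =
  fixes R q :: real
  assumes R: "0 < R" and q: "0 < q"
begin

definition gam where "gam t = (min t (R\<^sup>2)) powr q"

definition Gam where "Gam t = integral {0..t} gam"

definition gmax where "gmax = R powr (2 * q)"

text \<open>
  An integer exponent above \<open>2 q\<close>, for use with Bernoulli's inequality.
\<close>

definition bern where "bern = nat \<lceil>max 1 (2 * q)\<rceil>"

lemma bern: "1 \<le> bern" "2 * q \<le> real bern"
  unfolding bern_def by linarith+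

lemma gmax_nonneg: "0 \<le> gmax"
  by (simp add: gmax_def)

lemma sq_powr: "0 \<le> x \<Longrightarrow> (x\<^sup>2) powr q = x powr (2 * q)"
  by (cases "x = 0") (simp_all add: powr_powr flip: powr_numeral)

lemma gam_sq: "0 \<le> x \<Longrightarrow> gam (x\<^sup>2) = (min x R) powr (2 * q)"
proof -
  assume x: "0 \<le> x"
  have "min (x\<^sup>2) (R\<^sup>2) = (min x R)\<^sup>2"
    using x R by (auto simp: min_def power_mono_iff)
  then show ?thesis using x R by (simp add: gam_def sq_powr)
qed

lemma gam_nonneg: "0 \<le> gam t"
  by (simp add: gam_def)

lemma gam_mono: "0 \<le> s \<Longrightarrow> s \<le> t \<Longrightarrow> gam s \<le> gam t"
  unfolding gam_def using q R by (intro powr_mono2) auto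

lemma gam_le: "0 \<le> t \<Longrightarrow> gam t \<le> gmax"
proof -
  assume t: "0 \<le> t"
  have "gam t \<le> (R\<^sup>2) powr q" unfolding gam_def using q R t by (intro powr_mono2) auto
  then show ?thesis using R by (simp add: gmax_def sq_powr)
qed

lemma gam_continuous: "continuous_on {0..} gam"
  unfolding gam_def using R q by (intro continuous_on_powr' continuous_intros) auto

lemma gam_integrable: "0 \<le> s \<Longrightarrow> gam integrable_on {s..t}"
  by (intro integrable_continuous_interval continuous_on_subset[OF gam_continuous]) auto

lemma Gam_diff: "0 \<le> s \<Longrightarrow> s \<le> t \<Longrightarrow> Gam t - Gam s = integral {s..t} gam"
  unfolding Gam_def using Henstock_Kurzweil_Integration.integral_combine[of 0 s t gam] gam_integrable[of 0 t] by simp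

lemma Gam_tangent: assumes "0 \<le> s" "0 \<le> t" shows "gam s * (t - s) \<le> Gam t - Gam s"
proof (cases "s \<le> t")
  case True
  have "integral {s..t} (\<lambda>_. gam s) \<le> integral {s..t} gam"
    using assms True by (intro integral_le gam_integrable gam_mono) auto
  then show ?thesis using Gam_diff[OF assms(1) True] True by (simp add: mult.commute)
next
  case False
  then have ts: "t \<le> s" by simp
  have "integral {t..s} gam \<le> integral {t..s} (\<lambda>_. gam s)"
    using assms ts by (intro integral_le gam_integrable gam_mono) auto
  then show ?thesis using Gam_diff[OF assms(2) ts] ts by (simp add: algebra_simps)
qed

lemma Gam_0: "Gam 0 = 0"
  by (simp add: Gam_def)

lemma Gam_le: "0 \<le> t \<Longrightarrow> Gam t \<le> gam t * t"
  using Gam_tangent[of t 0] by (simp add: Gam_0 algebra_simps)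

lemma Gam_nonneg: "0 \<le> t \<Longrightarrow> 0 \<le> Gam t"
  unfolding Gam_def by (intro integral_nonneg gam_integrable) (auto simp: gam_nonneg)

text \<open>
  \<open>Gam\<close> is convex and vanishes at \<open>0\<close>: combine the tangents at \<open>c * t\<close>, evaluated at \<open>t\<close> and at \<open>0\<close>.
\<close>

lemma Gam_scale: assumes "0 \<le> t" "0 \<le> c" "c \<le> 1" shows "Gam (c * t) \<le> c * Gam t"
proof -
  let ?s = "c * t"
  have "c * (gam ?s * (t - ?s)) \<le> c * (Gam t - Gam ?s)"
    using assms by (intro mult_left_mono Gam_tangent) auto
  moreover have "(1 - c) * (gam ?s * (0 - ?s)) \<le> (1 - c) * (Gam 0 - Gam ?s)"
    using assms by (intro mult_left_mono Gam_tangent) auto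
  moreover have "c * (gam ?s * (t - ?s)) + (1 - c) * (gam ?s * (0 - ?s)) = 0"
    by (simp add: algebra_simps)
  ultimately show ?thesis by (simp add: Gam_0 algebra_simps)
qed

text \<open>
  Equality would force \<open>gam\<close> to be constant on \<open>{0..t}\<close>, but it increases strictly up to \<open>R\<^sup>2\<close>. This is
  what makes the Lagrange multiplier strictly smaller than the minimum of the functional.
\<close>

lemma Gam_less: assumes "0 < t" "t \<le> R\<^sup>2" shows "Gam t < gam t * t"
proof -
  have "gam (t / 2) < gam t"
    unfolding gam_def using assms q by (intro powr_less_mono2) auto
  then have "gam (t / 2) * (t / 2) < gam t * (t / 2)" using assms by simp
  moreover have "Gam (t / 2) \<le> gam (t / 2) * (t / 2)" using assms by (intro Gam_le) auto
  moreover have "gam t * (t / 2 - t) \<le> Gam (t / 2) - Gam t" using assms by (intro Gam_tangent) auto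
  ultimately show ?thesis by (simp add: field_simps)
qed

lemma Gam_continuous: "continuous_on {0..} Gam"
proof (rule lipschitz_on_continuous_on)
  show "gmax-lipschitz_on {0..} Gam"
  proof (rule lipschitz_onI[OF _ gmax_nonneg])
    fix s t :: real assume st: "s \<in> {0..}" "t \<in> {0..}"
    have "gam s * (t - s) \<le> Gam t - Gam s" "gam t * (s - t) \<le> Gam s - Gam t"
      using st by (auto intro: Gam_tangent)
    moreover have "gam s * \<bar>t - s\<bar> \<le> gmax * \<bar>t - s\<bar>" "gam t * \<bar>t - s\<bar> \<le> gmax * \<bar>t - s\<bar>"
      using st by (auto intro!: mult_right_mono gam_le)
    moreover have "- (gam s * \<bar>t - s\<bar>) \<le> gam s * (t - s)" "- (gam t * \<bar>t - s\<bar>) \<le> gam t * (s - t)"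
      using mult_left_mono[of "- \<bar>t - s\<bar>" "t - s" "gam s"] mult_left_mono[of "- \<bar>t - s\<bar>" "s - t" "gam t"]
        gam_nonneg by auto
    ultimately show "dist (Gam s) (Gam t) \<le> gmax * dist s t"
      by (simp add: dist_real_def abs_le_iff abs_minus_commute)
  qed
qed

text \<open>
  After division by powers of \<open>y\<close> this is \<open>1 - \<theta> powr (2 * q) \<le> bern * (1 - \<theta>)\<close> for \<open>\<theta> = x / y\<close> in the unit interval,
  which follows from Bernoulli's inequality for the larger integer exponent \<open>bern\<close>.
\<close>

lemma powr_difference:
  assumes "0 \<le> x" "x \<le> y"
  shows "(y powr (2 * q) - x powr (2 * q)) * y \<le> real bern * y powr (2 * q) * (y - x)"
proof (cases "y = 0")
  case False
  then have y: "0 < y" using assms by simp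
  define \<theta> where "\<theta> = x / y"
  have \<theta>: "0 \<le> \<theta>" "\<theta> \<le> 1" "x = \<theta> * y" using assms y by (auto simp: \<theta>_def)
  have "1 - real bern * (1 - \<theta>) \<le> \<theta> ^ bern"
    using Bernoulli_inequality[of "\<theta> - 1" bern] \<theta> by (simp add: algebra_simps)
  also have "\<theta> ^ bern \<le> \<theta> powr (2 * q)"
  proof (cases "\<theta> = 0")
    case True
    then show ?thesis using bern(1) by (simp add: power_0_left)
  next
    case False
    then have "\<theta> ^ bern = \<theta> powr (real bern)" using \<theta> by (simp add: powr_realpow)
    also have "\<dots> \<le> \<theta> powr (2 * q)" using \<theta> bern(2) by (intro powr_mono') auto
    finally show ?thesis .
  qed
  finally have "1 - \<theta> powr (2 * q) \<le> real bern * (1 - \<theta>)" by simp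
  then have "y powr (2 * q) * (1 - \<theta> powr (2 * q)) * y \<le> y powr (2 * q) * (real bern * (1 - \<theta>)) * y"
    using y by (intro mult_right_mono mult_left_mono) auto
  moreover have "x powr (2 * q) = \<theta> powr (2 * q) * y powr (2 * q)"
    using \<theta> y by (simp add: powr_mult)
  ultimately show ?thesis using \<theta>(3) by (simp add: algebra_simps)
qed simp

text \<open>
  Up to constants this says that the vector field \<open>gam (|z|\<^sup>2) z\<close> is Lipschitz. For \<open>q < 1 / 2\<close> the function \<open>gam (x\<^sup>2)\<close> itself is not
  Lipschitz at \<open>0\<close>; the factor \<open>y\<close> compensates.
\<close>

lemma gam_Lipschitz:
  assumes x: "0 \<le> x" and y: "0 \<le> y"
  shows "\<bar>gam (x\<^sup>2) - gam (y\<^sup>2)\<bar> * y \<le> real bern * gmax * \<bar>x - y\<bar>"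
proof -
  define r where "r = 2 * q"
  define n where "n = real bern"
  have n1: "1 \<le> n" using bern(1) by (simp add: n_def)
  have pd: "(v powr r - u powr r) * v \<le> n * v powr r * (v - u)" if "0 \<le> u" "u \<le> v" for u v
    using powr_difference[OF that] by (simp add: r_def n_def)
  have le: "v powr r \<le> gmax" if "0 \<le> v" "v \<le> R" for v
    unfolding gmax_def r_def using that q by (intro powr_mono2) auto
  have mono: "u powr r \<le> v powr r" if "0 \<le> u" "u \<le> v" for u v
    unfolding r_def using that q by (intro powr_mono2) auto
  have gR: "gmax = R powr r" by (simp add: gmax_def r_def)
  have gx: "gam (x\<^sup>2) = (min x R) powr r" and gy: "gam (y\<^sup>2) = (min y R) powr r"
    using gam_sq x y by (auto simp: r_def)
  have bnd: "n * v powr r * d \<le> n * gmax * d" if "0 \<le> v" "v \<le> R" "0 \<le> d" for v d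
    using le[OF that(1,2)] n1 that(3) by (intro mult_right_mono mult_left_mono) auto
  have nd: "n * gmax * d \<le> n * gmax * d'" if "d \<le> d'" for d d'
    using n1 gmax_nonneg that by (intro mult_left_mono) auto
  have "\<bar>gam (x\<^sup>2) - gam (y\<^sup>2)\<bar> * y \<le> n * gmax * \<bar>x - y\<bar>"
  proof (cases "y \<le> x")
    case yx: True
    show ?thesis
    proof (cases "R \<le> y")
      case True
      then have "min x R = R" "min y R = R" using yx by auto
      then show ?thesis using n1 gmax_nonneg by (simp add: gx gy)
    next
      case False
      define \<alpha> where "\<alpha> = min x R"
      have \<alpha>: "y \<le> \<alpha>" "\<alpha> \<le> x" "\<alpha> \<le> R" using False yx by (auto simp: \<alpha>_def)
      have "\<bar>gam (x\<^sup>2) - gam (y\<^sup>2)\<bar> * y = (\<alpha> powr r - y powr r) * y"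
        using False mono[OF y \<alpha>(1)] by (simp add: gx gy \<alpha>_def min_def)
      also have "\<dots> \<le> (\<alpha> powr r - y powr r) * \<alpha>"
        using mono[OF y \<alpha>(1)] \<alpha> by (intro mult_left_mono) auto
      also have "\<dots> \<le> n * \<alpha> powr r * (\<alpha> - y)" by (rule pd[OF y \<alpha>(1)])
      also have "\<dots> \<le> n * gmax * (\<alpha> - y)" using y \<alpha> by (intro bnd) auto
      also have "\<dots> \<le> n * gmax * \<bar>x - y\<bar>" using \<alpha> by (intro nd) auto
      finally show ?thesis .
    qed
  next
    case False
    then have xy: "x < y" by simp
    show ?thesis
    proof (cases "R \<le> x")
      case True
      then have "min x R = R" "min y R = R" using xy by auto
      then show ?thesis using n1 gmax_nonneg by (simp add: gx gy)
    next
      case xR: False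
      show ?thesis
      proof (cases "y \<le> R")
        case True
        have "\<bar>gam (x\<^sup>2) - gam (y\<^sup>2)\<bar> * y = (y powr r - x powr r) * y"
          using True xR mono[OF x less_imp_le[OF xy]] by (simp add: gx gy min_def)
        also have "\<dots> \<le> n * y powr r * (y - x)" using xy x by (intro pd) auto
        also have "\<dots> \<le> n * gmax * (y - x)" using y True xy by (intro bnd) auto
        finally show ?thesis using xy by simp
      next
        case False
        have xr: "x powr r \<le> gmax" using x xR by (intro le) auto
        have "\<bar>gam (x\<^sup>2) - gam (y\<^sup>2)\<bar> * y = (gmax - x powr r) * y"
          using False xR xr by (simp add: gx gy gR min_def)
        also have "\<dots> = (R powr r - x powr r) * R + (gmax - x powr r) * (y - R)"
          by (simp add: gR algebra_simps)
        also have "\<dots> \<le> n * gmax * (R - x) + gmax * (y - R)"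
        proof (rule add_mono)
          show "(R powr r - x powr r) * R \<le> n * gmax * (R - x)" unfolding gR using x xR by (intro pd) auto
          show "(gmax - x powr r) * (y - R) \<le> gmax * (y - R)" using False by (intro mult_right_mono) auto
        qed
        also have "gmax * (y - R) \<le> n * gmax * (y - R)"
          using n1 gmax_nonneg False mult_right_mono[of 1 n gmax] by (intro mult_right_mono) auto
        also have "n * gmax * (R - x) + n * gmax * (y - R) = n * gmax * \<bar>x - y\<bar>"
          using xy by (simp add: algebra_simps)
        finally show ?thesis by simp
      qed
    qed
  qed
  then show ?thesis by (simp add: n_def)
qed

text \<open>
  The bound for the second-order remainder of \<open>Gam (|z|\<^sup>2)\<close> in \<open>Gam_upper\<close>.
\<close>

definition Clip where "Clip = gmax * (1 + 2 * real bern)"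

lemma Clip_nonneg: "0 \<le> Clip"
  using gmax_nonneg by (simp add: Clip_def)

lemma gmax_le_Clip: "gmax \<le> Clip"
  using gmax_nonneg mult_left_mono[of 1 "1 + 2 * real bern" gmax] by (simp add: Clip_def)

lemma cmod_add_sq: "(cmod (z + \<zeta>))\<^sup>2 = (cmod z)\<^sup>2 + 2 * Re (z * cnj \<zeta>) + (cmod \<zeta>)\<^sup>2"
  unfolding cmod_power2 by (simp add: power2_eq_square algebra_simps)

text \<open>
  The tangent inequality of the convex function \<open>Gam\<close>, with the nonnegative term
  \<open>gam (|z|\<^sup>2) |\<zeta>|\<^sup>2\<close> discarded.
\<close>

lemma Gam_lower:
  "Gam ((cmod z)\<^sup>2) + 2 * (gam ((cmod z)\<^sup>2) * Re (z * cnj \<zeta>)) \<le> Gam ((cmod (z + \<zeta>))\<^sup>2)"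
proof -
  have "gam ((cmod z)\<^sup>2) * ((cmod (z + \<zeta>))\<^sup>2 - (cmod z)\<^sup>2) \<le> Gam ((cmod (z + \<zeta>))\<^sup>2) - Gam ((cmod z)\<^sup>2)"
    by (rule Gam_tangent) auto
  moreover have "0 \<le> gam ((cmod z)\<^sup>2) * (cmod \<zeta>)\<^sup>2" using gam_nonneg by simp
  ultimately show ?thesis by (simp add: cmod_add_sq algebra_simps)
qed

text \<open>
  The tangent of \<open>Gam\<close> is taken at the end point \<open>|z + \<zeta>|\<^sup>2\<close>; exchanging \<open>gam\<close> there for \<open>gam\<close> at
  \<open>|z|\<^sup>2\<close> costs a quadratic error by \<open>gam_Lipschitz\<close>.
\<close>

lemma Gam_upper:
  "Gam ((cmod (z + \<zeta>))\<^sup>2) \<le> Gam ((cmod z)\<^sup>2) + 2 * (gam ((cmod z)\<^sup>2) * Re (z * cnj \<zeta>)) + Clip * (cmod \<zeta>)\<^sup>2"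
proof -
  define t s where "t = (cmod (z + \<zeta>))\<^sup>2" and "s = (cmod z)\<^sup>2"
  have "gam t * (s - t) \<le> Gam s - Gam t" by (rule Gam_tangent) (auto simp: t_def s_def)
  moreover have "t - s = 2 * Re (z * cnj \<zeta>) + (cmod \<zeta>)\<^sup>2" by (simp add: t_def s_def cmod_add_sq)
  ultimately have 1: "Gam t - Gam s \<le> gam t * (2 * Re (z * cnj \<zeta>) + (cmod \<zeta>)\<^sup>2)" by (simp add: algebra_simps)
  have "(gam t - gam s) * Re (z * cnj \<zeta>) \<le> \<bar>gam t - gam s\<bar> * \<bar>Re (z * cnj \<zeta>)\<bar>"
    by (metis abs_ge_self abs_mult)
  also have "\<dots> \<le> \<bar>gam t - gam s\<bar> * (cmod z * cmod \<zeta>)"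
    using abs_Re_le_cmod[of "z * cnj \<zeta>"] by (intro mult_left_mono) (auto simp: norm_mult)
  also have "\<dots> = (\<bar>gam t - gam s\<bar> * cmod z) * cmod \<zeta>" by simp
  also have "\<dots> \<le> (real bern * gmax * \<bar>cmod (z + \<zeta>) - cmod z\<bar>) * cmod \<zeta>"
    unfolding t_def s_def by (intro mult_right_mono gam_Lipschitz) auto
  also have "\<dots> \<le> (real bern * gmax * cmod \<zeta>) * cmod \<zeta>"
    using norm_triangle_ineq3[of "z + \<zeta>" z] gmax_nonneg by (intro mult_right_mono mult_left_mono) auto
  finally have 2: "(gam t - gam s) * Re (z * cnj \<zeta>) \<le> real bern * gmax * (cmod \<zeta>)\<^sup>2" by (simp add: power2_eq_square mult.assoc)
  have 3: "gam t * (cmod \<zeta>)\<^sup>2 \<le> gmax * (cmod \<zeta>)\<^sup>2" by (intro mult_right_mono gam_le) (auto simp: t_def)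
  have "gam t * (2 * Re (z * cnj \<zeta>) + (cmod \<zeta>)\<^sup>2)
     = 2 * (gam s * Re (z * cnj \<zeta>)) + 2 * ((gam t - gam s) * Re (z * cnj \<zeta>)) + gam t * (cmod \<zeta>)\<^sup>2"
    by (simp add: algebra_simps)
  moreover have "Clip * (cmod \<zeta>)\<^sup>2 = 2 * (real bern * gmax * (cmod \<zeta>)\<^sup>2) + gmax * (cmod \<zeta>)\<^sup>2"
    by (simp add: Clip_def algebra_simps)
  ultimately show ?thesis using 1 2 3 unfolding t_def[symmetric] s_def[symmetric] by linarith
qed

end

locale graph_nonlinearity = magnetic_graph G A V + truncated_power R q
  for G :: "('v, 'e) mgraph" and A V :: "'e \<Rightarrow> real \<Rightarrow> real" and R q :: real
begin

definition Psi where "Psi u = gintegral G (\<lambda>e x. Gam ((cmod (u e x))\<^sup>2))"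

definition force where "force u = (\<lambda>e x. complex_of_real (gam ((cmod (u e x))\<^sup>2)) * u e x)" for u :: "('e, complex) gfun"

definition psi where "psi u v = 2 * b (force u) v"

lemma continuous_gmeasurable:
  fixes f :: "('e, complex) gfun"
  assumes "\<And>e. e \<in> edges G \<Longrightarrow> continuous_on (I e) (f e)"
  shows "gmeasurable G f"
  unfolding gmeasurable_iff
  using assms by (auto intro!: continuous_imp_measurable_on_sets_lebesgue edge_interval_lebesgue)

lemma continuous_gmeasurable_real:
  fixes f :: "('e, real) gfun"
  assumes "\<And>e. e \<in> edges G \<Longrightarrow> continuous_on (I e) (f e)"
  shows "gmeasurable G f"
  unfolding gmeasurable_iff
  using assms by (auto intro!: continuous_imp_measurable_on_sets_lebesgue edge_interval_lebesgue)

lemma continuous_density: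
  assumes u: "gcontinuous G u" and e: "e \<in> edges G" and h: "continuous_on {0..} (h :: real \<Rightarrow> real)"
  shows "continuous_on (I e) (\<lambda>x. h ((cmod (u e x))\<^sup>2))"
  by (rule continuous_on_compose2[OF h]) (auto intro!: continuous_intros continuous_edge u e)

lemma force_L2: assumes u: "u \<in> H1 G A V" shows "force u \<in> L2 G"
proof -
  have m: "gmeasurable G (force u)"
    unfolding force_def
    by (intro continuous_gmeasurable continuous_intros continuous_density[OF H1_cont[OF u] _ gam_continuous]
        continuous_edge[OF H1_cont[OF u]])
  have "gintegrable G (\<lambda>e x. (cmod (force u e x))\<^sup>2)"
  proof (rule gintegrable_bound)
    show "gintegrable G (\<lambda>e x. gmax\<^sup>2 * (cmod (u e x))\<^sup>2)"
      using H1_L2[OF u] by (intro gintegrable_mult) (simp add: L2_def)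
    fix e x
    have "cmod (force u e x) \<le> gmax * cmod (u e x)"
      using gam_le[of "(cmod (u e x))\<^sup>2"] gam_nonneg by (auto simp: force_def norm_mult intro!: mult_right_mono)
    then have "(cmod (force u e x))\<^sup>2 \<le> (gmax * cmod (u e x))\<^sup>2" by (intro power_mono) auto
    then show "norm ((cmod (force u e x))\<^sup>2) \<le> norm (gmax\<^sup>2 * (cmod (u e x))\<^sup>2)" by (simp add: power_mult_distrib)
  qed (rule gmeasurable_cmod_sq[OF m])
  then show ?thesis using m by (simp add: L2_def)
qed

lemma Gam_gintegrable: assumes u: "u \<in> H1 G A V" shows "gintegrable G (\<lambda>e x. Gam ((cmod (u e x))\<^sup>2))"
proof (rule gintegrable_bound)
  show "gintegrable G (\<lambda>e x. gmax * (cmod (u e x))\<^sup>2)"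
    using H1_L2[OF u] by (intro gintegrable_mult) (simp add: L2_def)
  show "gmeasurable G (\<lambda>e x. Gam ((cmod (u e x))\<^sup>2))"
    by (intro continuous_gmeasurable_real continuous_density[OF H1_cont[OF u] _ Gam_continuous])
  fix e x
  have "Gam ((cmod (u e x))\<^sup>2) \<le> gam ((cmod (u e x))\<^sup>2) * (cmod (u e x))\<^sup>2" by (rule Gam_le) simp
  also have "\<dots> \<le> gmax * (cmod (u e x))\<^sup>2" by (intro mult_right_mono gam_le) auto
  finally show "norm (Gam ((cmod (u e x))\<^sup>2)) \<le> norm (gmax * (cmod (u e x))\<^sup>2)"
    using Gam_nonneg[of "(cmod (u e x))\<^sup>2"] gmax_nonneg by simp
qed

lemma density_integrable:
  assumes u: "u \<in> H1 G A V" and v: "v \<in> H1 G A V"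
  shows "gintegrable G (\<lambda>e x. 2 * (gam ((cmod (u e x))\<^sup>2) * Re (u e x * cnj (v e x))))"
    and "psi u v = gintegral G (\<lambda>e x. 2 * (gam ((cmod (u e x))\<^sup>2) * Re (u e x * cnj (v e x))))"
proof -
  have i: "gintegrable G (\<lambda>e x. force u e x * cnj (v e x))"
    by (rule L2_product_integrable[OF force_L2[OF u] H1_L2[OF v]])
  have eq: "gam ((cmod (u e x))\<^sup>2) * Re (u e x * cnj (v e x)) = Re (force u e x * cnj (v e x))" for e x
    by (simp add: force_def algebra_simps)
  show "gintegrable G (\<lambda>e x. 2 * (gam ((cmod (u e x))\<^sup>2) * Re (u e x * cnj (v e x))))"
    unfolding eq by (intro gintegrable_mult gintegrable_Re i)
  show "psi u v = gintegral G (\<lambda>e x. 2 * (gam ((cmod (u e x))\<^sup>2) * Re (u e x * cnj (v e x))))"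
    unfolding eq gintegral_mult psi_def b_def L2_inner_def using gintegral_Re[OF i] by simp
qed

lemma psi_add:
  assumes u: "u \<in> S" and x: "x \<in> S" and y: "y \<in> S" shows "psi u (x + y) = psi u x + psi u y"
proof -
  have f: "force u \<in> L2 G" by (rule force_L2[OF S_H1[OF u]])
  have "L2_inner G (x + y) (force u) = L2_inner G x (force u) + 1 * L2_inner G y (force u)"
    unfolding plus_lincomb by (rule L2_inner_lincomb_left[OF H1_L2[OF S_H1[OF x]] H1_L2[OF S_H1[OF y]] f])
  moreover have "b (force u) z = Re (L2_inner G z (force u))" for z
    unfolding b_def by (subst L2_inner_cnj) simp
  ultimately show ?thesis by (simp add: psi_def)
qed

lemma psi_scale:
  assumes u: "u \<in> S" and x: "x \<in> S" shows "psi u (t *\<^sub>R x) = t * psi u x"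
proof -
  have "t *\<^sub>R x = (\<lambda>e y. complex_of_real t * x e y)" by (simp add: fun_eq_iff scaleR_conv_of_real)
  then show ?thesis by (simp add: psi_def b_def L2_inner_scale_right)
qed

lemma Psi_lower: assumes u: "u \<in> S" and x: "x \<in> S" shows "Psi u + psi u x \<le> Psi (u + x)"
proof -
  have H: "u \<in> H1 G A V" "x \<in> H1 G A V" "u + x \<in> H1 G A V" using u x S_H1 af.mem(2) by auto
  have "Psi u + psi u x = gintegral G (\<lambda>e y. Gam ((cmod (u e y))\<^sup>2) + 2 * (gam ((cmod (u e y))\<^sup>2) * Re (u e y * cnj (x e y))))"
    unfolding Psi_def density_integrable(2)[OF H(1,2)]
    by (rule gintegral_add[symmetric]) (intro Gam_gintegrable density_integrable H)+
  also have "\<dots> \<le> Psi (u + x)"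
    unfolding Psi_def
  proof (rule gintegral_mono)
    show "gintegrable G (\<lambda>e y. Gam ((cmod (u e y))\<^sup>2) + 2 * (gam ((cmod (u e y))\<^sup>2) * Re (u e y * cnj (x e y))))"
      by (intro gintegrable_add Gam_gintegrable density_integrable H)
    show "gintegrable G (\<lambda>e y. Gam ((cmod ((u + x) e y))\<^sup>2))" by (rule Gam_gintegrable[OF H(3)])
  qed (use Gam_lower in simp)
  finally show ?thesis .
qed

lemma Psi_upper: assumes u: "u \<in> S" and x: "x \<in> S" shows "Psi (u + x) \<le> Psi u + psi u x + Clip * b x x"
proof -
  have H: "u \<in> H1 G A V" "x \<in> H1 G A V" "u + x \<in> H1 G A V" using u x S_H1 af.mem(2) by auto
  let ?f = "\<lambda>e y. Gam ((cmod (u e y))\<^sup>2) + 2 * (gam ((cmod (u e y))\<^sup>2) * Re (u e y * cnj (x e y)))"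
  have i1: "gintegrable G ?f" by (intro gintegrable_add Gam_gintegrable density_integrable H)
  have i2: "gintegrable G (\<lambda>e y. Clip * (cmod (x e y))\<^sup>2)"
    using H1_L2[OF H(2)] by (intro gintegrable_mult) (simp add: L2_def)
  have "Psi (u + x) \<le> gintegral G (\<lambda>e y. ?f e y + Clip * (cmod (x e y))\<^sup>2)"
    unfolding Psi_def
  proof (rule gintegral_mono)
    show "gintegrable G (\<lambda>e y. ?f e y + Clip * (cmod (x e y))\<^sup>2)" by (rule gintegrable_add[OF i1 i2])
    show "gintegrable G (\<lambda>e y. Gam ((cmod ((u + x) e y))\<^sup>2))" by (rule Gam_gintegrable[OF H(3)])
  qed (use Gam_upper in simp)
  also have "\<dots> = gintegral G ?f + Clip * b x x"
    unfolding gintegral_add[OF i1 i2] gintegral_mult b_self ..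
  also have "gintegral G ?f = Psi u + psi u x"
    unfolding Psi_def density_integrable(2)[OF H(1,2)]
    by (rule gintegral_add) (intro Gam_gintegrable density_integrable H)+
  finally show ?thesis .
qed

lemma Psi_nonneg: "0 \<le> Psi u"
  unfolding Psi_def by (intro gintegral_nonneg Gam_nonneg) simp

lemma Psi_le: assumes u: "u \<in> S" shows "Psi u \<le> Clip * b u u"
proof -
  have H: "u \<in> H1 G A V" using u S_H1 by blast
  have "Psi u \<le> gintegral G (\<lambda>e x. Clip * (cmod (u e x))\<^sup>2)"
    unfolding Psi_def
  proof (rule gintegral_mono)
    show "gintegrable G (\<lambda>e x. Gam ((cmod (u e x))\<^sup>2))" by (rule Gam_gintegrable[OF H])
    show "gintegrable G (\<lambda>e x. Clip * (cmod (u e x))\<^sup>2)"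
      using H1_L2[OF H] by (intro gintegrable_mult) (simp add: L2_def)
    fix e x
    have "Gam ((cmod (u e x))\<^sup>2) \<le> gam ((cmod (u e x))\<^sup>2) * (cmod (u e x))\<^sup>2" by (rule Gam_le) simp
    also have "\<dots> \<le> Clip * (cmod (u e x))\<^sup>2"
      using gam_le[of "(cmod (u e x))\<^sup>2"] gmax_le_Clip by (intro mult_right_mono) auto
    finally show "Gam ((cmod (u e x))\<^sup>2) \<le> Clip * (cmod (u e x))\<^sup>2" .
  qed
  then show ?thesis by (simp add: gintegral_mult b_self)
qed

lemma Psi_scale: assumes u: "u \<in> S" and t: "0 \<le> t" "t \<le> 1" shows "Psi (t *\<^sub>R u) \<le> t\<^sup>2 * Psi u"
proof -
  have H: "u \<in> H1 G A V" "t *\<^sub>R u \<in> H1 G A V" using u S_H1 af.mem(4) by auto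
  have "Psi (t *\<^sub>R u) \<le> gintegral G (\<lambda>e x. t\<^sup>2 * Gam ((cmod (u e x))\<^sup>2))"
    unfolding Psi_def
  proof (rule gintegral_mono)
    show "gintegrable G (\<lambda>e x. Gam ((cmod ((t *\<^sub>R u) e x))\<^sup>2))" by (rule Gam_gintegrable[OF H(2)])
    show "gintegrable G (\<lambda>e x. t\<^sup>2 * Gam ((cmod (u e x))\<^sup>2))" by (intro gintegrable_mult Gam_gintegrable H)
    fix e x
    have "Gam (t\<^sup>2 * (cmod (u e x))\<^sup>2) \<le> t\<^sup>2 * Gam ((cmod (u e x))\<^sup>2)"
      using t by (intro Gam_scale) (auto simp: power_le_one)
    then show "Gam ((cmod ((t *\<^sub>R u) e x))\<^sup>2) \<le> t\<^sup>2 * Gam ((cmod (u e x))\<^sup>2)"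
      by (simp add: power_mult_distrib)
  qed
  then show ?thesis by (simp add: gintegral_mult Psi_def)
qed

lemma psi_self:
  assumes u: "u \<in> S" shows "psi u u = gintegral G (\<lambda>e x. 2 * (gam ((cmod (u e x))\<^sup>2) * (cmod (u e x))\<^sup>2))"
proof -
  have "Re (z * cnj z) = (cmod z)\<^sup>2" for z by (simp add: complex_mult_cnj cmod_power2)
  then show ?thesis using density_integrable(2)[OF S_H1[OF u] S_H1[OF u]] by simp
qed

lemma psi_self_le: assumes u: "u \<in> S" shows "psi u u \<le> 2 * Clip * b u u"
proof -
  have H: "u \<in> H1 G A V" using u S_H1 by blast
  have eq: "Re (z * cnj z) = (cmod z)\<^sup>2" for z by (simp add: complex_mult_cnj cmod_power2)
  have "psi u u \<le> gintegral G (\<lambda>e x. (2 * Clip) * (cmod (u e x))\<^sup>2)"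
    unfolding psi_self[OF u]
  proof (rule gintegral_mono)
    show "gintegrable G (\<lambda>e x. 2 * (gam ((cmod (u e x))\<^sup>2) * (cmod (u e x))\<^sup>2))"
      using density_integrable(1)[OF H H] by (simp only: eq)
    show "gintegrable G (\<lambda>e x. (2 * Clip) * (cmod (u e x))\<^sup>2)"
      using H1_L2[OF H] by (intro gintegrable_mult) (simp add: L2_def)
    fix e x
    have "gam ((cmod (u e x))\<^sup>2) * (cmod (u e x))\<^sup>2 \<le> Clip * (cmod (u e x))\<^sup>2"
      using gam_le[of "(cmod (u e x))\<^sup>2"] gmax_le_Clip by (intro mult_right_mono) auto
    then show "2 * (gam ((cmod (u e x))\<^sup>2) * (cmod (u e x))\<^sup>2) \<le> (2 * Clip) * (cmod (u e x))\<^sup>2" by simp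
  qed
  then show ?thesis by (simp only: gintegral_mult b_self)
qed

end

context magnetic_graph
begin

lemma continuous_zero_of_integral:
  fixes f :: "('e, real) gfun"
  assumes int: "gintegrable G f" and nn: "\<And>e x. \<lbrakk>e \<in> edges G; x \<in> I e\<rbrakk> \<Longrightarrow> 0 \<le> f e x"
    and c: "\<And>e. e \<in> edges G \<Longrightarrow> continuous_on (I e) (f e)"
    and zero: "gintegral G f = 0" and e: "e \<in> edges G" and x: "x \<in> I e"
  shows "f e x = 0"
proof -
  obtain l where l: "0 < l" "l \<in> I e" using I_pos[OF e] by blast
  define y where "y = max x l"
  have y: "0 < y" "y \<in> I e" "x \<le> y" using l x by (auto simp: y_def max_def)
  have ie: "set_integrable lebesgue (I e) (f e)" using int e by (simp add: gintegrable_def)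
  have nne: "0 \<le> (LINT x:I e'|lebesgue. f e' x)" if "e' \<in> edges G" for e'
    unfolding set_lebesgue_integral_def
    using nn[OF that] by (intro Bochner_Integration.integral_nonneg) (auto simp: indicator_def)
  have ze: "(LINT x:I e|lebesgue. f e x) = 0"
    using zero e unfolding gintegral_def by (simp add: sum_nonneg_eq_0_iff[OF fin nne])
  have cy: "continuous_on {0..y} (f e)" using c[OF e] I_sub[OF y(2)] continuous_on_subset by blast
  have iy: "set_integrable lebesgue {0..y} (f e)" by (rule continuous_set_integrable[OF cy])
  have "(LINT x:{0..y}|lebesgue. f e x) \<le> (LINT x:I e|lebesgue. f e x)"
    using I_sub[OF y(2)] nn[OF e] by (intro set_integral_subset_le ie) auto
  then have "integral {0..y} (f e) \<le> 0" using ze set_lebesgue_integral_eq_integral(2)[OF iy] by simp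
  moreover have "0 \<le> integral {0..y} (f e)"
    using nn[OF e] I_sub[OF y(2)] by (intro integral_nonneg integrable_continuous_interval cy) auto
  ultimately have "integral {0..y} (f e) = 0" by simp
  moreover have "integral {0..y} (f e) = 0 \<longleftrightarrow> (\<forall>t\<in>{0..y}. f e t = 0)"
    by (rule integral_eq_0_iff[OF cy y(1)]) (use nn[OF e] I_sub[OF y(2)] in blast)
  ultimately have "\<forall>t\<in>{0..y}. f e t = 0" by blast
  moreover have "x \<in> {0..y}" using I_nonneg[OF x] y(3) by simp
  ultimately show ?thesis by blast
qed

lemma b_definite:
  assumes u: "u \<in> S" "b u u = 0" shows "u = 0"
proof (rule S_eqI)
  show "u \<in> S" "0 \<in> S" using u by auto
  fix e x assume e: "e \<in> edges G" and x: "x \<in> I e"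
  have "(cmod (u e x))\<^sup>2 = 0"
  proof (rule continuous_zero_of_integral[where f = "\<lambda>e x. (cmod (u e x))\<^sup>2", OF _ _ _ _ e x])
    show "gintegrable G (\<lambda>e x. (cmod (u e x))\<^sup>2)" using H1_L2[OF S_H1[OF u(1)]] by (simp add: L2_def)
    show "gintegral G (\<lambda>e x. (cmod (u e x))\<^sup>2) = 0" using u(2) by (simp add: b_self)
    show "continuous_on (I e) (\<lambda>x. (cmod (u e x))\<^sup>2)" if "e \<in> edges G" for e
      by (intro continuous_intros continuous_edge[OF H1_cont[OF S_H1[OF u(1)]] that])
  qed simp
  then show "u e x = 0 e x" by simp
qed

end


section \<open>Ground states below the essential spectrum\<close>

context form_pair
begin

text \<open>
  A resolvent bound in \<open>L\<^sup>2\<close>, the norm of \<open>b\<close>, transfers to the energy norm. With \<open>y = u - t K u\<close>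
  it controls \<open>b u u\<close> by \<open>y\<close>, and \<open>a u u = a y u + t * b u u\<close>.
\<close>

lemma bounded_below_of_resolvent_bound:
  assumes t: "0 < t" and C: "\<And>u. u \<in> S \<Longrightarrow> b.nrm (K u) \<le> C * b.nrm (u - t *\<^sub>R K u)"
  shows "\<exists>k>0. \<forall>u\<in>S. k * a u u \<le> a (u - t *\<^sub>R K u) (u - t *\<^sub>R K u)"
proof -
  define c where "c = 1 + t * \<bar>C\<bar>"
  have c: "1 \<le> c" using t by (simp add: c_def)
  have main: "a u u \<le> (1 + 2 * t * c\<^sup>2) * a (u - t *\<^sub>R K u) (u - t *\<^sub>R K u)" if u: "u \<in> S" for u
  proof -
    define y where "y = u - t *\<^sub>R K u"
    have S: "y \<in> S" "t *\<^sub>R K u \<in> S" "K u \<in> S" using u by (auto simp: y_def)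
    have "b.nrm (K u) \<le> \<bar>C\<bar> * b.nrm y"
      using C[OF u] mult_right_mono[OF abs_ge_self, of "b.nrm y" C] S(1) by (simp add: y_def)
    then have "t * b.nrm (K u) \<le> t * (\<bar>C\<bar> * b.nrm y)" using t by (intro mult_left_mono) auto
    moreover have "b.nrm u \<le> b.nrm y + t * b.nrm (K u)"
      using b.triangle[OF S(1,2)] S t by (simp add: y_def b.nrm_scale)
    ultimately have "b.nrm u \<le> c * b.nrm y" by (simp add: c_def algebra_simps)
    also have "\<dots> \<le> c * a.nrm y" using c b_nrm_le[OF S(1)] by (intro mult_left_mono) auto
    finally have "(b.nrm u)\<^sup>2 \<le> (c * a.nrm y)\<^sup>2" using u by (intro power_mono) auto
    then have bu: "b u u \<le> c\<^sup>2 * (a.nrm y)\<^sup>2" using u by (simp add: b.nrm_sq power_mult_distrib)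
    have "a u u = a y u + t * b u u"
      using u S K_form[OF u u] by (simp add: y_def a.bilin)
    also have "\<dots> \<le> a.nrm y * a.nrm u + t * (c\<^sup>2 * (a.nrm y)\<^sup>2)"
      using a.abs_le_nrm[OF S(1) u] bu t by (intro add_mono mult_left_mono) auto
    finally have "(a.nrm u)\<^sup>2 \<le> a.nrm y * a.nrm u + t * (c\<^sup>2 * (a.nrm y)\<^sup>2)" using u by (simp add: a.nrm_sq)
    then have "2 * (a.nrm u)\<^sup>2 \<le> 2 * a.nrm y * a.nrm u + 2 * t * c\<^sup>2 * (a.nrm y)\<^sup>2" by simp
    then have "(a.nrm u)\<^sup>2 \<le> (a.nrm y)\<^sup>2 + 2 * t * c\<^sup>2 * (a.nrm y)\<^sup>2"
      using sum_squares_bound[of "a.nrm y" "a.nrm u"] by linarith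
    then show ?thesis using u S(1) by (simp add: a.nrm_sq y_def[symmetric] algebra_simps)
  qed
  have p: "0 < 1 + 2 * t * c\<^sup>2" using t by (simp add: add_pos_nonneg)
  have "1 / (1 + 2 * t * c\<^sup>2) * a u u \<le> a (u - t *\<^sub>R K u) (u - t *\<^sub>R K u)" if "u \<in> S" for u
    using main[OF that] p by (simp add: field_simps)
  then show ?thesis using p by (intro exI[of _ "1 / (1 + 2 * t * c\<^sup>2)"]) auto
qed

end

lemma sum_gfun_apply: "(\<Sum>i\<in>B. F i) e x = (\<Sum>i\<in>B. F i e x)"
  for F :: "'i \<Rightarrow> 'e \<Rightarrow> real \<Rightarrow> complex"
  by (induction B rule: infinite_finite_induct) auto

text \<open>
  The eigenvalue \<open>E\<close> serves to place the bottom of the spectrum below the essential spectrum.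
\<close>

locale bound_state = magnetic_graph G A V
  for G :: "('v, 'e) mgraph" and A V :: "'e \<Rightarrow> real \<Rightarrow> real" +
  fixes T :: "'e operator" and E :: real
  assumes op: "magnetic_schroedinger G A V T"
    and eig: "eigenvalue G T (complex_of_real E)"
    and below: "ereal E < inf_essential_spectrum G T"
begin

lemma H1_scale: "v \<in> H1 G A V \<Longrightarrow> (\<lambda>e x. c * v e x) \<in> H1 G A V"
  using H1_lincomb(1)[of v v "c - 1"] by (simp add: algebra_simps)

lemma mag_form_scale_right:
  assumes v: "v \<in> H1 G A V" and w: "w \<in> H1 G A V"
  shows "mag_form G A V w (\<lambda>e x. c * v e x) = cnj c * mag_form G A V w v"
proof -
  have "mag_form G A V (\<lambda>e x. c * v e x) w = c * mag_form G A V v w"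
    using mag_form_lincomb_left[OF v v w, of "c - 1"] by (simp add: algebra_simps)
  then show ?thesis using mag_form_cnj[of G A V w] by simp
qed

lemma T_L2: "(u, f) \<in> T \<Longrightarrow> u \<in> L2 G \<and> f \<in> L2 G"
  using op unfolding magnetic_schroedinger_def self_adjoint_def linear_operator_def by blast

lemma T_rep:
  assumes "(u, f) \<in> T"
  obtains w where "w \<in> S" "ae_eq G u w" "\<forall>v\<in>H1 G A V. mag_form G A V w v = L2_inner G f v"
proof -
  obtain z where z: "z \<in> H1 G A V" "ae_eq G u z" "\<forall>v\<in>H1 G A V. mag_form G A V z v = L2_inner G f v"
    using op assms unfolding magnetic_schroedinger_def by fast
  have "ae_eq G u (trunc z)"
    unfolding ae_eq_def
  proof
    fix e assume e: "e \<in> edges G"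
    then have "AE x in lebesgue. x \<in> I e \<longrightarrow> u e x = z e x" using z(2) by (simp add: ae_eq_def)
    then show "AE x in lebesgue. x \<in> I e \<longrightarrow> u e x = trunc z e x"
      by eventually_elim (simp add: e)
  qed
  moreover have "\<forall>v\<in>H1 G A V. mag_form G A V (trunc z) v = L2_inner G f v"
    using z by (simp add: mag_form_trunc_left)
  ultimately show ?thesis using that trunc_S[OF z(1)] by blast
qed

lemma H1_measurable: "u \<in> H1 G A V \<Longrightarrow> gmeasurable G u"
  using H1_L2 by (auto simp: L2_def)

lemma b_trunc_right: "b f (trunc v) = b f v"
  unfolding b_def by (rule arg_cong[where f = Re], rule L2_inner_cong) auto

text \<open>
  A self-adjoint operator contains every pair that satisfies its form identity, because such a pair
  lies in the adjoint. The hypothesis concerns real parts only; the imaginary parts are the real parts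
  for \<open>i v\<close>.
\<close>

lemma T_I:
  assumes w: "w \<in> S" and f: "f \<in> L2 G" and eq: "\<And>v. v \<in> S \<Longrightarrow> a w v = b f v"
  shows "(w, f) \<in> T"
proof -
  have wH: "w \<in> H1 G A V" by (rule S_H1[OF w])
  have re: "Re (mag_form G A V w v) = Re (L2_inner G f v)" if v: "v \<in> H1 G A V" for v
    using eq[OF trunc_S[OF v]] unfolding b_trunc_right
    unfolding a_def H1_inner_def b_def by (simp add: mag_form_trunc_right wH v)
  have full: "mag_form G A V w v = L2_inner G f v" if v: "v \<in> H1 G A V" for v
  proof (rule complex_eqI)
    show "Re (mag_form G A V w v) = Re (L2_inner G f v)" by (rule re[OF v])
    show "Im (mag_form G A V w v) = Im (L2_inner G f v)"
      using re[OF H1_scale[OF v, of \<i>]] by (simp add: mag_form_scale_right v wH L2_inner_scale_right)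
  qed
  have "L2_inner G h w = L2_inner G u f" if uh: "(u, h) \<in> T" for u h
  proof -
    obtain z where z: "z \<in> S" "ae_eq G u z" "\<forall>v\<in>H1 G A V. mag_form G A V z v = L2_inner G h v"
      using T_rep[OF uh] by blast
    have zH: "z \<in> H1 G A V" by (rule S_H1[OF z(1)])
    have "L2_inner G h w = mag_form G A V z w" using z(3) wH by simp
    also have "\<dots> = cnj (mag_form G A V w z)" by (rule mag_form_cnj)
    also have "\<dots> = cnj (L2_inner G f z)" using full[OF zH] by simp
    also have "\<dots> = L2_inner G z f" by (rule L2_inner_cnj[symmetric])
    also have "\<dots> = L2_inner G u f"
      using T_L2[OF uh] f H1_measurable[OF zH] z(2)
      by (intro L2_inner_cong_ae_left[symmetric]) (auto simp: L2_def)
    finally show ?thesis .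
  qed
  then have "(w, f) \<in> adjoint_operator G T"
    using H1_L2[OF wH] f by (auto simp: adjoint_operator_def)
  then show ?thesis using op by (simp add: magnetic_schroedinger_def self_adjoint_def)
qed

lemma eigenfunction: "\<exists>w\<in>S. w \<noteq> 0 \<and> a w w = E * b w w"
proof -
  obtain u where u: "(u, \<lambda>e x. complex_of_real E * u e x) \<in> T" "\<not> ae_eq G u (\<lambda>e x. 0)"
    using eig by (auto simp: eigenvalue_def eigenspace_def)
  obtain w where w: "w \<in> S" "ae_eq G u w" "\<forall>v\<in>H1 G A V. mag_form G A V w v = L2_inner G (\<lambda>e x. complex_of_real E * u e x) v"
    using T_rep[OF u(1)] by blast
  have wH: "w \<in> H1 G A V" by (rule S_H1[OF w(1)])
  have "mag_form G A V w w = L2_inner G (\<lambda>e x. complex_of_real E * u e x) w" using w(3) wH by blast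
  also have "\<dots> = complex_of_real E * L2_inner G u w" by (rule L2_inner_scale_left)
  also have "L2_inner G u w = L2_inner G w w"
    using T_L2[OF u(1)] H1_measurable[OF wH] w(2) by (intro L2_inner_cong_ae_left) (auto simp: L2_def)
  finally have "a w w = E * b w w" by (simp add: a_def H1_inner_def b_def)
  moreover have "w \<noteq> 0"
  proof
    assume "w = 0"
    then have "ae_eq G u (\<lambda>e x. 0)" using w(2) by (simp add: zero_fun_def)
    then show False using u(2) by simp
  qed
  ultimately show ?thesis using w(1) by blast
qed

abbreviation lam where "lam \<equiv> lambda1 G A V"

definition quotients where
  "quotients = {(H1_norm G A V u)\<^sup>2 / (L2_norm G u)\<^sup>2 | u.
     u \<in> H1 G A V \<and> (\<exists>e\<in>edges G. \<exists>x\<in>edge_interval G e. u e x \<noteq> 0)}"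

lemma lam_eq: "lam = Inf quotients"
  by (simp add: lambda1_def quotients_def)

lemma b_pos: "u \<in> S \<Longrightarrow> u \<noteq> 0 \<Longrightarrow> 0 < b u u"
  using b_definite bf.nonneg by (metis less_eq_real_def)

lemma quotients_eq: "quotients = {a u u / b u u | u. u \<in> S \<and> u \<noteq> 0}"
proof (intro equalityI subsetI)
  fix r assume "r \<in> quotients"
  then obtain u where u: "u \<in> H1 G A V" "\<exists>e\<in>edges G. \<exists>x\<in>I e. u e x \<noteq> 0"
      and r: "r = (H1_norm G A V u)\<^sup>2 / (L2_norm G u)\<^sup>2" by (auto simp: quotients_def)
  have t: "trunc u \<in> S" by (rule trunc_S[OF u(1)])
  have "trunc u \<noteq> 0"
  proof
    assume z: "trunc u = 0"
    obtain e x where ex: "e \<in> edges G" "x \<in> I e" "u e x \<noteq> 0" using u(2) by blast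
    then have "trunc u e x \<noteq> 0" by simp
    then show False using z by simp
  qed
  moreover have "a (trunc u) (trunc u) = a u u"
    unfolding a_def H1_inner_def using mag_form_trunc_left[OF u(1) S_H1[OF t]] mag_form_trunc_right[OF u(1) u(1)] by simp
  moreover have "b (trunc u) (trunc u) = b u u"
    unfolding b_self by (rule gintegral_cong) simp
  moreover have "r = a u u / b u u"
    unfolding r H1_norm_sq[OF u(1)] L2_norm_sq b_def ..
  ultimately show "r \<in> {a u u / b u u | u. u \<in> S \<and> u \<noteq> 0}" using t by (intro CollectI exI[of _ "trunc u"]) auto
next
  fix r assume "r \<in> {a u u / b u u | u. u \<in> S \<and> u \<noteq> 0}"
  then obtain u where u: "u \<in> S" "u \<noteq> 0" and r: "r = a u u / b u u" by blast
  have "\<exists>e\<in>edges G. \<exists>x\<in>I e. u e x \<noteq> 0"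
  proof (rule ccontr)
    assume "\<not> ?thesis"
    then have "u = 0" using u by (intro S_eqI) auto
    then show False using u by simp
  qed
  moreover have "r = (H1_norm G A V u)\<^sup>2 / (L2_norm G u)\<^sup>2"
    unfolding r H1_norm_sq[OF S_H1[OF u(1)]] L2_norm_sq b_def ..
  ultimately show "r \<in> quotients" using S_H1[OF u(1)] by (auto simp: quotients_def)
qed

lemma quotients_ge_1: "r \<in> quotients \<Longrightarrow> 1 \<le> r"
  using b_le_a S_H1 b_pos unfolding quotients_eq by fastforce

lemma quotients_nonempty: "quotients \<noteq> {}"
  using eigenfunction unfolding quotients_eq by blast

lemma quotients_bdd: "bdd_below quotients"
  using quotients_ge_1 by (rule bdd_belowI)

lemma lam_le_quotient: "x \<in> S \<Longrightarrow> lam * b x x \<le> a x x"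
proof (cases "x = 0")
  case False
  assume x: "x \<in> S"
  have "lam \<le> a x x / b x x" unfolding lam_eq
    by (rule cInf_lower[OF _ quotients_bdd]) (use x False in \<open>auto simp: quotients_eq\<close>)
  then show ?thesis using b_pos[OF x False] by (simp add: field_simps)
next
  case True
  assume "x \<in> S"
  then show ?thesis using True bf.zero_left af.zero_left by simp
qed

sublocale fp: form_pair S a b lam
proof
  show "1 \<le> lam" unfolding lam_eq using quotients_nonempty quotients_ge_1 by (rule cInf_greatest)
  show "lam * b x x \<le> a x x" if "x \<in> S" for x by (rule lam_le_quotient[OF that])
  fix \<epsilon> :: real assume "0 < \<epsilon>"
  then have "Inf quotients < lam + \<epsilon>" by (simp add: lam_eq)
  then obtain r where "r \<in> quotients" "r < lam + \<epsilon>" using cInf_lessD[OF quotients_nonempty] by blast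
  then obtain u where u: "u \<in> S" "u \<noteq> 0" "a u u / b u u < lam + \<epsilon>" unfolding quotients_eq by blast
  then show "\<exists>x\<in>S. 0 < b x x \<and> a x x < (lam + \<epsilon>) * b x x"
    using b_pos[OF u(1,2)] by (intro bexI[of _ u]) (auto simp: field_simps)
qed

lemma lam_le_E: "lam \<le> E"
proof -
  obtain w where w: "w \<in> S" "w \<noteq> 0" "a w w = E * b w w" using eigenfunction by blast
  have "lam * b w w \<le> E * b w w" using lam_le_quotient[OF w(1)] w(3) by simp
  then show ?thesis using b_pos[OF w(1,2)] by simp
qed

text \<open>
  On the form domain \<open>fp.K\<close> inverts \<open>T\<close>, so the resolvent estimate of \<open>T\<close> is one for \<open>fp.K\<close>.
\<close>

lemma resolvent_bounded_below:
  assumes t: "0 < t" and res: "complex_of_real t \<in> resolvent_set G T"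
  shows "\<exists>k>0. \<forall>u\<in>S. k * a u u \<le> a (u - t *\<^sub>R fp.K u) (u - t *\<^sub>R fp.K u)"
proof -
  obtain C where C: "\<forall>(u, f)\<in>T. L2_norm G u \<le> C * L2_norm G (\<lambda>e x. f e x - complex_of_real t * u e x)"
    using res by (auto simp: resolvent_set_def)
  have nrm: "L2_norm G f = bf.nrm f" for f by (simp add: L2_norm_def bf.nrm_def b_self)
  show ?thesis
  proof (rule fp.bounded_below_of_resolvent_bound[OF t])
    fix u assume u: "u \<in> S"
    have "(fp.K u, u) \<in> T"
      using u by (intro T_I H1_L2 S_H1) (auto simp: fp.K_form)
    then have "L2_norm G (fp.K u) \<le> C * L2_norm G (\<lambda>e x. u e x - complex_of_real t * fp.K u e x)" using C by blast
    moreover have "(\<lambda>e x. u e x - complex_of_real t * fp.K u e x) = u - t *\<^sub>R fp.K u"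
      by (simp add: fun_eq_iff scaleR_conv_of_real)
    ultimately show "bf.nrm (fp.K u) \<le> C * bf.nrm (u - t *\<^sub>R fp.K u)" by (simp add: nrm)
  qed
qed

lemma lam_pos: "0 < lam"
  using fp.lam_ge_1 by simp

text \<open>
  The number \<open>lam\<close> is in the spectrum and at most \<open>E\<close>, hence below the essential spectrum.
\<close>

lemma lam_discrete: "complex_of_real lam \<in> discrete_spectrum G T"
proof -
  have "complex_of_real lam \<notin> resolvent_set G T"
  proof
    assume "complex_of_real lam \<in> resolvent_set G T"
    then obtain k where "k > 0" "\<forall>u\<in>S. k * a u u \<le> a (u - lam *\<^sub>R fp.K u) (u - lam *\<^sub>R fp.K u)"
      using resolvent_bounded_below[OF lam_pos] by blast
    then show False using fp.L_not_bounded_below[of k] by (auto simp: fp.L_def)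
  qed
  then have "complex_of_real lam \<in> spectrum G T" by (simp add: spectrum_def)
  moreover have "complex_of_real lam \<notin> essential_spectrum G T"
  proof
    assume "complex_of_real lam \<in> essential_spectrum G T"
    then have "inf_essential_spectrum G T \<le> ereal lam"
      unfolding inf_essential_spectrum_def by (intro Inf_lower) auto
    also have "\<dots> \<le> ereal E" using lam_le_E by simp
    finally show False using below by simp
  qed
  ultimately show ?thesis by (simp add: essential_spectrum_def)
qed

lemma spectral_gap:
  obtains \<gamma> where "0 < \<gamma>" "\<gamma> < 1" "\<And>u. u \<in> S \<Longrightarrow> \<gamma> * a (fp.L u) u \<le> a (fp.L u) (fp.L u)"
proof -
  have "complex_of_real lam isolated_in spectrum G T"
    using lam_discrete by (simp add: discrete_spectrum_def)
  then obtain U where U: "open U" "U \<inter> spectrum G T = {complex_of_real lam}"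
    by (auto simp: isolated_in_def)
  then have "complex_of_real lam \<in> U" by blast
  then obtain \<eta> where \<eta>: "0 < \<eta>" "ball (complex_of_real lam) \<eta> \<subseteq> U"
    using U(1) open_contains_ball by blast
  have bb: "\<exists>k>0. \<forall>u\<in>S. k * a u u \<le> a (u - t *\<^sub>R fp.K u) (u - t *\<^sub>R fp.K u)" if t: "lam < t" "t < lam + \<eta>" for t
  proof (rule resolvent_bounded_below)
    show "0 < t" using t lam_pos by simp
    have "dist (complex_of_real lam) (complex_of_real t) = \<bar>lam - t\<bar>"
      by (simp add: dist_norm flip: of_real_diff)
    then have "complex_of_real t \<in> U" using t \<eta>(2) by (intro subsetD[OF \<eta>(2)]) simp
    moreover have "complex_of_real t \<noteq> complex_of_real lam" using t by simp
    ultimately have "complex_of_real t \<notin> spectrum G T" using U(2) by blast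
    then show "complex_of_real t \<in> resolvent_set G T" by (simp add: spectrum_def)
  qed
  show ?thesis by (rule fp.L_square_ge[OF \<eta>(1) bb]) (use that in blast)+
qed

text \<open>
  The kernel consists of eigenfunctions of \<open>T\<close>. A complex spanning set of the eigenspace spans
  over the reals when the multiples by \<open>i\<close> are added.
\<close>

lemma kernel_finite_dimensional: "\<exists>B. finite B \<and> B \<subseteq> S \<and> fp.N \<subseteq> span B"
proof -
  obtain B where B: "finite B" "B \<subseteq> eigenspace T (complex_of_real lam)"
      "\<forall>u\<in>eigenspace T (complex_of_real lam). \<exists>c. ae_eq G u (\<lambda>e x. \<Sum>\<beta>\<in>B. c \<beta> * \<beta> e x)"
    using lam_discrete unfolding discrete_spectrum_def finite_multiplicity_def by blast
  have "\<exists>w. w \<in> S \<and> ae_eq G \<beta> w" if "\<beta> \<in> B" for \<beta>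
  proof -
    have "(\<beta>, \<lambda>e x. complex_of_real lam * \<beta> e x) \<in> T" using B(2) that by (auto simp: eigenspace_def)
    from T_rep[OF this] show ?thesis by metis
  qed
  then obtain w where w: "\<And>\<beta>. \<beta> \<in> B \<Longrightarrow> w \<beta> \<in> S" "\<And>\<beta>. \<beta> \<in> B \<Longrightarrow> ae_eq G \<beta> (w \<beta>)" by metis
  define iw where "iw \<beta> = (\<lambda>e x. \<i> * w \<beta> e x)" for \<beta>
  have iwS: "iw \<beta> \<in> S" if "\<beta> \<in> B" for \<beta>
    using H1_scale[OF S_H1[OF w(1)[OF that]], of \<i>] w(1)[OF that] by (auto simp: S_def iw_def)
  let ?B = "w ` B \<union> iw ` B"
  have fB: "finite ?B" using B(1) by simp
  have BS: "?B \<subseteq> S" using w(1) iwS by auto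
  have "y \<in> span ?B" if y: "y \<in> fp.N" for y
  proof -
    have yS: "y \<in> S" using y by (simp add: fp.N_def)
    have "(y, \<lambda>e x. complex_of_real lam * y e x) \<in> T"
    proof (rule T_I[OF yS])
      show "(\<lambda>e x. complex_of_real lam * y e x) \<in> L2 G" by (intro L2_scale H1_L2 S_H1 yS)
      show "a y v = b (\<lambda>e x. complex_of_real lam * y e x) v" if "v \<in> S" for v
        using fp.N_form[OF y that] by (simp add: b_def L2_inner_scale_left)
    qed
    then obtain c where c: "ae_eq G y (\<lambda>e x. \<Sum>\<beta>\<in>B. c \<beta> * \<beta> e x)"
      using B(3) by (auto simp: eigenspace_def)
    define s where "s = (\<Sum>\<beta>\<in>B. Re (c \<beta>) *\<^sub>R w \<beta> + Im (c \<beta>) *\<^sub>R iw \<beta>)"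
    have s_span: "s \<in> span ?B"
      unfolding s_def by (intro span_sum span_add span_scale span_base) auto
    then have sS: "s \<in> S" using span_minimal[OF BS S_subspace] by blast
    have s_apply: "s e x = (\<Sum>\<beta>\<in>B. c \<beta> * w \<beta> e x)" for e x
      unfolding s_def sum_gfun_apply
    proof (rule sum.cong)
      fix \<beta>
      have "c \<beta> = complex_of_real (Re (c \<beta>)) + \<i> * complex_of_real (Im (c \<beta>))" by (simp add: complex_eq)
      then show "(Re (c \<beta>) *\<^sub>R w \<beta> + Im (c \<beta>) *\<^sub>R iw \<beta>) e x = c \<beta> * w \<beta> e x"
        by (simp add: iw_def scaleR_conv_of_real) (metis (no_types, lifting) distrib_right mult.assoc mult.commute)
    qed simp
    have "y - s = 0"
    proof (rule b_definite)
      show "y - s \<in> S" by (rule af.mem(3)[OF yS sS])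
      have ae: "AE x in lebesgue_on (I e). (cmod ((y - s) e x))\<^sup>2 = 0" if e: "e \<in> edges G" for e
      proof -
        have "AE x in lebesgue_on (I e). \<forall>\<beta>\<in>B. \<beta> e x = w \<beta> e x"
          using w(2) e by (intro AE_finite_allI[OF B(1)]) (auto simp: ae_eq_iff)
        moreover have "AE x in lebesgue_on (I e). y e x = (\<Sum>\<beta>\<in>B. c \<beta> * \<beta> e x)"
          using c e by (simp add: ae_eq_iff)
        ultimately show ?thesis
        proof eventually_elim
          case (elim x)
          then have "y e x = (\<Sum>\<beta>\<in>B. c \<beta> * w \<beta> e x)" by simp
          then show ?case by (simp add: s_apply)
        qed
      qed
      have "integral\<^sup>L (lebesgue_on (I e)) (\<lambda>x. (cmod ((y - s) e x))\<^sup>2) = 0" if e: "e \<in> edges G" for e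
        by (rule integral_eq_zero_AE[OF ae[OF e]])
      then show "b (y - s) (y - s) = 0" unfolding b_self gintegral_eq by simp
    qed
    then show ?thesis using s_span by simp
  qed
  then show ?thesis using fB BS by blast
qed

text \<open>
  Substituting \<open>u = sqrt \<mu> w\<close> turns mass \<open>\<mu>\<close> into mass \<open>1\<close> and puts the factor \<open>\<mu> powr q\<close>, where
  \<open>p = 2 q + 2\<close>, in front of the nonlinearity. For small \<open>\<mu>\<close> the truncated problem has a minimiser \<open>w\<close>. Its energy is
  at most \<open>lam + 1\<close>, so \<open>|w| \<le> R\<close> by the embedding into bounded functions, and \<open>w\<close> solves the original equation.
  Since \<open>w\<close> does at least as well as an eigenfunction, \<open>a w w - 2 * \<epsilon> * Psi w \<le> lam\<close>; the multiplier \<open>a w w - \<epsilon> * psi w w\<close> is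
  smaller because \<open>2 * Psi w < psi w w\<close>, which is where \<open>p > 2\<close> enters.
\<close>

theorem small_mass_critical_point:
  assumes p: "2 < p"
  shows "\<exists>\<mu>0>0. \<forall>\<mu>. 0 < \<mu> \<and> \<mu> \<le> \<mu>0 \<longrightarrow>
           (\<exists>u l. constrained_critical_point G A V p \<mu> u l \<and> 0 \<le> l \<and> l < lam)"
proof -
  obtain \<gamma> where \<gamma>: "0 < \<gamma>" "\<gamma> < 1" "\<And>u. u \<in> S \<Longrightarrow> \<gamma> * a (fp.L u) u \<le> a (fp.L u) (fp.L u)"
    using spectral_gap by blast
  obtain B where B: "finite B" "B \<subseteq> S" "fp.N \<subseteq> span B" using kernel_finite_dimensional by blast
  obtain Cs where Cs: "0 \<le> Cs" "\<forall>u\<in>H1 G A V. \<forall>e\<in>edges G. \<forall>x\<in>I e. (cmod (u e x))\<^sup>2 \<le> Cs * a u u"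
    using sup_bound by blast
  define q where "q = (p - 2) / 2"
  (* Cs * (lam + 1) bounds the squared modulus of every function of energy at most lam + 1; the
     summand 1 keeps R positive. *)
  define R where "R = sqrt (Cs * (lam + 1)) + 1"
  have q: "0 < q" using p by (simp add: q_def)
  have CsL: "0 \<le> Cs * (lam + 1)" using Cs(1) lam_pos by simp
  have R: "0 < R" using CsL by (simp add: R_def add_nonneg_pos)
  have R2: "Cs * (lam + 1) \<le> R\<^sup>2"
  proof -
    have "Cs * (lam + 1) = (sqrt (Cs * (lam + 1)))\<^sup>2" using CsL by simp
    also have "\<dots> \<le> R\<^sup>2" using CsL by (intro power_mono) (auto simp: R_def)
    finally show ?thesis .
  qed
  interpret nl: graph_nonlinearity G A V R q
    by unfold_locales (rule R, rule q)
  (* The admissible size of 2 * eps * Clip: the bound 1 keeps the energy of the minimiser at most lam + 1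
     and the multiplier nonnegative, the other bound stays within the spectral gap. *)
  define \<delta> where "\<delta> = min 1 (\<gamma> * lam / 2)"
  have \<delta>: "0 < \<delta>" "\<delta> \<le> 1" "\<delta> \<le> \<gamma> * lam / 2" using \<gamma>(1) lam_pos by (auto simp: \<delta>_def)
  define \<mu>0 where "\<mu>0 = (\<delta> / (nl.Clip + 1)) powr (1 / q)"
  have d0: "0 < \<delta> / (nl.Clip + 1)" using \<delta>(1) nl.Clip_nonneg by simp
  have \<mu>0: "0 < \<mu>0" using \<delta>(1) nl.Clip_nonneg by (auto simp: \<mu>0_def)
  have "\<exists>u l. constrained_critical_point G A V p \<mu> u l \<and> 0 \<le> l \<and> l < lam" if \<mu>: "0 < \<mu>" "\<mu> \<le> \<mu>0" for \<mu>
  proof -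
    (* The factor 1 / 2 compensates the 2 in the derivative nl.psi of nl.Psi. *)
    define \<epsilon> where "\<epsilon> = \<mu> powr q / 2"
    have \<epsilon>: "0 < \<epsilon>" using \<mu> by (simp add: \<epsilon>_def)
    have small: "2 * \<epsilon> * nl.Clip \<le> \<delta>"
    proof -
      have "\<mu> powr q \<le> \<mu>0 powr q" using \<mu> q by (intro powr_mono2) auto
      also have "\<dots> = \<delta> / (nl.Clip + 1)" using q \<delta>(1) nl.Clip_nonneg by (auto simp: \<mu>0_def powr_powr)
      finally have "\<mu> powr q * nl.Clip \<le> \<delta> / (nl.Clip + 1) * nl.Clip"
        using nl.Clip_nonneg by (intro mult_right_mono) auto
      also have "\<dots> \<le> \<delta>" using nl.Clip_nonneg \<delta>(1) by (simp add: field_simps)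
      finally show ?thesis by (simp add: \<epsilon>_def)
    qed
    interpret pert: form_pair_perturbation S a b lam \<gamma> B nl.Psi nl.psi nl.Clip \<epsilon>
    proof
      have "(1 - \<gamma>) * (lam + 2 * \<epsilon> * nl.Clip) \<le> (1 - \<gamma>) * (lam + \<gamma> * lam / 2)"
        using small \<delta>(3) \<gamma>(2) by (intro mult_left_mono) auto
      also have "\<dots> = lam - \<gamma> * lam / 2 - \<gamma>\<^sup>2 * lam / 2" by (simp add: power2_eq_square field_simps)
      also have "\<dots> < lam"
      proof -
        have "0 < \<gamma> * lam / 2" "0 \<le> \<gamma>\<^sup>2 * lam / 2" using \<gamma>(1) lam_pos by auto
        then show ?thesis by linarith
      qed
      finally show "(1 - \<gamma>) * (lam + 2 * \<epsilon> * nl.Clip) < lam" .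
    qed (use \<gamma> B \<epsilon> nl.Clip_nonneg nl.psi_add nl.psi_scale nl.Psi_lower nl.Psi_upper nl.Psi_nonneg nl.Psi_le nl.Psi_scale in auto)
    obtain w where w: "w \<in> S" "b w w = 1" "a w w - 2 * \<epsilon> * nl.Psi w \<le> lam"
        "\<forall>v\<in>S. a w v - \<epsilon> * nl.psi w v = (a w w - \<epsilon> * nl.psi w w) * b w v"
      using pert.constrained_minimizer by blast
    have wH: "w \<in> H1 G A V" by (rule S_H1[OF w(1)])
    have Psi1: "2 * \<epsilon> * nl.Psi w \<le> \<delta>"
    proof -
      have "2 * \<epsilon> * nl.Psi w \<le> 2 * \<epsilon> * nl.Clip"
        using nl.Psi_le[OF w(1)] w(2) \<epsilon> by simp
      then show ?thesis using small by linarith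
    qed
    have sup: "(cmod (w e x))\<^sup>2 \<le> R\<^sup>2" if "e \<in> edges G" "x \<in> I e" for e x
    proof -
      have "(cmod (w e x))\<^sup>2 \<le> Cs * a w w" using Cs(2) wH that by blast
      also have "\<dots> \<le> Cs * (lam + 1)" using w(3) Psi1 \<delta>(2) Cs(1) by (intro mult_left_mono) auto
      also have "\<dots> \<le> R\<^sup>2" by (rule R2)
      finally show ?thesis .
    qed
    define l where "l = a w w - \<epsilon> * nl.psi w w"
    have l0: "0 \<le> l"
    proof -
      have "\<epsilon> * nl.psi w w \<le> \<epsilon> * (2 * nl.Clip)" using nl.psi_self_le[OF w(1)] w(2) \<epsilon> by simp
      then have "\<epsilon> * nl.psi w w \<le> 1" using small \<delta>(2) by simp
      then show ?thesis using lam_le_quotient[OF w(1)] w(2) fp.lam_ge_1 by (simp add: l_def)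
    qed
    (* If the pointwise strict inequality Gam_less failed to integrate strictly, then w would vanish. *)
    have strict: "2 * nl.Psi w < nl.psi w w"
    proof (rule ccontr)
      assume ns: "\<not> ?thesis"
      define f where "f e x = 2 * (nl.gam ((cmod (w e x))\<^sup>2) * (cmod (w e x))\<^sup>2) - 2 * nl.Gam ((cmod (w e x))\<^sup>2)" for e x
      have i1: "gintegrable G (\<lambda>e x. 2 * (nl.gam ((cmod (w e x))\<^sup>2) * (cmod (w e x))\<^sup>2))"
      proof -
        have "Re (z * cnj z) = (cmod z)\<^sup>2" for z by (simp add: complex_mult_cnj cmod_power2)
        then show ?thesis using nl.density_integrable(1)[OF wH wH] by (simp only:)
      qed
      have i2: "gintegrable G (\<lambda>e x. 2 * nl.Gam ((cmod (w e x))\<^sup>2))"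
        by (intro gintegrable_mult nl.Gam_gintegrable wH)
      have fi: "gintegrable G f" unfolding f_def by (rule gintegrable_diff[OF i1 i2])
      have f0: "0 \<le> f e x" for e x using nl.Gam_le[of "(cmod (w e x))\<^sup>2"] by (simp add: f_def)
      have "gintegral G f = nl.psi w w - 2 * nl.Psi w"
        unfolding f_def gintegral_diff[OF i1 i2] by (simp add: nl.psi_self[OF w(1)] gintegral_mult nl.Psi_def)
      then have fz: "gintegral G f = 0" using ns gintegral_nonneg[of G f] f0 by (simp add: order.antisym)
      have fc: "continuous_on (I e) (f e)" if "e \<in> edges G" for e
        unfolding f_def
        by (intro continuous_intros continuous_edge[OF H1_cont[OF wH] that]
            nl.continuous_density[OF H1_cont[OF wH] that nl.gam_continuous]
            nl.continuous_density[OF H1_cont[OF wH] that nl.Gam_continuous])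
      have "w = 0"
      proof (rule S_eqI[OF w(1)])
        fix e x assume e: "e \<in> edges G" and x: "x \<in> I e"
        have z: "f e x = 0" by (rule continuous_zero_of_integral[OF fi f0 fc fz e x])
        show "w e x = 0 e x"
        proof (rule ccontr)
          assume "w e x \<noteq> 0 e x"
          then have "0 < (cmod (w e x))\<^sup>2" by simp
          then show False using nl.Gam_less[OF _ sup[OF e x]] z by (simp add: f_def)
        qed
      qed simp
      then show False using w(2) bf.zero_left[of 0] by simp
    qed
    have l1: "l < lam"
    proof -
      have "\<epsilon> * (2 * nl.Psi w) < \<epsilon> * nl.psi w w" using strict \<epsilon> by simp
      then show ?thesis using w(3) by (simp add: l_def)
    qed
    define u where "u = sqrt \<mu> *\<^sub>R w"
    have u_apply: "u e x = complex_of_real (sqrt \<mu>) * w e x" for e x by (simp add: u_def scaleR_conv_of_real)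
    have uS: "u \<in> S" unfolding u_def by (rule af.mem(4)[OF w(1)])
    have mass: "u \<in> mass_sphere G A V \<mu>"
    proof -
      have "b u u = \<mu>" using w(1,2) \<mu> by (simp add: u_def bf.bilin)
      then show ?thesis using S_H1[OF uS] by (simp add: mass_sphere_def b_self)
    qed
    have "H1_inner G A V u v
          - Re (gintegral G (\<lambda>e x. of_real (cmod (u e x) powr (p - 2)) * u e x * cnj (v e x)))
        = l * Re (L2_inner G u v)" if v: "v \<in> H1 G A V" for v
    proof -
      define v' where "v' = trunc v"
      have v': "v' \<in> S" unfolding v'_def by (rule trunc_S[OF v])
      have e1: "H1_inner G A V u v = sqrt \<mu> * a w v'"
      proof -
        have "H1_inner G A V u v = a u v'"
          unfolding a_def H1_inner_def v'_def by (simp add: mag_form_trunc_right S_H1[OF uS] v)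
        then show ?thesis using w(1) v' by (simp add: u_def af.scale_left)
      qed
      have e2: "Re (L2_inner G u v) = sqrt \<mu> * b w v'"
      proof -
        have "Re (L2_inner G u v) = b u v'" unfolding v'_def b_trunc_right by (simp add: b_def)
        then show ?thesis using w(1) v' by (simp add: u_def bf.scale_left)
      qed
      have "gintegral G (\<lambda>e x. of_real (cmod (u e x) powr (p - 2)) * u e x * cnj (v e x))
        = gintegral G (\<lambda>e x. complex_of_real (\<mu> powr q * sqrt \<mu>) * (nl.force w e x * cnj (v e x)))"
      proof (rule gintegral_cong)
        fix e x assume e: "e \<in> edges G" and x: "x \<in> I e"
        have cR: "cmod (w e x) \<le> R" using sup[OF e x] R by (simp add: power2_le_iff_abs_le)
        have q2: "p - 2 = 2 * q" by (simp add: q_def)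
        have "cmod (u e x) powr (p - 2) = (sqrt \<mu> * cmod (w e x)) powr (2 * q)"
          using \<mu>(1) by (simp add: u_apply norm_mult q2)
        also have "\<dots> = sqrt \<mu> powr (2 * q) * cmod (w e x) powr (2 * q)" using \<mu>(1) by (simp add: powr_mult)
        also have "sqrt \<mu> powr (2 * q) = \<mu> powr q" using nl.sq_powr[of "sqrt \<mu>"] \<mu>(1) by simp
        also have "cmod (w e x) powr (2 * q) = nl.gam ((cmod (w e x))\<^sup>2)" using cR by (simp add: nl.gam_sq)
        finally show "of_real (cmod (u e x) powr (p - 2)) * u e x * cnj (v e x)
          = complex_of_real (\<mu> powr q * sqrt \<mu>) * (nl.force w e x * cnj (v e x))"
          by (simp add: u_apply nl.force_def)
      qed
      also have "\<dots> = complex_of_real (\<mu> powr q * sqrt \<mu>) * L2_inner G (nl.force w) v"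
        unfolding gintegral_mult L2_inner_def ..
      finally have "Re (gintegral G (\<lambda>e x. of_real (cmod (u e x) powr (p - 2)) * u e x * cnj (v e x)))
        = \<mu> powr q * sqrt \<mu> * b (nl.force w) v" by (simp add: b_def)
      also have "\<dots> = sqrt \<mu> * (\<epsilon> * nl.psi w v')"
        by (simp add: \<epsilon>_def nl.psi_def v'_def b_trunc_right)
      finally have e3: "Re (gintegral G (\<lambda>e x. of_real (cmod (u e x) powr (p - 2)) * u e x * cnj (v e x)))
        = sqrt \<mu> * (\<epsilon> * nl.psi w v')" .
      have "a w v' - \<epsilon> * nl.psi w v' = l * b w v'" using w(4) v' by (simp add: l_def)
      then show ?thesis unfolding e1 e2 e3 by (simp flip: right_diff_distrib)
    qed
    then have "constrained_critical_point G A V p \<mu> u l"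
      using mass by (simp add: constrained_critical_point_def)
    then show ?thesis using l0 l1 by blast
  qed
  then show ?thesis using \<mu>0 by blast
qed

end


section \<open>Critical points of small mass\<close>

theorem theorem1p6:
  fixes G :: "('v, 'e) mgraph"
    and A V :: "'e \<Rightarrow> real \<Rightarrow> real"
    and p :: real
    and T :: "'e operator"
    and m :: enat
    and lam :: "nat \<Rightarrow> real"
  assumes "metric_graph G"
    and "connected_graph G"
    and "noncompact_graph G"
    and "finite (edges G)"
    and "p > 2"
    and "A \<in> L2_loc G"
    and "V \<in> L1_loc G"
    and "\<forall>e\<in>edges G. \<forall>x\<in>edge_interval G e. 1 \<le> V e x"
    and "magnetic_schroedinger G A V T"
    and "1 \<le> m"
    and "1 \<le> lam 1"
    and "strict_mono_on {j. 1 \<le> j \<and> enat j \<le> m} lam"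
    and "\<forall>j. 1 \<le> j \<and> enat j \<le> m \<longrightarrow>
           eigenvalue G T (complex_of_real (lam j)) \<and>
           ereal (lam j) < inf_essential_spectrum G T"
  shows "\<exists>\<mu>0>0. \<forall>\<mu>. 0 < \<mu> \<and> \<mu> \<le> \<mu>0 \<longrightarrow>
           (\<exists>u l. constrained_critical_point G A V p \<mu> u l \<and> 0 \<le> l \<and> l < lambda1 G A V)"
proof -
  have "bound_state G A V T (lam 1)"
  proof (intro bound_state.intro bound_state_axioms.intro magnetic_graph.intro)
    have "enat 1 \<le> m" using \<open>1 \<le> m\<close> by (simp add: one_enat_def)
    then show "eigenvalue G T (complex_of_real (lam 1))" "ereal (lam 1) < inf_essential_spectrum G T"
      using assms by auto
  qed (use assms in auto)
  from bound_state.small_mass_critical_point[OF this \<open>2 < p\<close>] show ?thesis .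
qed

end
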